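(* Let $G$ be a finitely generated nilpotent group and let $k\ge 2$ be a real number such that the Dehn function of $G$ satisfies $\delta(n)=O(n^k)$. Then for every finite presentation of $G$, the averaged Dehn function $\delta^{\mathrm{avg}}$ of that presentation satisfies: if $k>2$, then $\delta^{\mathrm{avg}}(n)=O(n^{k/2})$; and if $k=2$, then $\delta^{\mathrm{avg}}(n)=O(n\log n)$.
   Context: Let $G=\langle e_1,\dots,e_d\mid r_1,\dots,r_s\rangle$ be a finite presentation of a group with identity $e$; let $F$ be the free group on $e_1,\dots,e_d$ and $R\trianglelefteq F$ the normal closure of $r_1,\dots,r_s$, so $G=F/R$. Filling area: for $w\in R$ (or a word in the $e_i^{\pm1}$ representing the identity of $G$, regarded as an element of $R\subset F$), $\delta(w)$ is the minimal $k$ such that $w=\prod_{i=1}^k g_i^{-1}r_{a_i}^{\pm1}g_i$ in $F$ for some $g_i\in F$ and indices $a_i\in\{1,\dots,s\}$. Dehn function: $\delta(n)=\max_{w\in R\cap B(n)}\delta(w)$, where $B(n)$ is the ball of radius $n$ about the identity in $F$ (word metric for $e_1,\dots,e_d$). For $k>1$, whether $\delta(n)=O(n^k)$ does not depend on the choice of finite presentation. Averaged Dehn function: a lazy word of length $n$ is a sequence $(a_1,\dots,a_n)$ of letters $a_j\in\{e_1,e_1^{-1},\dots,e_d,e_d^{-1},e\}$ (an alphabet of $2d+1$ letters, $e$ standing for the identity); it is read as the product $a_1a_2\cdots a_n$ in $F$ or in $G$. Let $\overline{\rho}_n$ be the uniform probability measure on the (nonempty) set of lazy words of length $n$ with $a_1\cdots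 a_n=e$ in $G$; equivalently, it is the law of the $n$-step random walk from $e$, with each step uniformly distributed over the $2d+1$ letters, conditioned to return to $e$ at time $n$. Then $\delta^{\mathrm{avg}}(n)=\sum_w \delta(w)\,\overline{\rho}_n(w)$. $f(n)=O(g(n))$ means that there are $M,n_0$ with $f(n)\le M g(n)$ for all $n>n_0$. *)

theory Defs
  imports
    "HOL-Probability.Probability_Mass_Function"
    "HOL-Library.Landau_Symbols"
    "HOL-Algebra.Generated_Groups"
begin

section \<open>Free groups of finite rank\<close>

text \<open>The pair \<open>(i, True)\<close> stands for the generator \<open>e\<^sub>i\<close> and \<open>(i, False)\<close> for its inverse.
  Generators are numbered from 0, so those of the free group of rank \<open>d\<close> are the \<open>i < d\<close>.
  Elements of the free group are the reduced words.\<close>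

type_synonym letter = "nat \<times> bool"

definition letters :: "nat \<Rightarrow> letter set" where
  "letters d = {..<d} \<times> UNIV"

definition inv_letter :: "letter \<Rightarrow> letter" where
  "inv_letter x = (fst x, \<not> snd x)"

definition reduced :: "letter list \<Rightarrow> bool" where
  "reduced = successively (\<lambda>x y. y \<noteq> inv_letter x)"

fun cancel_cons :: "letter \<Rightarrow> letter list \<Rightarrow> letter list" where
  "cancel_cons x [] = [x]"
| "cancel_cons x (y # ys) = (if y = inv_letter x then ys else x # y # ys)"

definition free_group :: "nat \<Rightarrow> letter list monoid" where
  "free_group d =
     \<lparr>carrier = {w. set w \<subseteq> letters d \<and> reduced w},
      mult = (\<lambda>u v. foldr cancel_cons u v),
      one = []\<rparr>"

lemma inv_letter_inv_letter [simp]: "inv_letter (inv_letter x) = x"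
  by (simp add: inv_letter_def)

lemma inv_letter_neq [simp]: "inv_letter x \<noteq> x" "x \<noteq> inv_letter x"
  by (auto simp: inv_letter_def prod_eq_iff)

lemma inv_letter_in_letters [simp]: "inv_letter x \<in> letters d \<longleftrightarrow> x \<in> letters d"
  by (cases x) (auto simp: inv_letter_def letters_def)

lemma reduced_simps [simp]:
  "reduced []" "reduced [x]"
  "reduced (x # y # ys) \<longleftrightarrow> y \<noteq> inv_letter x \<and> reduced (y # ys)"
  by (simp_all add: reduced_def)

lemma reduced_tl: "reduced (x # xs) \<Longrightarrow> reduced xs"
  by (cases xs) auto

lemma reduced_cancel_cons: "reduced w \<Longrightarrow> reduced (cancel_cons x w)"
  by (cases w) (auto dest: reduced_tl)

lemma reduced_foldr_cancel_cons: "reduced w \<Longrightarrow> reduced (foldr cancel_cons u w)"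
  by (induction u) (auto intro: reduced_cancel_cons)

lemma set_cancel_cons: "set (cancel_cons x w) \<subseteq> insert x (set w)"
  by (cases w) auto

lemma set_foldr_cancel_cons: "set (foldr cancel_cons u w) \<subseteq> set u \<union> set w"
  by (induction u) (use set_cancel_cons in fastforce)+

lemma cancel_cons_inv: "reduced w \<Longrightarrow> cancel_cons x (cancel_cons (inv_letter x) w) = w"
  by (cases w rule: remdups_adj.cases) auto

lemma cancel_cons_reduced: "reduced (x # w) \<Longrightarrow> cancel_cons x w = x # w"
  by (cases w) auto

lemma foldr_cancel_cons_Nil: "reduced w \<Longrightarrow> foldr cancel_cons w [] = w"
proof (induction w)
  case (Cons x w)
  then have "foldr cancel_cons w [] = w" using reduced_tl by blast
  then show ?case using Cons.prems by (simp add: cancel_cons_reduced)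
qed simp

lemma foldr_cancel_cons_cancel_cons:
  assumes "reduced w"
  shows "foldr cancel_cons (cancel_cons x v) w = cancel_cons x (foldr cancel_cons v w)"
proof (cases v)
  case (Cons y ys)
  have "cancel_cons x (cancel_cons (inv_letter x) (foldr cancel_cons ys w)) = foldr cancel_cons ys w"
    using assms by (intro cancel_cons_inv reduced_foldr_cancel_cons)
  then show ?thesis using Cons by auto
qed auto

lemma foldr_cancel_cons_assoc:
  assumes "reduced w"
  shows "foldr cancel_cons (foldr cancel_cons u v) w = foldr cancel_cons u (foldr cancel_cons v w)"
  by (induction u) (simp_all add: foldr_cancel_cons_cancel_cons assms)

lemma foldr_cancel_cons_inverse:
  "reduced w \<Longrightarrow> foldr cancel_cons (foldr cancel_cons (rev (map inv_letter u)) []) (foldr cancel_cons u w) = w"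
proof (induction u arbitrary: w)
  case (Cons x u)
  have "foldr cancel_cons (rev (map inv_letter u)) (cancel_cons (inv_letter x) (cancel_cons x (foldr cancel_cons u w)))
      = foldr cancel_cons (rev (map inv_letter u)) (foldr cancel_cons u w)"
    using cancel_cons_inv[of "foldr cancel_cons u w" "inv_letter x"] Cons.prems
    by (simp add: reduced_foldr_cancel_cons)
  then show ?case
    using Cons by (simp add: foldr_cancel_cons_assoc reduced_foldr_cancel_cons reduced_cancel_cons)
qed auto

lemma group_free_group: "group (free_group d)"
proof (rule groupI)
  fix x y assume "x \<in> carrier (free_group d)" "y \<in> carrier (free_group d)"
  then show "x \<otimes>\<^bsub>free_group d\<^esub> y \<in> carrier (free_group d)"
    using set_foldr_cancel_cons[of x y] by (auto simp: free_group_def reduced_foldr_cancel_cons)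
next
  fix x assume x: "x \<in> carrier (free_group d)"
  let ?y = "foldr cancel_cons (rev (map inv_letter x)) []"
  have "?y \<in> carrier (free_group d)"
    using set_foldr_cancel_cons[of "rev (map inv_letter x)" "[]"] x
    by (auto simp: free_group_def reduced_foldr_cancel_cons subset_iff image_iff) fastforce
  moreover have "?y \<otimes>\<^bsub>free_group d\<^esub> x = \<one>\<^bsub>free_group d\<^esub>"
    using foldr_cancel_cons_inverse[of "[]" x] x by (simp add: free_group_def foldr_cancel_cons_Nil)
  ultimately show "\<exists>y\<in>carrier (free_group d). y \<otimes>\<^bsub>free_group d\<^esub> x = \<one>\<^bsub>free_group d\<^esub>" by blast
qed (auto simp: free_group_def foldr_cancel_cons_assoc)

text \<open>The elements of the free group represented by a word, not necessarily reduced, and by a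
  lazy word, in which \<open>None\<close> is the letter \<open>e\<close>.\<close>

definition word_value :: "nat \<Rightarrow> letter list \<Rightarrow> letter list" where
  "word_value d w = foldr (\<otimes>\<^bsub>free_group d\<^esub>) (map (\<lambda>x. [x]) w) \<one>\<^bsub>free_group d\<^esub>"

definition lazy_value :: "nat \<Rightarrow> letter option list \<Rightarrow> letter list" where
  "lazy_value d a =
     foldr (\<otimes>\<^bsub>free_group d\<^esub>)
       (map (\<lambda>t. case t of None \<Rightarrow> \<one>\<^bsub>free_group d\<^esub> | Some x \<Rightarrow> [x]) a) \<one>\<^bsub>free_group d\<^esub>"

definition word_ball :: "nat \<Rightarrow> nat \<Rightarrow> letter list set" where
  "word_ball d n = {word_value d w | w. set w \<subseteq> letters d \<and> length w \<le> n}"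


section \<open>Finite presentations and nilpotency\<close>

definition normal_closure :: "('a, 'b) monoid_scheme \<Rightarrow> 'a set \<Rightarrow> 'a set" where
  "normal_closure G S = \<Inter>{N. N \<lhd> G \<and> S \<subseteq> N}"

abbreviation relations :: "nat \<Rightarrow> letter list list \<Rightarrow> letter list set" where
  "relations d rs \<equiv> normal_closure (free_group d) (set rs)"

definition finite_presentation_of ::
    "('a, 'b) monoid_scheme \<Rightarrow> nat \<Rightarrow> letter list list \<Rightarrow> bool" where
  "finite_presentation_of G d rs \<longleftrightarrow>
     set rs \<subseteq> carrier (free_group d) \<and> free_group d Mod relations d rs \<cong> G"

definition finitely_generated_group :: "('a, 'b) monoid_scheme \<Rightarrow> bool" where
  "finitely_generated_group G \<longleftrightarrow>
     group G \<and> (\<exists>S. finite S \<and> S \<subseteq> carrier G \<and> generate G S = carrier G)"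

fun lower_central :: "('a, 'b) monoid_scheme \<Rightarrow> nat \<Rightarrow> 'a set" where
  "lower_central G 0 = carrier G"
| "lower_central G (Suc n) =
     generate G (\<Union>h \<in> lower_central G n. \<Union>g \<in> carrier G.
       {h \<otimes>\<^bsub>G\<^esub> g \<otimes>\<^bsub>G\<^esub> inv\<^bsub>G\<^esub> h \<otimes>\<^bsub>G\<^esub> inv\<^bsub>G\<^esub> g})"

definition nilpotent_group :: "('a, 'b) monoid_scheme \<Rightarrow> bool" where
  "nilpotent_group G \<longleftrightarrow> group G \<and> (\<exists>c. lower_central G c = {\<one>\<^bsub>G\<^esub>})"


section \<open>Filling area, Dehn function and averaged Dehn function\<close>

definition relator_conjugates :: "nat \<Rightarrow> letter list list \<Rightarrow> letter list set" where
  "relator_conjugates d rs =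
     (\<Union>g \<in> carrier (free_group d). \<Union>r \<in> set rs.
        {inv\<^bsub>free_group d\<^esub> g \<otimes>\<^bsub>free_group d\<^esub> r \<otimes>\<^bsub>free_group d\<^esub> g,
         inv\<^bsub>free_group d\<^esub> g \<otimes>\<^bsub>free_group d\<^esub> inv\<^bsub>free_group d\<^esub> r \<otimes>\<^bsub>free_group d\<^esub> g})"

definition filling_area :: "nat \<Rightarrow> letter list list \<Rightarrow> letter list \<Rightarrow> nat" where
  "filling_area d rs w =
     (LEAST k. \<exists>cs. length cs = k \<and> set cs \<subseteq> relator_conjugates d rs \<and>
        w = foldr (\<otimes>\<^bsub>free_group d\<^esub>) cs \<one>\<^bsub>free_group d\<^esub>)"

definition dehn_function :: "nat \<Rightarrow> letter list list \<Rightarrow> nat \<Rightarrow> nat" where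
  "dehn_function d rs n = Max (filling_area d rs ` (relations d rs \<inter> word_ball d n))"

definition lazy_loops :: "nat \<Rightarrow> letter list list \<Rightarrow> nat \<Rightarrow> letter option list set" where
  "lazy_loops d rs n =
     {a. length a = n \<and> set a \<subseteq> insert None (Some ` letters d) \<and> lazy_value d a \<in> relations d rs}"

definition avg_dehn_function :: "nat \<Rightarrow> letter list list \<Rightarrow> nat \<Rightarrow> real" where
  "avg_dehn_function d rs n =
     (\<Sum>a \<in> lazy_loops d rs n.
        real (filling_area d rs (lazy_value d a)) * pmf (pmf_of_set (lazy_loops d rs n)) a)"

text \<open>The sets under \<open>Max\<close> and \<open>pmf_of_set\<close> are finite and nonempty, and \<open>normal_closure\<close> is
  an intersection over a nonempty family, so none of these takes a default value.\<close>

lemma finite_letters: "finite (letters d)"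
  by (simp add: letters_def)

lemma carrier_normal: "group G \<Longrightarrow> carrier G \<lhd> G"
  by (simp add: group.normal_inv_iff group.subgroup_self group.inv_closed group.is_monoid monoid.m_closed)

lemma one_in_normal_closure: "\<one>\<^bsub>G\<^esub> \<in> normal_closure G S"
  by (auto simp: normal_closure_def dest: normal_imp_subgroup intro: subgroup.one_closed)

lemma finite_word_ball: "finite (word_ball d n)"
proof -
  have "word_ball d n = word_value d ` {w. set w \<subseteq> letters d \<and> length w \<le> n}"
    by (auto simp: word_ball_def)
  then show ?thesis by (simp add: finite_lists_length_le finite_letters)
qed

lemma one_in_word_ball: "\<one>\<^bsub>free_group d\<^esub> \<in> word_ball d n"
  by (auto simp: word_ball_def word_value_def intro!: exI[of _ "[]"])

lemma finite_lazy_loops: "finite (lazy_loops d rs n)"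
  by (rule finite_subset[OF _ finite_lists_length_eq[of "insert None (Some ` letters d)" n]])
    (auto simp: lazy_loops_def finite_letters)

lemma lazy_loops_nonempty: "lazy_loops d rs n \<noteq> {}"
proof -
  have "lazy_value d (replicate n None) = \<one>\<^bsub>free_group d\<^esub>"
    by (induction n) (auto simp: lazy_value_def free_group_def)
  then have "replicate n None \<in> lazy_loops d rs n"
    using one_in_normal_closure[of "free_group d" "set rs"] by (auto simp: lazy_loops_def)
  then show ?thesis by blast
qed

end

theory Submission
  imports Defs
begin

text \<open>
  Cut a random loop of length n at the multiples of \<open>2\<^sup>i\<close> and join consecutive cutting points by
  geodesics of \<open>G\<close>. Passing from scale i to scale i + 1 fills about \<open>n / 2\<^sup>i\<close> geodesic triangles whose
  sides have typical length \<open>2\<^sup>i\<^sup>/\<^sup>2\<close>, hence area of order \<open>2\<^sup>i\<^sup>k\<^sup>/\<^sup>2\<close>. Summing over i gives \<open>n\<^sup>k\<^sup>/\<^sup>2\<close> if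
  \<open>k > 2\<close> and n log n if \<open>k = 2\<close>.

  It remains to see that a segment of length m of the bridge has its k-th moment bounded by a
  multiple of \<open>m\<^sup>k\<^sup>/\<^sup>2\<close>. The only input from nilpotency is that balls are doubling, which follows by
  collecting commutators, the letters of weight w being counted with mass \<open>r\<^sup>-\<^sup>w\<close>. Doubling yields
  \<open>p\<^sub>n(x) \<le> C / V(\<surd>n)\<close> by a Nash-type inequality, Gaussian moments by propagating the weights
  \<open>exp (\<bar>x\<bar> / \<surd>N)\<close>, and from these the matching lower bound for \<open>p\<^sub>n(e)\<close>. Hence the bridge law of
  a segment of length at most about n / 2 is dominated by the law of the free walk.
\<close>

section \<open>Words in weighted commutators\<close>

text \<open>Two obstacles shape the proof. Doubling needs one radius C r that serves every dilation
  factor: if the covering constant grew with the mass to be covered, balls would only be compared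
  with balls of an uncontrolled radius. Hence the care in \<open>cover_layer\<close>. On the side of
  the walk no pointwise Gaussian estimate is proved; weighted l2-norms, which behave well under one
  symmetric step, are turned into moments by Cauchy-Schwarz against the volume. A segment of m
  letters of the bridge has density p_m(x) p_{n-m}(x^-1) / p_n(e), so comparing it with the free
  walk only needs a bound for p_{n-m} / p_n(e), available while n - m is comparable with n. The
  filling is organised top down by halving, so n need not be a power of 2, and each triangle is
  charged to its two short sides: the third side, which may come from the whole loop, never needs a
  moment. Laziness enters in three places: it reduces increments over two steps to one step, it
  leaves part of the Dirichlet form to absorb the variation of a weight, and it removes
  parity.\<close>

definition lprod :: "('a, 'b) monoid_scheme \<Rightarrow> 'a list \<Rightarrow> 'a" where
  "lprod G xs = foldr (\<otimes>\<^bsub>G\<^esub>) xs \<one>\<^bsub>G\<^esub>"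

definition commutator :: "('a, 'b) monoid_scheme \<Rightarrow> 'a \<Rightarrow> 'a \<Rightarrow> 'a" where
  "commutator G x y = inv\<^bsub>G\<^esub> x \<otimes>\<^bsub>G\<^esub> inv\<^bsub>G\<^esub> y \<otimes>\<^bsub>G\<^esub> x \<otimes>\<^bsub>G\<^esub> y"

lemma lprod_Nil [simp]: "lprod G [] = \<one>\<^bsub>G\<^esub>"
  by (simp add: lprod_def)

lemma lprod_Cons [simp]: "lprod G (x # xs) = x \<otimes>\<^bsub>G\<^esub> lprod G xs"
  by (simp add: lprod_def)

context group
begin

lemma inv_cancel [simp]:
  "x \<in> carrier G \<Longrightarrow> y \<in> carrier G \<Longrightarrow> inv x \<otimes> (x \<otimes> y) = y"
  "x \<in> carrier G \<Longrightarrow> y \<in> carrier G \<Longrightarrow> x \<otimes> (inv x \<otimes> y) = y"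
  by (simp_all flip: m_assoc)

lemma lprod_closed [simp]: "set xs \<subseteq> carrier G \<Longrightarrow> lprod G xs \<in> carrier G"
  by (induction xs) auto

lemma lprod_append:
  "set xs \<subseteq> carrier G \<Longrightarrow> set ys \<subseteq> carrier G \<Longrightarrow> lprod G (xs @ ys) = lprod G xs \<otimes> lprod G ys"
  by (induction xs) (auto simp: m_assoc)

lemma lprod_replicate: "x \<in> carrier G \<Longrightarrow> lprod G (replicate n x) = x [^] n"
proof (induction n)
  case (Suc n)
  then show ?case using nat_pow_comm[of x 1 n] by simp
qed simp

lemma commutator_closed [simp]: "x \<in> carrier G \<Longrightarrow> y \<in> carrier G \<Longrightarrow> commutator G x y \<in> carrier G"
  by (simp add: commutator_def)

lemma inv_commutator: "x \<in> carrier G \<Longrightarrow> y \<in> carrier G \<Longrightarrow> inv (commutator G x y) = commutator G y x"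
  by (simp add: commutator_def m_assoc inv_mult_group)

lemma subgroup_lower_central: "subgroup (lower_central G n) G"
proof (induction n)
  case (Suc n)
  have "h \<in> carrier G" if "h \<in> lower_central G n" for h
    using Suc that by (rule subgroup.mem_carrier)
  then show ?case
    unfolding lower_central.simps by (intro generate_is_subgroup) auto
qed (simp add: subgroup_self)

lemma commutator_lower_central:
  assumes "x \<in> lower_central G n" "y \<in> carrier G"
  shows "commutator G x y \<in> lower_central G (Suc n)" "commutator G y x \<in> lower_central G (Suc n)"
proof -
  have x: "x \<in> carrier G"
    by (rule subgroup.mem_carrier[OF subgroup_lower_central assms(1)])
  have ix: "inv x \<in> lower_central G n"
    by (rule subgroup.m_inv_closed[OF subgroup_lower_central assms(1)])
  have "commutator G x y = inv x \<otimes> inv y \<otimes> inv (inv x) \<otimes> inv (inv y)"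
    using x assms by (simp add: commutator_def)
  then show *: "commutator G x y \<in> lower_central G (Suc n)"
    unfolding lower_central.simps using ix assms(2)
    by (intro generate.incl UN_I[of "inv x"] UN_I[of "inv y"]) auto
  show "commutator G y x \<in> lower_central G (Suc n)"
    using subgroup.m_inv_closed[OF subgroup_lower_central *] x assms(2) by (simp add: inv_commutator)
qed

end

text \<open>The weight of an iterated commutator is its number of leaves. A bracket tree with more than
  \<open>2\<^sup>i\<close> leaves has a branch of length greater than i, so in class c all brackets of weight above
  \<open>2\<^sup>c\<close> are trivial. This rough bound makes the inclusion of \<open>[\<gamma>\<^sub>a, \<gamma>\<^sub>b]\<close> in \<open>\<gamma>\<^sub>a\<^sub>+\<^sub>b\<close>
  unnecessary.\<close>

inductive bracket :: "('a, 'b) monoid_scheme \<Rightarrow> 'a set \<Rightarrow> nat \<Rightarrow> 'a \<Rightarrow> bool" for G E where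
  base: "x \<in> E \<Longrightarrow> bracket G E 1 x"
| comm: "bracket G E a x \<Longrightarrow> bracket G E b y \<Longrightarrow> bracket G E (a + b) (commutator G x y)"

type_synonym 'a weighted_word = "(nat \<times> 'a) list"

text \<open>A bound on the mass at scale r says that there are \<open>O(r\<^sup>w)\<close> letters of weight w for every w.
  Conjugation by a letter y multiplies the mass by at most \<open>1 + r\<^sup>-\<^sup>w\<close>, where w is the weight
  of y, hence conjugation by a word Y by at most \<open>exp (mass r Y)\<close>.\<close>

definition mass :: "real \<Rightarrow> 'a weighted_word \<Rightarrow> real" where
  "mass r U = (\<Sum>p\<leftarrow>U. 1 / r ^ fst p)"

definition word_elem :: "('a, 'b) monoid_scheme \<Rightarrow> 'a weighted_word \<Rightarrow> 'a" where
  "word_elem G U = lprod G (map snd U)"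

definition letter_bracket :: "('a, 'b) monoid_scheme \<Rightarrow> nat \<times> 'a \<Rightarrow> nat \<times> 'a \<Rightarrow> nat \<times> 'a" where
  "letter_bracket G x y = (fst x + fst y, commutator G (snd x) (snd y))"

text \<open>Rests on y^-1 x y = x [x, y], applied to each letter x.\<close>

fun conj_word :: "('a, 'b) monoid_scheme \<Rightarrow> 'a weighted_word \<Rightarrow> 'a weighted_word \<Rightarrow> 'a weighted_word" where
  "conj_word G [] U = U"
| "conj_word G (y # Y) U = conj_word G Y (concat (map (\<lambda>x. [x, letter_bracket G x y]) U))"

text \<open>Commutator collection, based on a Y = Y (Y^-1 a Y). Only the remainder is returned: the
  word equals its letters satisfying Q, in their order, followed by this remainder.\<close>

fun collect :: "('a, 'b) monoid_scheme \<Rightarrow> (nat \<times> 'a \<Rightarrow> bool) \<Rightarrow> 'a weighted_word \<Rightarrow> 'a weighted_word" where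
  "collect G Q [] = []"
| "collect G Q (a # U) = (if Q a then [] else conj_word G (filter Q U) [a]) @ collect G Q U"

text \<open>Follows [x, y z] = [x, z] (z^-1 [x, y] z).\<close>

fun bracket_word :: "('a, 'b) monoid_scheme \<Rightarrow> nat \<times> 'a \<Rightarrow> 'a weighted_word \<Rightarrow> 'a weighted_word" where
  "bracket_word G x [] = []"
| "bracket_word G x (y # Y) = bracket_word G x Y @ conj_word G Y [letter_bracket G x y]"

text \<open>Follows [x z, y] = (z^-1 [x, y] z) [z, y].\<close>

fun commutator_word :: "('a, 'b) monoid_scheme \<Rightarrow> 'a weighted_word \<Rightarrow> 'a weighted_word \<Rightarrow> 'a weighted_word" where
  "commutator_word G [] Y = []"
| "commutator_word G (x # X) Y = conj_word G X (bracket_word G x Y) @ commutator_word G X Y"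

lemma mass_simps [simp]:
  "mass r [] = 0" "mass r (p # U) = 1 / r ^ fst p + mass r U" "mass r (U @ V) = mass r U + mass r V"
  by (simp_all add: mass_def)

lemma mass_nonneg [simp]: "r > 0 \<Longrightarrow> 0 \<le> mass r U"
  by (induction U) auto

lemma mass_filter: "r > 0 \<Longrightarrow> mass r (filter Q U) \<le> mass r U"
  by (induction U) (auto simp: add_increasing)

lemma mass_replicate [simp]: "mass r (replicate n p) = real n / r ^ fst p"
  by (induction n) (auto simp: add_divide_distrib)

lemma mass_conj_word:
  assumes "r > 0"
  shows "mass r (conj_word G Y U) \<le> mass r U * exp (mass r Y)"
proof (induction Y arbitrary: U)
  case (Cons y Y)
  have eq: "mass r (concat (map (\<lambda>x. [x, letter_bracket G x y]) U)) = mass r U * (1 + 1 / r ^ fst y)"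
    using assms by (induction U) (auto simp: algebra_simps letter_bracket_def power_add)
  have "mass r (conj_word G (y # Y) U) \<le> mass r U * (1 + 1 / r ^ fst y) * exp (mass r Y)"
    using Cons[of "concat (map (\<lambda>x. [x, letter_bracket G x y]) U)"] unfolding eq by simp
  also have "\<dots> \<le> mass r U * exp (1 / r ^ fst y) * exp (mass r Y)"
    using assms by (intro mult_right_mono mult_left_mono exp_ge_add_one_self) auto
  finally show ?case by (simp add: exp_add mult.assoc)
qed auto

lemma mass_Cons_mono: "r > 0 \<Longrightarrow> exp (mass r U) \<le> exp (mass r (a # U))"
  by simp

text \<open>Each letter is conjugated at most once, by a subword of what follows it, so a single
  exponential of the total mass suffices.\<close>

lemma mass_collect:
  assumes "r > 0"
  shows "mass r (collect G Q U) \<le> mass r U * exp (mass r U)"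
proof (induction U)
  case (Cons a U)
  define e where "e = exp (mass r (a # U))"
  note e = mass_Cons_mono[OF assms, of U a, folded e_def]
  have "exp (mass r (filter Q U)) \<le> e"
    using mass_filter[OF assms, of Q U] e by (meson exp_le_cancel_iff order_trans)
  then have "1 / r ^ fst a * exp (mass r (filter Q U)) \<le> 1 / r ^ fst a * e"
    using assms by (intro mult_left_mono) auto
  then have 1: "mass r (conj_word G (filter Q U) [a]) \<le> 1 / r ^ fst a * e"
    using mass_conj_word[OF assms, of G "filter Q U" "[a]"] by simp
  have "mass r U * exp (mass r U) \<le> mass r U * e"
    using assms e by (intro mult_left_mono) auto
  then have 2: "mass r (collect G Q U) \<le> mass r U * e"
    using Cons by linarith
  have "0 \<le> 1 / r ^ fst a * e" using assms by (simp add: e_def)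
  then have "mass r (collect G Q (a # U)) \<le> 1 / r ^ fst a * e + mass r U * e"
    using 1 2 by simp
  also have "\<dots> = mass r (a # U) * e" by (simp add: algebra_simps)
  finally show ?case unfolding e_def .
qed auto

lemma mass_bracket_word:
  assumes "r > 0"
  shows "mass r (bracket_word G x Y) \<le> 1 / r ^ fst x * mass r Y * exp (mass r Y)"
proof (induction Y)
  case (Cons y Y)
  define e where "e = exp (mass r (y # Y))"
  note e = mass_Cons_mono[OF assms, of Y y, folded e_def]
  have "mass r (conj_word G Y [letter_bracket G x y]) \<le> (1 / r ^ fst x * (1 / r ^ fst y)) * exp (mass r Y)"
    using mass_conj_word[OF assms, of G Y "[letter_bracket G x y]"] by (simp add: letter_bracket_def power_add)
  also have "\<dots> \<le> (1 / r ^ fst x * (1 / r ^ fst y)) * e"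
    using e assms by (intro mult_left_mono) auto
  finally have 1: "mass r (conj_word G Y [letter_bracket G x y]) \<le> \<dots>" .
  have "1 / r ^ fst x * mass r Y * exp (mass r Y) \<le> 1 / r ^ fst x * mass r Y * e"
    using e assms by (intro mult_left_mono) auto
  then have "mass r (bracket_word G x (y # Y)) \<le> 1 / r ^ fst x * mass r Y * e + (1 / r ^ fst x * (1 / r ^ fst y)) * e"
    using 1 Cons by simp
  also have "\<dots> = 1 / r ^ fst x * mass r (y # Y) * e" by (simp add: algebra_simps)
  finally show ?case unfolding e_def .
qed auto

text \<open>Weights add under brackets, so masses multiply; the exponential pays for the
  conjugations.\<close>

lemma mass_commutator_word:
  assumes "r > 0"
  shows "mass r (commutator_word G X Y) \<le> mass r X * mass r Y * exp (mass r X + mass r Y)"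
proof (induction X)
  case (Cons x X)
  define e where "e = exp (mass r (x # X) + mass r Y)"
  have e: "exp (mass r Y) * exp (mass r X) \<le> e" "exp (mass r X + mass r Y) \<le> e"
    using assms by (auto simp: e_def simp flip: exp_add)
  have "mass r (conj_word G X (bracket_word G x Y)) \<le> mass r (bracket_word G x Y) * exp (mass r X)"
    by (rule mass_conj_word[OF assms])
  also have "\<dots> \<le> (1 / r ^ fst x * mass r Y * exp (mass r Y)) * exp (mass r X)"
    by (intro mult_right_mono mass_bracket_word[OF assms]) auto
  also have "\<dots> = 1 / r ^ fst x * mass r Y * (exp (mass r Y) * exp (mass r X))" by simp
  also have "\<dots> \<le> 1 / r ^ fst x * mass r Y * e"
    using assms e by (intro mult_left_mono) auto
  finally have 1: "mass r (conj_word G X (bracket_word G x Y)) \<le> 1 / r ^ fst x * mass r Y * e" .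
  have "mass r X * mass r Y * exp (mass r X + mass r Y) \<le> mass r X * mass r Y * e"
    using assms e by (intro mult_left_mono) auto
  then have "mass r (commutator_word G (x # X) Y) \<le> 1 / r ^ fst x * mass r Y * e + mass r X * mass r Y * e"
    using 1 Cons by simp
  also have "\<dots> = mass r (x # X) * mass r Y * e" by (simp add: algebra_simps)
  finally show ?case unfolding e_def .
qed auto


section \<open>Word length and the substitution rules for weighted words\<close>

locale sym_gen_group = group G for G (structure) +
  fixes E :: "'a set"
  assumes E_fin: "finite E" and E_carrier: "E \<subseteq> carrier G"
    and E_inv: "x \<in> E \<Longrightarrow> inv x \<in> E"
    and E_gen: "x \<in> carrier G \<Longrightarrow> \<exists>xs. set xs \<subseteq> E \<and> lprod G xs = x"
begin

definition len :: "'a \<Rightarrow> nat" where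
  "len x = (LEAST n. \<exists>xs. set xs \<subseteq> E \<and> length xs = n \<and> lprod G xs = x)"

lemma len_attained:
  assumes "x \<in> carrier G"
  obtains xs where "set xs \<subseteq> E" "length xs = len x" "lprod G xs = x"
proof -
  have "\<exists>n xs. set xs \<subseteq> E \<and> length xs = n \<and> lprod G xs = x" using E_gen[OF assms] by auto
  from LeastI_ex[OF this] show ?thesis using that unfolding len_def by auto
qed

lemma len_le: "set xs \<subseteq> E \<Longrightarrow> len (lprod G xs) \<le> length xs"
  unfolding len_def by (rule Least_le) auto

lemma len_one [simp]: "len \<one> = 0"
  using len_le[of "[]"] by simp

lemma len_mult:
  assumes "x \<in> carrier G" "y \<in> carrier G"
  shows "len (x \<otimes> y) \<le> len x + len y"
proof -
  obtain xs where xs: "set xs \<subseteq> E" "length xs = len x" "lprod G xs = x" by (rule len_attained[OF assms(1)])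
  obtain ys where ys: "set ys \<subseteq> E" "length ys = len y" "lprod G ys = y" by (rule len_attained[OF assms(2)])
  show ?thesis using len_le[of "xs @ ys"] xs ys E_carrier by (auto simp: lprod_append)
qed

lemma len_inv:
  assumes "x \<in> carrier G"
  shows "len (inv x) = len x"
proof -
  have le: "len (inv x) \<le> len x" if x: "x \<in> carrier G" for x
  proof -
    have inv: "set xs \<subseteq> E \<Longrightarrow> \<exists>ys. set ys \<subseteq> E \<and> length ys = length xs \<and> lprod G ys = inv (lprod G xs)" for xs
    proof (induction xs)
      case (Cons x xs)
      then obtain ys where "set ys \<subseteq> E" "length ys = length xs" "lprod G ys = inv (lprod G xs)" by auto
      then show ?case using Cons.prems E_carrier E_inv
        by (intro exI[of _ "ys @ [inv x]"]) (auto simp: lprod_append inv_mult_group subset_eq)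
    qed simp
    obtain xs where xs: "set xs \<subseteq> E" "length xs = len x" "lprod G xs = x" by (rule len_attained[OF x])
    then obtain ys where "set ys \<subseteq> E" "length ys = length xs" "lprod G ys = inv (lprod G xs)" using inv by blast
    then show ?thesis using len_le[of ys] xs by simp
  qed
  show ?thesis using le[of x] le[of "inv x"] assms by simp
qed

lemma len_pow: "x \<in> carrier G \<Longrightarrow> len (x [^] (n::nat)) \<le> n * len x"
proof (induction n)
  case (Suc n)
  then show ?case using len_mult[of "x [^] n" x] by simp
qed simp

lemma len_E: "x \<in> E \<Longrightarrow> len x \<le> 1"
  using len_le[of "[x]"] E_carrier by auto

lemma bracket_carrier: "bracket G E w x \<Longrightarrow> x \<in> carrier G"
  by (induction rule: bracket.induct) (use E_carrier in auto)

lemma bracket_pos: "bracket G E w x \<Longrightarrow> w \<ge> 1"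
  by (induction rule: bracket.induct) auto

lemma bracket_inv: "bracket G E w x \<Longrightarrow> bracket G E w (inv x)"
proof (induction rule: bracket.induct)
  case (comm a x b y)
  then show ?case using bracket.comm[of G E b y a x] by (simp add: inv_commutator bracket_carrier add.commute)
qed (auto intro: bracket.base[simplified] E_inv)

text \<open>The disjunct \<open>i = 0\<close> carries the base case: a generator has weight 1, which
  does not exceed 2^0.\<close>

lemma bracket_lower_central: "bracket G E w x \<Longrightarrow> w > 2 ^ i \<or> i = 0 \<Longrightarrow> x \<in> lower_central G i"
proof (induction arbitrary: i rule: bracket.induct)
  case (base x)
  then show ?case using E_carrier by (cases i) auto
next
  case (comm a x b y)
  show ?case
  proof (cases i)
    case 0
    then show ?thesis using comm.hyps by (simp add: bracket_carrier)
  next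
    case (Suc j)
    with comm.prems have "a > 2 ^ j \<or> b > 2 ^ j" by auto
    then show ?thesis using comm.IH[of j] comm.hyps commutator_lower_central Suc bracket_carrier by blast
  qed
qed

text \<open>Both parts of a commutator have weight at least 1, hence less than w, so only finitely
  many pairs produce it.\<close>

lemma finite_bracket: "finite {x. bracket G E w x}"
proof (induction w rule: less_induct)
  case (less w)
  have "{x. bracket G E w x} \<subseteq> E \<union> (\<Union>a\<in>{..<w}. \<Union>b\<in>{..<w}. \<Union>x\<in>{x. bracket G E a x}. commutator G x ` {y. bracket G E b y})"
  proof
    fix z assume "z \<in> {x. bracket G E w x}"
    then have "bracket G E w z" by simp
    then show "z \<in> E \<union> (\<Union>a\<in>{..<w}. \<Union>b\<in>{..<w}. \<Union>x\<in>{x. bracket G E a x}. commutator G x ` {y. bracket G E b y})"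
    proof cases
      case (comm a x b y)
      then show ?thesis using bracket_pos[of a x] bracket_pos[of b y]
        by (intro UnI2 UN_I[of a] UN_I[of b] UN_I[of x]) auto
    qed auto
  qed
  then show ?case by (rule finite_subset) (use E_fin less in auto)
qed

definition valid :: "'a weighted_word \<Rightarrow> bool" where
  "valid U \<longleftrightarrow> (\<forall>p\<in>set U. bracket G E (fst p) (snd p))"

definition min_weight :: "nat \<Rightarrow> 'a weighted_word \<Rightarrow> bool" where
  "min_weight j U \<longleftrightarrow> (\<forall>p\<in>set U. fst p \<ge> j)"

lemma valid_simps [simp]:
  "valid []" "valid (p # U) \<longleftrightarrow> bracket G E (fst p) (snd p) \<and> valid U" "valid (U @ V) \<longleftrightarrow> valid U \<and> valid V"
  by (auto simp: valid_def)

lemma min_weight_simps [simp]: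
  "min_weight j []" "min_weight j (p # U) \<longleftrightarrow> fst p \<ge> j \<and> min_weight j U" "min_weight j (U @ V) \<longleftrightarrow> min_weight j U \<and> min_weight j V"
  by (auto simp: min_weight_def)

lemma valid_carrier: "valid U \<Longrightarrow> set (map snd U) \<subseteq> carrier G"
  by (auto simp: valid_def dest: bracket_carrier)

lemma word_elem_closed [simp]: "valid U \<Longrightarrow> word_elem G U \<in> carrier G"
  unfolding word_elem_def by (rule lprod_closed[OF valid_carrier])

lemma word_elem_Nil [simp]: "word_elem G [] = \<one>"
  by (simp add: word_elem_def)

lemma word_elem_Cons [simp]: "word_elem G (p # U) = snd p \<otimes> word_elem G U"
  by (simp add: word_elem_def)

lemma word_elem_append [simp]: "valid U \<Longrightarrow> valid V \<Longrightarrow> word_elem G (U @ V) = word_elem G U \<otimes> word_elem G V"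
  unfolding word_elem_def map_append by (intro lprod_append valid_carrier)

lemma valid_filter [simp]: "valid U \<Longrightarrow> valid (filter Q U)"
  by (auto simp: valid_def)

lemma word_elem_replicate: "x \<in> carrier G \<Longrightarrow> word_elem G (replicate n (w, x)) = x [^] n"
  by (simp add: word_elem_def lprod_replicate)

lemma valid_replicate: "bracket G E w x \<Longrightarrow> valid (replicate n (w, x))"
  by (induction n) auto

lemma conj_word1: 
  assumes "valid U" "bracket G E (fst y) (snd y)"
  defines "V \<equiv> concat (map (\<lambda>x. [x, letter_bracket G x y]) U)"
  shows "valid V" "word_elem G V = inv (snd y) \<otimes> word_elem G U \<otimes> snd y"
proof -
  have y: "snd y \<in> carrier G" using assms(2) by (rule bracket_carrier)
  show valid: "valid V" using assms(1) unfolding V_def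
    by (induction U) (auto simp: letter_bracket_def intro: bracket.comm assms(2))
  show "word_elem G V = inv (snd y) \<otimes> word_elem G U \<otimes> snd y"
    using assms(1) unfolding V_def
    by (induction U) (auto simp: letter_bracket_def y commutator_def m_assoc bracket_carrier)
qed

lemma valid_conj_word: "valid U \<Longrightarrow> valid Y \<Longrightarrow> valid (conj_word G Y U)"
  by (induction Y arbitrary: U) (auto simp: conj_word1)

lemma word_elem_conj_word: "valid U \<Longrightarrow> valid Y \<Longrightarrow> word_elem G (conj_word G Y U) = inv (word_elem G Y) \<otimes> word_elem G U \<otimes> word_elem G Y"
  by (induction Y arbitrary: U) (auto simp: conj_word1 bracket_carrier m_assoc inv_mult_group)

text \<open>Weights are at least 1, so a bracket created by conjugation is strictly heavier than the
  letter it comes from.\<close>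

lemma set_conj_word: "valid Y \<Longrightarrow> p \<in> set (conj_word G Y U) \<Longrightarrow> p \<in> set U \<or> (\<exists>u\<in>set U. fst p > fst u)"
proof (induction Y arbitrary: U)
  case (Cons y Y)
  let ?U = "concat (map (\<lambda>x. [x, letter_bracket G x y]) U)"
  have y: "fst y \<ge> 1" using Cons.prems bracket_pos[of "fst y" "snd y"] by simp
  have *: "\<exists>u\<in>set U. fst q > fst u" if q: "q \<in> set ?U" "q \<notin> set U" for q
  proof -
    obtain u where "u \<in> set U" "q = letter_bracket G u y" using q by auto
    then show ?thesis using y by (intro bexI[of _ u]) (auto simp: letter_bracket_def)
  qed
  show ?case
  proof (cases "p \<in> set ?U")
    case True
    then show ?thesis using * by blast
  next
    case False
    have "p \<in> set ?U \<or> (\<exists>u\<in>set ?U. fst p > fst u)"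
      using Cons.prems by (intro Cons.IH) simp_all
    with False obtain u where u: "u \<in> set ?U" "fst p > fst u" by blast
    show ?thesis
    proof (cases "u \<in> set U")
      case False
      then obtain v where "v \<in> set U" "fst u > fst v" using *[OF u(1)] by blast
      then show ?thesis using u by (intro disjI2 bexI[of _ v]) simp_all
    qed (use u in blast)
  qed
qed simp

lemma min_weight_conj_word: "valid Y \<Longrightarrow> min_weight j U \<Longrightarrow> min_weight j (conj_word G Y U)"
  unfolding min_weight_def using set_conj_word by fastforce

text \<open>Created letters have weight above j, so the part of least weight survives with its order
  and multiplicities.\<close>

lemma filter_conj_word:
  assumes "valid Y" "min_weight j U"
  shows "filter (\<lambda>p. fst p = j) (conj_word G Y U) = filter (\<lambda>p. fst p = j) U"
  using assms
proof (induction Y arbitrary: U)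
  case (Cons y Y)
  let ?U = "concat (map (\<lambda>x. [x, letter_bracket G x y]) U)"
  have y: "fst y \<ge> 1" using Cons.prems bracket_pos[of "fst y" "snd y"] by simp
  have "min_weight j ?U" using Cons.prems(2) by (induction U) (auto simp: letter_bracket_def)
  moreover have "filter (\<lambda>p. fst p = j) ?U = filter (\<lambda>p. fst p = j) U"
    using Cons.prems(2) y by (induction U) (auto simp: letter_bracket_def)
  ultimately show ?case using Cons by simp
qed auto

lemma valid_collect: "valid U \<Longrightarrow> valid (collect G Q U)"
  by (induction U) (auto simp: valid_conj_word)

lemma word_elem_collect:
  "valid U \<Longrightarrow> word_elem G U = word_elem G (filter Q U) \<otimes> word_elem G (collect G Q U)"
  by (induction U) (auto simp: word_elem_conj_word valid_conj_word valid_collect bracket_carrier m_assoc)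

lemma set_collect:
  "valid U \<Longrightarrow> p \<in> set (collect G Q U) \<Longrightarrow> (p \<in> set U \<and> \<not> Q p) \<or> (\<exists>u\<in>set U. fst p > fst u)"
proof (induction U)
  case (Cons a U)
  then show ?case using set_conj_word[of "filter Q U" p "[a]"] by (auto split: if_splits)
qed auto

lemma valid_bracket_word: "bracket G E (fst x) (snd x) \<Longrightarrow> valid Y \<Longrightarrow> valid (bracket_word G x Y)"
  by (induction Y) (auto simp: letter_bracket_def intro!: valid_conj_word bracket.comm)

lemma word_elem_bracket_word: "bracket G E (fst x) (snd x) \<Longrightarrow> valid Y \<Longrightarrow> word_elem G (bracket_word G x Y) = commutator G (snd x) (word_elem G Y)"
proof (induction Y)
  case Nil
  then show ?case by (simp add: commutator_def bracket_carrier)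
next
  case (Cons y Y)
  have b: "valid [letter_bracket G x y]" using Cons.prems by (auto simp: letter_bracket_def intro: bracket.comm)
  have "word_elem G (bracket_word G x (y # Y)) = word_elem G (bracket_word G x Y) \<otimes> word_elem G (conj_word G Y [letter_bracket G x y])"
    unfolding bracket_word.simps using Cons.prems b by (intro word_elem_append valid_bracket_word valid_conj_word) simp_all
  also have "word_elem G (conj_word G Y [letter_bracket G x y]) = inv (word_elem G Y) \<otimes> word_elem G [letter_bracket G x y] \<otimes> word_elem G Y"
    using Cons.prems b by (intro word_elem_conj_word) simp_all
  also have "word_elem G [letter_bracket G x y] = commutator G (snd x) (snd y)"
    using Cons.prems bracket_carrier[of "fst x" "snd x"] bracket_carrier[of "fst y" "snd y"] by (simp add: letter_bracket_def)
  also have "word_elem G (bracket_word G x Y) = commutator G (snd x) (word_elem G Y)" using Cons by simp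
  also have "commutator G (snd x) (word_elem G Y) \<otimes> (inv (word_elem G Y) \<otimes> commutator G (snd x) (snd y) \<otimes> word_elem G Y) =
      commutator G (snd x) (word_elem G (y # Y))"
    using Cons.prems bracket_carrier[of "fst x" "snd x"] bracket_carrier[of "fst y" "snd y"]
    by (simp add: commutator_def m_assoc inv_mult_group)
  finally show ?case .
qed

lemma valid_commutator_word: "valid X \<Longrightarrow> valid Y \<Longrightarrow> valid (commutator_word G X Y)"
  by (induction X) (auto intro!: valid_conj_word valid_bracket_word)

lemma word_elem_commutator_word: "valid X \<Longrightarrow> valid Y \<Longrightarrow> word_elem G (commutator_word G X Y) = commutator G (word_elem G X) (word_elem G Y)"
proof (induction X)
  case (Cons x X)
  have "word_elem G (commutator_word G (x # X) Y) = inv (word_elem G X) \<otimes> commutator G (snd x) (word_elem G Y) \<otimes> word_elem G X \<otimes> commutator G (word_elem G X) (word_elem G Y)"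
    using Cons by (simp add: valid_bracket_word valid_conj_word valid_commutator_word word_elem_conj_word word_elem_bracket_word)
  also have "\<dots> = commutator G (word_elem G (x # X)) (word_elem G Y)"
    using Cons.prems bracket_carrier[of "fst x" "snd x"] by (simp add: commutator_def m_assoc inv_mult_group)
  finally show ?case .
qed (simp add: commutator_def)

lemma min_weight_bracket_word: "valid Y \<Longrightarrow> fst x \<ge> a \<Longrightarrow> min_weight b Y \<Longrightarrow> min_weight (a + b) (bracket_word G x Y)"
  by (induction Y) (auto intro!: min_weight_conj_word simp: letter_bracket_def)

lemma min_weight_commutator_word: "valid X \<Longrightarrow> valid Y \<Longrightarrow> min_weight a X \<Longrightarrow> min_weight b Y \<Longrightarrow> min_weight (a + b) (commutator_word G X Y)"
  by (induction X) (auto intro!: min_weight_conj_word min_weight_bracket_word)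

lemma min_weight_filter_none: "min_weight (Suc j) U \<Longrightarrow> filter (\<lambda>p. fst p = j) U = []"
  by (auto simp: min_weight_def filter_empty_conv)

lemma filter_bracket_word:
  assumes "valid Y" "min_weight b Y" "filter (\<lambda>p. fst p = b) Y = replicate n (b, y)"
  shows "filter (\<lambda>p. fst p = a + b) (bracket_word G (a, x) Y) = replicate n (a + b, commutator G x y)"
  using assms
proof (induction Y arbitrary: n)
  case (Cons p Y)
  have f: "filter (\<lambda>q. fst q = a + b) (conj_word G Y [letter_bracket G (a, x) p]) = filter (\<lambda>q. fst q = a + b) [letter_bracket G (a, x) p]"
    using Cons.prems by (intro filter_conj_word) (auto simp: letter_bracket_def)
  show ?case
  proof (cases "fst p = b")
    case True
    with Cons.prems(3) obtain m where m: "n = Suc m" "p = (b, y)" "filter (\<lambda>p. fst p = b) Y = replicate m (b, y)"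
      by (cases n) auto
    then show ?thesis using Cons f by (auto simp: letter_bracket_def replicate_append_same)
  next
    case False
    then show ?thesis using Cons f by (auto simp: letter_bracket_def)
  qed
qed simp

text \<open>Bilinearity of the commutator to leading order: the m letters x and the n letters y meet
  in m n brackets [x, y], and every other bracket is heavier than a + b.\<close>

lemma filter_commutator_word:
  assumes "valid X" "valid Y" "min_weight a X" "min_weight b Y"
    "filter (\<lambda>p. fst p = a) X = replicate m (a, x)" "filter (\<lambda>p. fst p = b) Y = replicate n (b, y)"
  shows "filter (\<lambda>p. fst p = a + b) (commutator_word G X Y) = replicate (m * n) (a + b, commutator G x y)"
  using assms
proof (induction X arbitrary: m)
  case (Cons p X)
  have f: "filter (\<lambda>q. fst q = a + b) (conj_word G X (bracket_word G p Y)) = filter (\<lambda>q. fst q = a + b) (bracket_word G p Y)"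
    using Cons.prems by (intro filter_conj_word min_weight_bracket_word) auto
  show ?case
  proof (cases "fst p = a")
    case True
    with Cons.prems(5) obtain k where m: "m = Suc k" "p = (a, x)" "filter (\<lambda>p. fst p = a) X = replicate k (a, x)"
      by (cases m) auto
    then show ?thesis using Cons f filter_bracket_word[of Y b n y a x] by (auto simp: replicate_add)
  next
    case False
    then have "min_weight (Suc (a + b)) (bracket_word G p Y)" using Cons.prems min_weight_bracket_word[of Y "Suc a" p b] by auto
    then show ?thesis using Cons f False by (auto simp: min_weight_filter_none)
  qed
qed simp

end

section \<open>Short representatives of high powers and coverings by translates\<close>

lemma mult_exp_mono: "0 \<le> x \<Longrightarrow> x \<le> y \<Longrightarrow> x * exp x \<le> y * exp (y::real)"
  by (intro mult_mono) auto

locale sym_gen_nilpotent_group = sym_gen_group +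
  fixes c :: nat
  assumes lower_central_trivial: "lower_central G c = {\<one>}"
begin

lemma bracket_trivial: "bracket G E w x \<Longrightarrow> w > 2 ^ c \<Longrightarrow> x = \<one>"
  using bracket_lower_central[of w x c] lower_central_trivial by auto

lemma word_elem_trivial: "valid U \<Longrightarrow> min_weight j U \<Longrightarrow> j > 2 ^ c \<Longrightarrow> word_elem G U = \<one>"
proof (induction U)
  case (Cons p U)
  then show ?case using bracket_trivial[of "fst p" "snd p"] by auto
qed simp

text \<open>Distortion of brackets: [x^m, y^n] is [x, y]^(m n) up to heavier letters, yet costs only
  the lengths of x^m and y^n. The error word has a mass bound independent of r, so it can be treated
  by induction on the weight.\<close>

lemma power_short:
  assumes "bracket G E a x"
  shows "\<exists>C M. 0 \<le> M \<and> (\<forall>r\<ge>1. \<forall>m\<le>r ^ a. \<exists>g U. g \<in> carrier G \<and> len g \<le> C * r \<and> valid U \<and> min_weight (Suc a) U \<and>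
    mass (real r) U \<le> M \<and> g = x [^] m \<otimes> word_elem G U)"
  using assms
proof (induction rule: bracket.induct)
  case (base x)
  have x: "x \<in> carrier G" using base E_carrier by auto
  have "len (x [^] m) \<le> m" for m
    using order_trans[OF len_pow[OF x, of m] mult_le_mono2[OF len_E[OF base]]] by simp
  then have "\<exists>g U. g \<in> carrier G \<and> len g \<le> 1 * r \<and> valid U \<and> min_weight (Suc 1) U \<and>
    mass (real r) U \<le> 0 \<and> g = x [^] m \<otimes> word_elem G U" if "m \<le> r ^ 1" for r m
    using x that by (intro exI[of _ "x [^] m"] exI[of _ "[]"]) (auto intro: order_trans[of _ m])
  then show ?case by (meson order_refl)
next
  case (comm a x b y)
  define t where "t = commutator G x y"
  have t: "bracket G E (a + b) t" unfolding t_def by (intro bracket.comm comm.hyps)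
  have tc: "t \<in> carrier G" using bracket_carrier[OF t] .
  have xc: "x \<in> carrier G" and yc: "y \<in> carrier G" using comm.hyps bracket_carrier by auto
  obtain C1 M1 where 1: "0 \<le> M1" "\<And>r m. r \<ge> 1 \<Longrightarrow> m \<le> r ^ a \<Longrightarrow> \<exists>g U. g \<in> carrier G \<and> len g \<le> C1 * r \<and> valid U \<and> min_weight (Suc a) U \<and>
    mass (real r) U \<le> M1 \<and> g = x [^] m \<otimes> word_elem G U"
    using comm.IH(1) by blast
  obtain C2 M2 where 2: "0 \<le> M2" "\<And>r m. r \<ge> 1 \<Longrightarrow> m \<le> r ^ b \<Longrightarrow> \<exists>g U. g \<in> carrier G \<and> len g \<le> C2 * r \<and> valid U \<and> min_weight (Suc b) U \<and>
    mass (real r) U \<le> M2 \<and> g = y [^] m \<otimes> word_elem G U"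
    using comm.IH(2) by blast
  define K where "K = (1 + M1) * (1 + M2) * exp ((1 + M1) + (1 + M2))"
  define M3 where "M3 = K * exp K"
  define C3 where "C3 = 2 * (C1 + C2)"
  have K: "0 \<le> K" "0 \<le> M3" using 1 2 by (auto simp: K_def M3_def)
  \<comment> \<open>A single commutator reaches exponents of product form m n; the general exponent
    is assembled from two of these.\<close>
  have step: "\<exists>g U. g \<in> carrier G \<and> len g \<le> C3 * r \<and> valid U \<and> min_weight (Suc (a + b)) U \<and>
    mass (real r) U \<le> M3 \<and> g = t [^] (m * n) \<otimes> word_elem G U"
    if r: "r \<ge> 1" and m: "m \<le> r ^ a" and n: "n \<le> r ^ b" for r m n
  proof -
    have rp: "real r > 0" using r by simp
    obtain g U where g: "g \<in> carrier G" "len g \<le> C1 * r" "valid U" "min_weight (Suc a) U"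
      "mass (real r) U \<le> M1" "g = x [^] m \<otimes> word_elem G U" using 1(2)[OF r m] by blast
    obtain h V where h: "h \<in> carrier G" "len h \<le> C2 * r" "valid V" "min_weight (Suc b) V"
      "mass (real r) V \<le> M2" "h = y [^] n \<otimes> word_elem G V" using 2(2)[OF r n] by blast
    define A where "A = replicate m (a, x) @ U"
    define B where "B = replicate n (b, y) @ V"
    define D where "D = commutator_word G A B"
    define F where "F = collect G (\<lambda>p. fst p = a + b) D"
    have wdA: "valid A" and wdB: "valid B" using g h comm.hyps by (auto simp: A_def B_def valid_replicate)
    have geA: "min_weight a A" and geB: "min_weight b B" using g h by (auto simp: A_def B_def min_weight_def)
    have "real m / real r ^ a \<le> 1" "real n / real r ^ b \<le> 1"
      using m n rp by (auto simp: divide_le_eq simp flip: of_nat_power)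
    then have mA: "mass r A \<le> 1 + M1" and mB: "mass r B \<le> 1 + M2"
      using g h by (auto simp: A_def B_def intro: add_mono)
    have "mass r D \<le> mass r A * mass r B * exp (mass r A + mass r B)"
      unfolding D_def by (rule mass_commutator_word[OF rp])
    also have "\<dots> \<le> K" unfolding K_def using mA mB 1(1) 2(1) rp
      by (intro mult_mono) auto
    finally have mD: "mass r D \<le> K" .
    have "mass r F \<le> mass r D * exp (mass r D)" unfolding F_def by (rule mass_collect[OF rp])
    also have "\<dots> \<le> M3" unfolding M3_def using mD rp by (intro mult_exp_mono) auto
    finally have mF: "mass r F \<le> M3" .
    have wdD: "valid D" unfolding D_def by (intro valid_commutator_word wdA wdB)
    have geD: "min_weight (a + b) D" unfolding D_def by (intro min_weight_commutator_word wdA wdB geA geB)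
    have fA: "filter (\<lambda>p. fst p = a) A = replicate m (a, x)" using g by (simp add: A_def min_weight_filter_none)
    have fB: "filter (\<lambda>p. fst p = b) B = replicate n (b, y)" using h by (simp add: B_def min_weight_filter_none)
    have fD: "filter (\<lambda>p. fst p = a + b) D = replicate (m * n) (a + b, t)"
      unfolding D_def t_def by (intro filter_commutator_word wdA wdB geA geB fA fB)
    have "word_elem G A = g" "word_elem G B = h"
      using g h comm.hyps xc yc by (auto simp: A_def B_def valid_replicate word_elem_replicate)
    then have "commutator G g h = word_elem G D" unfolding D_def using word_elem_commutator_word[OF wdA wdB] by simp
    also have "\<dots> = word_elem G (filter (\<lambda>p. fst p = a + b) D) \<otimes> word_elem G F"
      unfolding F_def by (rule word_elem_collect[OF wdD])
    finally have eq: "commutator G g h = t [^] (m * n) \<otimes> word_elem G F" using tc by (simp add: fD word_elem_replicate)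
    have "min_weight (Suc (a + b)) F"
      unfolding min_weight_def F_def using set_collect[OF wdD] geD by (fastforce simp: min_weight_def)
    moreover have "len (commutator G g h) \<le> C3 * r"
    proof -
      have "len (commutator G g h) \<le> len g + len h + len g + len h"
        using len_mult[of "inv g \<otimes> inv h \<otimes> g" h] len_mult[of "inv g \<otimes> inv h" g] len_mult[of "inv g" "inv h"] g h
        by (simp add: commutator_def len_inv)
      also have "\<dots> \<le> C3 * r" using g h by (simp add: C3_def distrib_right)
      finally show ?thesis .
    qed
    moreover have "valid F" unfolding F_def by (rule valid_collect[OF wdD])
    ultimately show ?thesis using eq mF commutator_closed[OF g(1) h(1)] by blast
  qed
  have "\<exists>g U. g \<in> carrier G \<and> len g \<le> 2 * C3 * r \<and> valid U \<and> min_weight (Suc (a + b)) U \<and>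
    mass (real r) U \<le> M3 * exp 1 + M3 \<and> g = t [^] n \<otimes> word_elem G U"
    if r: "r \<ge> 1" and n: "n \<le> r ^ (a + b)" for r n :: nat
  proof -
    have rp: "real r > 0" using r by simp
    \<comment> \<open>Every n up to r^(a+b) is m r^b + l with m \<le> r^a and l < r^b. Both parts
      have product form, the second as 1 times l.\<close>
    define m where "m = n div r ^ b"
    define l where "l = n mod r ^ b"
    have "r ^ b > 0" using r by simp
    then have l: "l < r ^ b" by (simp add: l_def)
    have "m \<le> r ^ (a + b) div r ^ b" unfolding m_def using n by (rule div_le_mono)
    then have m: "m \<le> r ^ a" using r by (simp add: power_add)
    have nml: "n = m * r ^ b + l" unfolding m_def l_def by (rule div_mult_mod_eq[symmetric])
    obtain g U where g: "g \<in> carrier G" "len g \<le> C3 * r" "valid U" "min_weight (Suc (a + b)) U"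
      "mass (real r) U \<le> M3" "g = t [^] (m * r ^ b) \<otimes> word_elem G U" using step[OF r m, of "r ^ b"] by auto
    obtain h V where h: "h \<in> carrier G" "len h \<le> C3 * r" "valid V" "min_weight (Suc (a + b)) V"
      "mass (real r) V \<le> M3" "h = t [^] l \<otimes> word_elem G V" using step[OF r, of 1 l] l r by auto
    \<comment> \<open>In the product g h the error word U stands between the two powers of t. Moving
      t^l to the left past U conjugates U by L, whose mass is at most 1; hence the factor
      \<open>exp 1\<close>.\<close>
    define L where "L = replicate l (a + b, t)"
    have wdL: "valid L" unfolding L_def by (rule valid_replicate[OF t])
    have vL: "word_elem G L = t [^] l" using tc by (simp add: L_def word_elem_replicate)
    have "l \<le> r ^ (a + b)" using nml n by simp
    then have "mass r L \<le> 1" using rp by (auto simp: L_def divide_le_eq simp flip: of_nat_power)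
    then have "mass r U * exp (mass r L) \<le> M3 * exp 1" using g K rp by (intro mult_mono) auto
    then have mU: "mass r (conj_word G L U) \<le> M3 * exp 1" using mass_conj_word[OF rp, of G L U] by simp
    have "g \<otimes> h = t [^] n \<otimes> word_elem G (conj_word G L U @ V)"
      using g h wdL tc by (simp add: valid_conj_word word_elem_conj_word vL nml m_assoc flip: nat_pow_mult)
    moreover have "len (g \<otimes> h) \<le> 2 * C3 * r" using len_mult[of g h] g h by simp
    moreover have "valid (conj_word G L U @ V)" "min_weight (Suc (a + b)) (conj_word G L U @ V)"
      "mass r (conj_word G L U @ V) \<le> M3 * exp 1 + M3"
      using g h mU wdL by (auto intro!: valid_conj_word min_weight_conj_word add_mono)
    ultimately show ?thesis using m_closed[OF g(1) h(1)] by blast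
  qed
  then show ?case using K unfolding t_def[symmetric]
    by (intro exI[of _ "2 * C3"] exI[of _ "M3 * exp 1 + M3"]) auto
qed

text \<open>Interpolates between words of weight at least j + 1 (X empty) and words of weight at
  least j (X all brackets of weight j), so that brackets can be removed one at a time.\<close>

definition layer :: "nat \<Rightarrow> 'a set \<Rightarrow> 'a weighted_word \<Rightarrow> bool" where
  "layer j X U \<longleftrightarrow> valid U \<and> min_weight j U \<and> (\<forall>p\<in>set U. fst p = j \<longrightarrow> snd p \<in> X)"

text \<open>Downward induction on the weight from above \<open>2 ^ c\<close>, where brackets are
  trivial, nested with induction over the finite set of brackets of weight j. The insertion case
  also receives the full statement one weight higher, where the error words of
  \<open>power_short\<close> live.\<close>

lemma layer_induct:
  assumes top: "\<And>j X. j > 2 ^ c \<Longrightarrow> P j X"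
    and empty: "\<And>j. P (Suc j) {x. bracket G E (Suc j) x} \<Longrightarrow> P j {}"
    and insert: "\<And>j X t. bracket G E j t \<Longrightarrow> P (Suc j) {x. bracket G E (Suc j) x} \<Longrightarrow> P j X \<Longrightarrow> P j (insert t X)"
  shows "P j {x. bracket G E j x}"
proof (induction "2 ^ c + 1 - j" arbitrary: j)
  case 0
  then show ?case by (intro top) auto
next
  case (Suc n)
  have IH: "P (Suc j) {x. bracket G E (Suc j) x}" using Suc by (intro Suc.hyps) auto
  have "X \<subseteq> {x. bracket G E j x} \<Longrightarrow> P j X" if "finite X" for X
    using that by induction (auto intro: empty[OF IH] insert IH)
  then show ?case using finite_bracket by blast
qed

lemma layer_full: "valid U \<Longrightarrow> min_weight j U \<Longrightarrow> layer j {x. bracket G E j x} U"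
  by (auto simp: layer_def valid_def)

lemma layer_empty: "layer j {} U \<Longrightarrow> layer (Suc j) {x. bracket G E (Suc j) x} U"
  unfolding layer_def min_weight_def valid_def by (metis empty_iff le_antisym mem_Collect_eq not_less_eq_eq)

lemma word_elem_powers:
  assumes "t \<in> carrier G" "\<forall>p\<in>set L. snd p \<in> {t, inv t}"
  shows "\<exists>x::int. word_elem G L = t [^] x \<and> \<bar>x\<bar> \<le> int (length L)"
  using assms(2)
proof (induction L)
  case (Cons p L)
  then obtain x :: int where x: "word_elem G L = t [^] x" "\<bar>x\<bar> \<le> int (length L)" by auto
  from Cons consider "snd p = t" | "snd p = inv t" by auto
  then show ?case
  proof cases
    case 1
    then have "word_elem G (p # L) = t [^] (1 + x)" using x assms by (simp add: int_pow_mult)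
    then show ?thesis using x by (intro exI[of _ "1 + x"]) auto
  next
    case 2
    moreover have "t [^] (- 1 + x) = t [^] (- 1 :: int) \<otimes> t [^] x"
      using assms by (intro int_pow_mult)
    ultimately have "word_elem G (p # L) = t [^] (- 1 + x)" using x assms by (simp add: int_pow_neg)
    then show ?thesis using x by (intro exI[of _ "- 1 + x"]) auto
  qed
qed (auto intro!: exI[of _ 0])

lemma mass_const: "\<forall>p\<in>set L. fst p = j \<Longrightarrow> mass r L = real (length L) / r ^ j"
  by (induction L) (auto simp: add_divide_distrib)

text \<open>Collecting t and its inverse to the front removes t from the admissible set. The
  exponent is at most M r^j because each collected letter has mass r^-j.\<close>

lemma split_powers:
  assumes "layer j (insert t X) U" "bracket G E j t" "r \<ge> 1" "mass (real r) U \<le> M"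
  shows "\<exists>x V. word_elem G U = t [^] (x::int) \<otimes> word_elem G V \<and> \<bar>x\<bar> \<le> M * real r ^ j \<and> layer j X V \<and> mass r V \<le> M * exp M"
proof -
  define Q where "Q = (\<lambda>p::nat \<times> 'a. fst p = j \<and> snd p \<in> {t, inv t})"
  have rp: "real r > 0" using assms by simp
  have tc: "t \<in> carrier G" using bracket_carrier[OF assms(2)] .
  have U: "valid U" "min_weight j U" using assms by (auto simp: layer_def)
  obtain x :: int where x: "word_elem G (filter Q U) = t [^] x" "\<bar>x\<bar> \<le> int (length (filter Q U))"
    using word_elem_powers[OF tc, of "filter Q U"] by (auto simp: Q_def)
  have "real (length (filter Q U)) / real r ^ j = mass r (filter Q U)"
    by (rule mass_const[symmetric]) (auto simp: Q_def)
  also have "\<dots> \<le> M" using mass_filter[OF rp, of Q U] assms by simp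
  finally have "real (length (filter Q U)) \<le> M * real r ^ j" using rp by (simp add: divide_le_eq)
  then have 1: "\<bar>x\<bar> \<le> M * real r ^ j" using x(2) by linarith
  have "layer j X (collect G Q U)"
    using set_collect[OF U(1), of _ Q] U assms(1) valid_collect[OF U(1)]
    by (fastforce simp: layer_def min_weight_def Q_def)
  moreover have "mass r (collect G Q U) \<le> M * exp M"
    using mass_collect[OF rp, of G Q U] mult_exp_mono[of "mass r U" M] assms rp by simp
  ultimately show ?thesis using 1 x word_elem_collect[OF U(1), of Q] by (intro exI[of _ x] exI[of _ "collect G Q U"]) auto
qed

lemma len_int_pow: "t \<in> carrier G \<Longrightarrow> len (t [^] (x::int)) = len (t [^] nat \<bar>x\<bar>)"
  by (cases x rule: int_cases2) (simp_all add: int_pow_neg int_pow_int len_inv)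

text \<open>Peel off one power t^x at a time. An exponent of order r^j splits into boundedly many
  blocks t^(r^j) and a remainder; each is short by \<open>power_short\<close>, since its error word
  has weight at least j + 1 and is short by induction.\<close>

lemma len_word_elem_layer:
  "\<forall>M. \<exists>C. \<forall>r\<ge>1. \<forall>U. layer j {x. bracket G E j x} U \<and> mass (real r) U \<le> M \<longrightarrow> len (word_elem G U) \<le> C * r"
proof (induction rule: layer_induct)
  case (1 j X)
  then show ?case using word_elem_trivial by (auto simp: layer_def)
next
  case (2 j)
  show ?case
  proof
    fix M
    from 2 obtain C where "\<forall>r\<ge>1. \<forall>U. layer (Suc j) {x. bracket G E (Suc j) x} U \<and> mass (real r) U \<le> M \<longrightarrow> len (word_elem G U) \<le> C * r"
      by blast
    then show "\<exists>C. \<forall>r\<ge>1. \<forall>U. layer j {} U \<and> mass (real r) U \<le> M \<longrightarrow> len (word_elem G U) \<le> C * r"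
      using layer_empty[of j] by (intro exI[of _ C]) simp
  qed
next
  case (3 j X t)
  have tc: "t \<in> carrier G" using bracket_carrier[OF 3(1)] .
  obtain C1 M1 where C1: "0 \<le> M1" "\<And>r m. r \<ge> 1 \<Longrightarrow> m \<le> r ^ j \<Longrightarrow> \<exists>g U. g \<in> carrier G \<and> len g \<le> C1 * r \<and> valid U \<and> min_weight (Suc j) U \<and>
    mass (real r) U \<le> M1 \<and> g = t [^] m \<otimes> word_elem G U"
    using power_short[OF 3(1)] by blast
  obtain C2 where C2: "\<And>r U. r \<ge> 1 \<Longrightarrow> layer (Suc j) {x. bracket G E (Suc j) x} U \<Longrightarrow> mass (real r) U \<le> M1 \<Longrightarrow> len (word_elem G U) \<le> C2 * r"
    using 3(2) by blast
  have pow: "len (t [^] m) \<le> (C1 + C2) * r" if r: "r \<ge> 1" "m \<le> r ^ j" for r m :: nat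
  proof -
    obtain g U where g: "g \<in> carrier G" "len g \<le> C1 * r" "valid U" "min_weight (Suc j) U"
      "mass (real r) U \<le> M1" "g = t [^] m \<otimes> word_elem G U" using C1(2)[OF r] by blast
    have "len (word_elem G U) \<le> C2 * r" using g r by (intro C2 layer_full) auto
    moreover have "t [^] m = g \<otimes> inv (word_elem G U)" using g tc by (simp add: m_assoc)
    ultimately show ?thesis using len_mult[of g "inv (word_elem G U)"] g len_inv[of "word_elem G U"] by (simp add: distrib_right)
  qed
  show ?case
  proof
    fix M :: real
    define K where "K = nat \<lceil>M\<rceil>"
    obtain C3 where C3: "\<And>r U. r \<ge> 1 \<Longrightarrow> layer j X U \<Longrightarrow> mass (real r) U \<le> M * exp M \<Longrightarrow> len (word_elem G U) \<le> C3 * r"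
      using 3(3) by blast
    have "len (word_elem G U) \<le> ((K + 1) * (C1 + C2) + C3) * r"
      if r: "r \<ge> 1" and U: "layer j (insert t X) U" "mass (real r) U \<le> M" for r U
    proof -
      obtain x V where x: "word_elem G U = t [^] (x::int) \<otimes> word_elem G V" "\<bar>x\<bar> \<le> M * real r ^ j" "layer j X V" "mass r V \<le> M * exp M"
        using split_powers[OF U(1) 3(1) r U(2)] by blast
      define m where "m = nat \<bar>x\<bar>"
      have rj: "r ^ j > 0" using r by simp
      have "M * real r ^ j \<le> real K * real r ^ j" unfolding K_def by (intro mult_right_mono) (auto simp: real_nat_ceiling_ge)
      then have "real m \<le> real (K * r ^ j)" using x(2) by (simp add: m_def)
      then have "m \<le> K * r ^ j" by linarith
      then have q: "m div r ^ j \<le> K" using div_le_mono[of m "K * r ^ j" "r ^ j"] r by simp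
      have "t [^] m = (t [^] (r ^ j)) [^] (m div r ^ j) \<otimes> t [^] (m mod r ^ j)"
        using tc by (simp add: nat_pow_pow nat_pow_mult)
      then have "len (t [^] m) \<le> len ((t [^] (r ^ j)) [^] (m div r ^ j)) + len (t [^] (m mod r ^ j))"
        using len_mult tc by simp
      also have "\<dots> \<le> (m div r ^ j) * len (t [^] (r ^ j)) + (C1 + C2) * r"
        using tc pow[OF r, of "m mod r ^ j"] rj by (intro add_mono len_pow) (auto simp: less_imp_le)
      also have "\<dots> \<le> K * ((C1 + C2) * r) + (C1 + C2) * r"
        using q pow[OF r, of "r ^ j"] by (intro add_mono mult_le_mono) auto
      also have "\<dots> = (K + 1) * (C1 + C2) * r" by (simp add: algebra_simps)
      finally have "len (t [^] x) \<le> (K + 1) * (C1 + C2) * r"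
        using len_int_pow[OF tc, of x] unfolding m_def by linarith
      moreover have "len (word_elem G V) \<le> C3 * r" using C3 r x by blast
      moreover have "word_elem G V \<in> carrier G" using x by (simp add: layer_def)
      ultimately show ?thesis using x(1) len_mult[of "t [^] x" "word_elem G V"] tc by (simp add: distrib_right)
    qed
    then show "\<exists>C. \<forall>r\<ge>1. \<forall>U. layer j (insert t X) U \<and> mass (real r) U \<le> M \<longrightarrow> len (word_elem G U) \<le> C * r" by blast
  qed
qed

definition covers :: "nat \<Rightarrow> nat \<Rightarrow> 'a set \<Rightarrow> real \<Rightarrow> real \<Rightarrow> 'a set \<Rightarrow> bool" where
  "covers r j X C M Y \<longleftrightarrow> finite Y \<and> Y \<subseteq> carrier G \<and>
     (\<forall>U. layer j X U \<longrightarrow> mass (real r) U \<le> M \<longrightarrow>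
        (\<exists>y\<in>Y. \<exists>V. valid V \<and> min_weight j V \<and> mass r V \<le> C \<and> word_elem G U = y \<otimes> word_elem G V))"

lemma covers_empty: "covers r (Suc j) {x. bracket G E (Suc j) x} C M Y \<Longrightarrow> covers r j {} C M Y"
proof -
  assume Y: "covers r (Suc j) {x. bracket G E (Suc j) x} C M Y"
  have "\<exists>y\<in>Y. \<exists>V. valid V \<and> min_weight j V \<and> mass r V \<le> C \<and> word_elem G U = y \<otimes> word_elem G V"
    if U: "layer j {} U" "mass (real r) U \<le> M" for U
  proof -
    obtain y V where "y \<in> Y" "valid V" "min_weight (Suc j) V" "mass r V \<le> C" "word_elem G U = y \<otimes> word_elem G V"
      using Y layer_empty[OF U(1)] U(2) unfolding covers_def by blast
    moreover from this have "min_weight j V" by (auto simp: min_weight_def)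
    ultimately show ?thesis by blast
  qed
  then show ?thesis using Y unfolding covers_def by blast
qed

lemma covers_trivial: "j > 2 ^ c \<Longrightarrow> covers r j X 0 M {\<one>}"
  using word_elem_trivial by (auto simp: covers_def layer_def intro!: exI[of _ "[]"])

text \<open>The point is that C does not depend on M: words of any bounded mass are covered by boundedly
  many translates of those of mass at most C.\<close>

lemma cover_layer:
  "\<exists>C\<ge>0. \<forall>M. \<exists>N. \<forall>r\<ge>1. \<exists>Y. card Y \<le> N \<and> covers r j {x. bracket G E j x} C M Y"
proof (induction rule: layer_induct)
  case (1 j X)
  then have "card {\<one>} \<le> 1 \<and> covers r j X 0 M {\<one>}" for r M using covers_trivial by simp
  then show ?case by (intro exI[of _ 0] conjI allI exI[of _ 1] impI exI[of _ "{\<one>}"]) auto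
next
  case (2 j)
  then show ?case using covers_empty by meson
next
  case (3 j X t)
  have tc: "t \<in> carrier G" using bracket_carrier[OF 3(1)] .
  from 3(3) obtain C0 where C0: "C0 \<ge> 0"
    "\<And>M. \<exists>N. \<forall>r\<ge>1. \<exists>Y. card Y \<le> N \<and> covers r j X C0 M Y" by blast
  show ?case
  proof (intro exI[of _ "C0 + 1"] conjI allI)
    show "0 \<le> C0 + 1" using C0 by simp
    fix M :: real
    \<comment> \<open>The word left by \<open>split_powers\<close> has mass at most |M| exp |M|; the
      factor \<open>exp 1\<close> pays for conjugating it by t^z with z \<le> r^j.\<close>
    from C0(2)[of "\<bar>M\<bar> * exp \<bar>M\<bar> * exp 1"] obtain N where
      N: "\<And>r. r \<ge> 1 \<Longrightarrow> \<exists>Y. card Y \<le> N \<and> covers r j X C0 (\<bar>M\<bar> * exp \<bar>M\<bar> * exp 1) Y" by blast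
    define K where "K = \<lceil>\<bar>M\<bar>\<rceil> + 1"
    define I where "I = {- K..K}"
    show "\<exists>N. \<forall>r\<ge>1. \<exists>Y. card Y \<le> N \<and> covers r j (insert t X) (C0 + 1) M Y"
    proof (intro exI[of _ "card I * N"] allI impI)
      fix r :: nat assume r: "r \<ge> 1"
      have rp: "real r > 0" using r by simp
      obtain Y where cY: "card Y \<le> N" and covY: "covers r j X C0 (\<bar>M\<bar> * exp \<bar>M\<bar> * exp 1) Y"
        using N[OF r] by blast
      have Y: "finite Y" "Y \<subseteq> carrier G" using covY by (auto simp: covers_def)
      have Y4: "\<exists>y\<in>Y. \<exists>V. valid V \<and> min_weight j V \<and> mass r V \<le> C0 \<and> word_elem G U = y \<otimes> word_elem G V"
        if "layer j X U" "mass (real r) U \<le> \<bar>M\<bar> * exp \<bar>M\<bar> * exp 1" for U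
        using covY that by (auto simp: covers_def)
      define Z where "Z = (\<lambda>(q, y). t [^] (q * int r ^ j) \<otimes> y) ` (I \<times> Y)"
      have "card Z \<le> card (I \<times> Y)" unfolding Z_def using Y by (intro card_image_le) (auto simp: I_def)
      also have "\<dots> \<le> card I * N" using cY by (simp add: card_cartesian_product)
      finally have cZ: "card Z \<le> card I * N" .
      have "\<exists>y\<in>Z. \<exists>V. valid V \<and> min_weight j V \<and> mass r V \<le> C0 + 1 \<and> word_elem G U = y \<otimes> word_elem G V"
        if U: "layer j (insert t X) U" "mass (real r) U \<le> M" for U
      proof -
        have "mass r U \<le> \<bar>M\<bar>" using U by linarith
        from split_powers[OF U(1) 3(1) r this] obtain x V where x: "word_elem G U = t [^] (x::int) \<otimes> word_elem G V"
          "\<bar>x\<bar> \<le> \<bar>M\<bar> * real r ^ j" "layer j X V" "mass r V \<le> \<bar>M\<bar> * exp \<bar>M\<bar>" by blast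
        \<comment> \<open>Write x = q R + z with 0 \<le> z < R and t^x V = t^(q R) (t^z V t^-z) t^z.
          Only the boundedly many blocks t^(q R) enter the translate; the remainder t^z stays at the
          right end and adds at most 1 to the mass, whatever M is.\<close>
        define R where "R = int r ^ j"
        have R: "R > 0" using r by (simp add: R_def)
        define z where "z = nat (x mod R)"
        have z: "int z = x mod R" "z \<le> r ^ j"
        proof -
          show *: "int z = x mod R" using R by (simp add: z_def)
          have "x mod R < R" using R by simp
          then have "int z < int (r ^ j)" using * by (simp add: R_def)
          then show "z \<le> r ^ j" by linarith
        qed
        have "real_of_int \<bar>x\<bar> \<le> real_of_int (\<lceil>\<bar>M\<bar>\<rceil> * R)"
        proof -
          have "\<bar>M\<bar> * real r ^ j \<le> real_of_int \<lceil>\<bar>M\<bar>\<rceil> * real r ^ j" by (intro mult_right_mono) auto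
          then show ?thesis using x(2) by (simp add: R_def)
        qed
        then have xR: "\<bar>x\<bar> \<le> \<lceil>\<bar>M\<bar>\<rceil> * R" by linarith
        have "x div R \<le> (\<lceil>\<bar>M\<bar>\<rceil> * R) div R" using xR R by (intro zdiv_mono1) auto
        moreover have "(- (\<lceil>\<bar>M\<bar>\<rceil> * R)) div R \<le> x div R" using xR R by (intro zdiv_mono1) auto
        moreover have "(- (\<lceil>\<bar>M\<bar>\<rceil> * R)) div R = - \<lceil>\<bar>M\<bar>\<rceil>"
          using nonzero_mult_div_cancel_right[of R "- \<lceil>\<bar>M\<bar>\<rceil>"] R by simp
        ultimately have q: "x div R \<in> I" using R by (auto simp: I_def K_def)
        \<comment> \<open>Inverse letters, because \<open>conj_word\<close> forms L^-1 V L and t^z V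
          t^-z is wanted.\<close>
        define L where "L = replicate z (j, inv t)"
        have wdL: "valid L" unfolding L_def by (rule valid_replicate[OF bracket_inv[OF 3(1)]])
        have vL: "word_elem G L = inv (t [^] z)" using tc by (simp add: L_def word_elem_replicate nat_pow_inv)
        have zr: "real z / real r ^ j \<le> 1" using z rp by (auto simp: divide_le_eq simp flip: of_nat_power)
        have V: "valid V" using x by (simp add: layer_def)
        have "mass r V * exp (mass r L) \<le> \<bar>M\<bar> * exp \<bar>M\<bar> * exp 1"
          using x zr rp by (intro mult_mono) (auto simp: L_def)
        then have m: "mass r (conj_word G L V) \<le> \<bar>M\<bar> * exp \<bar>M\<bar> * exp 1"
          using mass_conj_word[OF rp, of G L V] by linarith
        have "layer j X (conj_word G L V)"
          using x(3) valid_conj_word[OF V wdL] min_weight_conj_word[OF wdL, of j V] set_conj_word[OF wdL, of _ V]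
          by (fastforce simp: layer_def min_weight_def)
        from Y4[OF this m] obtain y V' where y: "y \<in> Y" "valid V'" "min_weight j V'" "mass r V' \<le> C0" "word_elem G (conj_word G L V) = y \<otimes> word_elem G V'"
          by blast
        have yc: "y \<in> carrier G" using y Y by auto
        have wdV: "valid (V' @ replicate z (j, t))" using y valid_replicate[OF 3(1)] by simp
        have val: "word_elem G (V' @ replicate z (j, t)) = word_elem G V' \<otimes> t [^] z"
          using y valid_replicate[OF 3(1), of z] tc by (simp add: word_elem_replicate)
        have "t [^] x = t [^] (x div R * R) \<otimes> t [^] (x mod R)"
          using tc by (simp flip: int_pow_mult)
        also have "t [^] (x mod R) = t [^] z" by (simp flip: z(1) add: int_pow_int)
        finally have "word_elem G U = t [^] (x div R * R) \<otimes> (t [^] z \<otimes> word_elem G V \<otimes> inv (t [^] z)) \<otimes> t [^] z"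
          using x(1) tc V by (simp add: m_assoc)
        also have "t [^] z \<otimes> word_elem G V \<otimes> inv (t [^] z) = y \<otimes> word_elem G V'"
          using y(5) word_elem_conj_word[OF V wdL] tc by (simp add: vL)
        finally have "word_elem G U = (t [^] (x div R * R) \<otimes> y) \<otimes> word_elem G (V' @ replicate z (j, t))"
          using val tc yc y by (simp add: m_assoc)
        moreover have "t [^] (x div R * R) \<otimes> y \<in> Z" unfolding Z_def R_def[symmetric] using q y by force
        moreover have "min_weight j (V' @ replicate z (j, t))" "mass r (V' @ replicate z (j, t)) \<le> C0 + 1"
          using y zr by (auto simp: min_weight_def)
        ultimately show ?thesis using wdV by blast
      qed
      moreover have "finite Z" "Z \<subseteq> carrier G" using Y tc by (auto simp: Z_def I_def)
      ultimately have "covers r j (insert t X) (C0 + 1) M Z" by (auto simp: covers_def)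
      then show "\<exists>Y. card Y \<le> card I * N \<and> covers r j (insert t X) (C0 + 1) M Y"
        using cZ by blast
    qed
  qed
qed

end

section \<open>Volume doubling in nilpotent groups\<close>

context sym_gen_group
begin

definition gball :: "real \<Rightarrow> 'a set" where
  "gball t = {x \<in> carrier G. real (len x) \<le> t}"

definition vol :: "real \<Rightarrow> real" where
  "vol t = real (card (gball t))"

lemma finite_gball [simp]: "finite (gball t)"
proof (rule finite_subset)
  show "gball t \<subseteq> lprod G ` {xs. set xs \<subseteq> E \<and> length xs \<le> nat \<lfloor>t\<rfloor>}"
  proof
    fix x assume x: "x \<in> gball t"
    then have xc: "x \<in> carrier G" by (simp add: gball_def)
    obtain xs where "set xs \<subseteq> E" "length xs = len x" "lprod G xs = x" by (rule len_attained[OF xc])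
    moreover have "len x \<le> nat \<lfloor>t\<rfloor>" using x by (simp add: gball_def le_nat_floor)
    ultimately show "x \<in> lprod G ` {xs. set xs \<subseteq> E \<and> length xs \<le> nat \<lfloor>t\<rfloor>}"
      by (intro image_eqI[of _ _ xs]) auto
  qed
qed (simp add: finite_lists_length_le E_fin)

lemma gball_mono: "s \<le> t \<Longrightarrow> gball s \<subseteq> gball t"
  by (auto simp: gball_def)

lemma vol_mono: "s \<le> t \<Longrightarrow> vol s \<le> vol t"
  unfolding vol_def by (intro of_nat_mono card_mono gball_mono) simp_all

lemma vol_ge_1: "t \<ge> 0 \<Longrightarrow> vol t \<ge> 1"
proof -
  assume "t \<ge> 0"
  then have "{\<one>} \<subseteq> gball t" by (auto simp: gball_def)
  then have "card {\<one>} \<le> card (gball t)" by (intro card_mono) simp_all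
  then show ?thesis by (simp add: vol_def)
qed

end

context sym_gen_nilpotent_group
begin

text \<open>A product of at most K r generators has mass at most K at scale r. It therefore lies in
  one of boundedly many translates of the elements of mass at most C0, and those have length at most
  C r, where C is chosen before K.\<close>

lemma vol_cover: "\<exists>C. \<forall>K. \<exists>N. \<forall>r\<ge>1. vol (real (K * r)) \<le> real N * vol (real (C * r))"
proof -
  obtain C0 where C0: "\<And>M. \<exists>N. \<forall>r\<ge>1. \<exists>Y. card Y \<le> N \<and> covers r 1 {x. bracket G E 1 x} C0 M Y"
    using cover_layer[of 1] by blast
  obtain C where C: "\<And>r U. r \<ge> 1 \<Longrightarrow> layer 1 {x. bracket G E 1 x} U \<Longrightarrow> mass (real r) U \<le> C0 \<Longrightarrow> len (word_elem G U) \<le> C * r"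
    using len_word_elem_layer[of 1] by blast
  show ?thesis
  proof (rule exI[of _ C], rule allI)
    fix K
    obtain N where N: "\<And>r. r \<ge> 1 \<Longrightarrow> \<exists>Y. card Y \<le> N \<and> covers r 1 {x. bracket G E 1 x} C0 (real K) Y"
      using C0 by blast
    have "vol (real (K * r)) \<le> real N * vol (real (C * r))" if r: "r \<ge> 1" for r
    proof -
      obtain Y where Y: "card Y \<le> N" "covers r 1 {x. bracket G E 1 x} C0 (real K) Y" using N[OF r] by blast
      then have fin: "finite Y" by (simp add: covers_def)
      have sub: "gball (real (K * r)) \<subseteq> (\<Union>y\<in>Y. (\<otimes>) y ` gball (real (C * r)))"
      proof
        fix x assume x: "x \<in> gball (real (K * r))"
        then have xc: "x \<in> carrier G" and xl: "len x \<le> K * r" by (simp_all add: gball_def del: of_nat_mult)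
        obtain xs where xs: "set xs \<subseteq> E" "length xs = len x" "lprod G xs = x" by (rule len_attained[OF xc])
        define U where "U = map (\<lambda>x. (1::nat, x)) xs"
        have "valid U" using xs(1) by (auto simp: U_def valid_def intro: bracket.base[simplified])
        moreover have "min_weight 1 U" by (auto simp: U_def min_weight_def)
        ultimately have cU: "layer 1 {x. bracket G E 1 x} U" by (rule layer_full)
        have "mass r U = real (length U) / real r ^ 1" by (rule mass_const) (auto simp: U_def)
        also have "\<dots> \<le> real K"
          using r xs(2) xl by (simp add: U_def divide_le_eq flip: of_nat_mult)
        finally have mU: "mass r U \<le> real K" .
        obtain y V where y: "y \<in> Y" "valid V" "min_weight 1 V" "mass r V \<le> C0" "word_elem G U = y \<otimes> word_elem G V"
          using Y(2) cU mU unfolding covers_def by blast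
        have "word_elem G U = x" using xs(3) by (simp add: U_def word_elem_def comp_def)
        moreover have "len (word_elem G V) \<le> C * r" using r y by (intro C layer_full) auto
        ultimately show "x \<in> (\<Union>y\<in>Y. (\<otimes>) y ` gball (real (C * r)))"
          using y by (intro UN_I[of y] image_eqI[of _ _ "word_elem G V"]) (auto simp: gball_def simp flip: of_nat_mult)
      qed
      have "card (gball (real (K * r))) \<le> card (\<Union>y\<in>Y. (\<otimes>) y ` gball (real (C * r)))"
        using sub fin by (intro card_mono) auto
      also have "\<dots> \<le> (\<Sum>y\<in>Y. card ((\<otimes>) y ` gball (real (C * r))))" by (rule card_UN_le[OF fin])
      also have "\<dots> \<le> (\<Sum>y\<in>Y. card (gball (real (C * r))))" by (intro sum_mono card_image_le) simp
      also have "\<dots> \<le> N * card (gball (real (C * r)))" using Y by simp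
      finally show ?thesis unfolding vol_def by (simp flip: of_nat_mult)
    qed
    then show "\<exists>N. \<forall>r\<ge>1. vol (real (K * r)) \<le> real N * vol (real (C * r))" by blast
  qed
qed

lemma vol_doubling: "\<exists>K. \<forall>t\<ge>0. vol (2 * t) \<le> K * vol t"
proof -
  obtain C where "\<forall>K. \<exists>N. \<forall>r\<ge>1. vol (real (K * r)) \<le> real N * vol (real (C * r))" using vol_cover by blast
  \<comment> \<open>The dilation 4 (C + 1) may be chosen after C. With r the integer part of t / (C
    + 1) it gives both C r \<le> t and 2 t \<le> 4 (C + 1) r.\<close>
  then obtain N where N: "\<And>r. r \<ge> 1 \<Longrightarrow> vol (real (4 * (C + 1) * r)) \<le> real N * vol (real (C * r))" by blast
  define D where "D = real (C + 1)"
  have D: "D \<ge> 1" by (simp add: D_def)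
  have "vol (2 * t) \<le> max (real N) (vol (2 * D)) * vol t" if t: "t \<ge> 0" for t
  proof (cases "t \<ge> D")
    case True
    define r where "r = nat \<lfloor>t / D\<rfloor>"
    have 1: "real r \<le> t / D" using t D by (simp add: r_def)
    have "1 \<le> t / D" using True D by simp
    then have r: "r \<ge> 1" unfolding r_def by linarith
    have "t / D < real r + 1" unfolding r_def by linarith
    then have "t / D \<le> 2 * real r" using r by simp
    then have "2 * t \<le> 4 * D * real r" using D by (simp add: field_simps)
    then have "vol (2 * t) \<le> vol (real (4 * (C + 1) * r))" by (intro vol_mono) (simp add: D_def algebra_simps)
    also have "\<dots> \<le> real N * vol (real (C * r))" by (rule N[OF r])
    also have "vol (real (C * r)) \<le> vol t"
    proof (rule vol_mono)
      have "real (C * r) \<le> D * real r" by (simp add: D_def distrib_right)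
      also have "\<dots> \<le> t" using 1 D by (simp add: field_simps)
      finally show "real (C * r) \<le> t" .
    qed
    also have "real N * vol t \<le> max (real N) (vol (2 * D)) * vol t"
      using vol_ge_1[OF t] by (intro mult_right_mono) auto
    finally show ?thesis by (simp add: mult_left_mono)
  next
    case False
    have "vol (2 * t) \<le> vol (2 * D)" using False by (intro vol_mono) simp
    also have "\<dots> \<le> max (real N) (vol (2 * D)) * vol t"
      using vol_ge_1[OF t] vol_ge_1[of "2 * D"] D mult_mono[of "vol (2 * D)" "max (real N) (vol (2 * D))" 1 "vol t"] by simp
    finally show ?thesis .
  qed
  then show ?thesis by blast
qed

end

section \<open>Return probabilities of the lazy walk\<close>

text \<open>Steps are labels and not group elements: distinct letters of a presentation may have the
  same value, and the walk is uniform on letters. The involution \<open>iv\<close> makes the step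
  law symmetric, \<open>idl\<close> makes it lazy, and of nilpotency only \<open>doubling\<close> is
  kept.\<close>

locale lazy_walk = sym_gen_group +
  fixes S :: "'s set" and st :: "'s \<Rightarrow> 'a" and iv :: "'s \<Rightarrow> 's" and idl :: 's and D :: real
  assumes S_fin: "finite S" and st_S: "st ` S = E"
    and iv_S: "s \<in> S \<Longrightarrow> iv s \<in> S" and iv_iv: "s \<in> S \<Longrightarrow> iv (iv s) = s"
    and st_iv: "s \<in> S \<Longrightarrow> st (iv s) = inv (st s)"
    and idl: "idl \<in> S" "st idl = \<one>"
    and doubling: "t \<ge> 0 \<Longrightarrow> vol (2 * t) \<le> D * vol t"
begin

definition q :: real where "q = real (card S)"

text \<open>An infinite sum over the whole carrier, so that translations reindex it without any
  tracking of supports.\<close>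

definition total :: "('a \<Rightarrow> real) \<Rightarrow> real" where "total f = infsum f (carrier G)"

definition finsupp :: "('a \<Rightarrow> real) \<Rightarrow> bool" where "finsupp f \<longleftrightarrow> finite {x \<in> carrier G. f x \<noteq> 0}"

definition stepop :: "('a \<Rightarrow> real) \<Rightarrow> 'a \<Rightarrow> real" where
  "stepop f x = (\<Sum>s\<in>S. f (x \<otimes> st s)) / q"

definition point_mass :: "'a \<Rightarrow> 'a \<Rightarrow> real" where "point_mass y x = (if x = y then 1 else 0)"

definition p :: "nat \<Rightarrow> 'a \<Rightarrow> real" where "p n = (stepop ^^ n) (point_mass \<one>)"

definition u :: "nat \<Rightarrow> real" where "u n = p (2 * n) \<one>"

lemma st_E: "s \<in> S \<Longrightarrow> st s \<in> E" using st_S by auto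

lemma st_closed [simp]: "s \<in> S \<Longrightarrow> st s \<in> carrier G" using st_E E_carrier by auto

lemma q_ge_1: "q \<ge> 1"
  using card_gt_0_iff[of S] S_fin idl unfolding q_def by (auto simp: Suc_le_eq)

lemma D_ge_1: "D \<ge> 1"
proof -
  have "vol 0 \<le> D * vol 0" using doubling[of 0] by simp
  then show ?thesis using vol_ge_1[of 0] by simp
qed

lemma bij_iv: "bij_betw iv S S"
  by (rule bij_betwI[of _ _ _ iv]) (auto simp: iv_S iv_iv)

section \<open>Sums of finitely supported functions over the group\<close>

lemma finsupp_subset: "finsupp f \<Longrightarrow> (\<And>x. x \<in> carrier G \<Longrightarrow> f x = 0 \<Longrightarrow> g x = 0) \<Longrightarrow> finsupp g"
  unfolding finsupp_def by (erule rev_finite_subset) auto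

lemma finsupp_mult1: "finsupp f \<Longrightarrow> finsupp (\<lambda>x. f x * g x)"
  by (erule finsupp_subset) auto

lemma finsupp_mult2: "finsupp g \<Longrightarrow> finsupp (\<lambda>x. f x * g x)"
  by (erule finsupp_subset) auto

lemma finsupp_add: "finsupp f \<Longrightarrow> finsupp g \<Longrightarrow> finsupp (\<lambda>x. f x + g x)"
  unfolding finsupp_def by (rule finite_subset[of _ "{x \<in> carrier G. f x \<noteq> 0} \<union> {x \<in> carrier G. g x \<noteq> 0}"]) auto

lemma finsupp_diff: "finsupp f \<Longrightarrow> finsupp g \<Longrightarrow> finsupp (\<lambda>x. f x - g x)"
  unfolding finsupp_def by (rule finite_subset[of _ "{x \<in> carrier G. f x \<noteq> 0} \<union> {x \<in> carrier G. g x \<noteq> 0}"]) auto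

lemma finsupp_sum: "finite A \<Longrightarrow> (\<And>i. i \<in> A \<Longrightarrow> finsupp (f i)) \<Longrightarrow> finsupp (\<lambda>x. \<Sum>i\<in>A. f i x)"
proof (induction A rule: finite_induct)
  case empty
  then show ?case by (simp add: finsupp_def)
next
  case (insert a A)
  then show ?case using finsupp_add[of "f a" "\<lambda>x. \<Sum>i\<in>A. f i x"] by simp
qed

lemma finsupp_power: "finsupp f \<Longrightarrow> n > 0 \<Longrightarrow> finsupp (\<lambda>x. f x ^ n)"
  by (erule finsupp_subset) auto

lemma bij_shiftr: "y \<in> carrier G \<Longrightarrow> bij_betw (\<lambda>x. x \<otimes> y) (carrier G) (carrier G)"
  by (rule bij_betwI[of _ _ _ "\<lambda>x. x \<otimes> inv y"]) (auto simp: m_assoc)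

lemma bij_shiftl: "y \<in> carrier G \<Longrightarrow> bij_betw (\<lambda>x. y \<otimes> x) (carrier G) (carrier G)"
  by (rule bij_betwI[of _ _ _ "\<lambda>x. inv y \<otimes> x"]) (auto simp: m_assoc)

lemma finsupp_bij:
  assumes "finsupp f" "bij_betw h (carrier G) (carrier G)"
  shows "finsupp (\<lambda>x. f (h x))"
proof -
  have "h ` {x \<in> carrier G. f (h x) \<noteq> 0} \<subseteq> {x \<in> carrier G. f x \<noteq> 0}"
    using assms(2) by (auto simp: bij_betw_def)
  moreover have "inj_on h {x \<in> carrier G. f (h x) \<noteq> 0}"
    using assms(2) by (auto simp: bij_betw_def intro: inj_on_subset)
  ultimately show ?thesis using assms(1) unfolding finsupp_def by (meson finite_imageD finite_subset)
qed

lemma finsupp_shiftr: "finsupp f \<Longrightarrow> y \<in> carrier G \<Longrightarrow> finsupp (\<lambda>x. f (x \<otimes> y))"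
  by (rule finsupp_bij[OF _ bij_shiftr])

lemma finsupp_shiftl: "finsupp f \<Longrightarrow> y \<in> carrier G \<Longrightarrow> finsupp (\<lambda>x. f (y \<otimes> x))"
  by (rule finsupp_bij[OF _ bij_shiftl])

lemma total_shiftr: "y \<in> carrier G \<Longrightarrow> total (\<lambda>x. f (x \<otimes> y)) = total f"
  unfolding total_def by (rule infsum_reindex_bij_betw[OF bij_shiftr])

lemma total_shiftl: "y \<in> carrier G \<Longrightarrow> total (\<lambda>x. f (y \<otimes> x)) = total f"
  unfolding total_def by (rule infsum_reindex_bij_betw[OF bij_shiftl])

lemma total_eq_sum:
  assumes "finite A" "A \<subseteq> carrier G" "\<And>x. x \<in> carrier G \<Longrightarrow> x \<notin> A \<Longrightarrow> f x = 0"
  shows "total f = sum f A"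
proof -
  have "total f = infsum f A" unfolding total_def by (rule infsum_cong_neutral) (use assms in auto)
  then show ?thesis using assms(1) by simp
qed

lemma finsupp_summable: "finsupp f \<Longrightarrow> f summable_on carrier G"
proof -
  assume f: "finsupp f"
  have "f summable_on {x \<in> carrier G. f x \<noteq> 0}" using f by (intro summable_on_finite) (simp add: finsupp_def)
  then show ?thesis by (rule summable_on_cong_neutral[THEN iffD1, rotated -1]) auto
qed

lemma total_cong: "(\<And>x. x \<in> carrier G \<Longrightarrow> f x = g x) \<Longrightarrow> total f = total g"
  unfolding total_def by (rule infsum_cong)

lemma total_add: "finsupp f \<Longrightarrow> finsupp g \<Longrightarrow> total (\<lambda>x. f x + g x) = total f + total g"
  unfolding total_def by (intro infsum_add finsupp_summable)

lemma total_cmult: "total (\<lambda>x. c * f x) = c * total f"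
  unfolding total_def by (rule infsum_cmult_right')

lemma total_diff: "finsupp f \<Longrightarrow> finsupp g \<Longrightarrow> total (\<lambda>x. f x - g x) = total f - total g"
  using total_add[of f "\<lambda>x. - 1 * g x"] finsupp_mult2[of g "\<lambda>x. - 1"] total_cmult[of "- 1" g] by simp

lemma total_divide: "total (\<lambda>x. f x / c) = total f / c"
  unfolding total_def by (simp add: divide_inverse infsum_cmult_left')

lemma total_sum: "finite A \<Longrightarrow> (\<And>i. i \<in> A \<Longrightarrow> finsupp (f i)) \<Longrightarrow> total (\<lambda>x. \<Sum>i\<in>A. f i x) = (\<Sum>i\<in>A. total (f i))"
proof (induction A rule: finite_induct)
  case empty
  then show ?case by (simp add: total_def)
next
  case (insert a A)
  then have "finsupp (f a)" "finsupp (\<lambda>x. \<Sum>i\<in>A. f i x)" by (auto intro: finsupp_sum)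
  with insert show ?case by (simp add: total_add)
qed

lemma total_mono: "finsupp f \<Longrightarrow> finsupp g \<Longrightarrow> (\<And>x. x \<in> carrier G \<Longrightarrow> f x \<le> g x) \<Longrightarrow> total f \<le> total g"
  unfolding total_def by (intro infsum_mono finsupp_summable)

lemma total_nonneg: "(\<And>x. x \<in> carrier G \<Longrightarrow> 0 \<le> f x) \<Longrightarrow> 0 \<le> total f"
  unfolding total_def by (rule infsum_nonneg)

section \<open>The averaging operator and the transition probabilities\<close>

lemma finsupp_stepop: "finsupp f \<Longrightarrow> finsupp (stepop f)"
proof -
  assume f: "finsupp f"
  have "finsupp (\<lambda>x. \<Sum>s\<in>S. f (x \<otimes> st s))" using f by (intro finsupp_sum S_fin finsupp_shiftr) auto
  then show ?thesis by (rule finsupp_subset) (simp add: stepop_def)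
qed

text \<open>Symmetry of the step law: translate the term of s by \<open>st s\<close>, then rename s
  to \<open>iv s\<close>. The test function g may be arbitrary, for instance constant.\<close>

lemma stepop_adjoint:
  assumes "finsupp f"
  shows "total (\<lambda>x. stepop f x * g x) = total (\<lambda>x. f x * stepop g x)"
proof -
  have "total (\<lambda>x. stepop f x * g x) = total (\<lambda>x. (\<Sum>s\<in>S. f (x \<otimes> st s) * g x) / q)"
    by (rule total_cong) (simp add: stepop_def sum_distrib_right sum_divide_distrib)
  also have "\<dots> = (\<Sum>s\<in>S. total (\<lambda>x. f (x \<otimes> st s) * g x)) / q"
    unfolding total_divide using assms by (subst total_sum) (auto intro!: finsupp_mult1 finsupp_shiftr S_fin)
  also have "(\<Sum>s\<in>S. total (\<lambda>x. f (x \<otimes> st s) * g x)) = (\<Sum>s\<in>S. total (\<lambda>x. f x * g (x \<otimes> st (iv s))))"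
  proof (intro sum.cong refl)
    fix s assume s: "s \<in> S"
    have "total (\<lambda>x. f x * g (x \<otimes> st (iv s))) = total (\<lambda>x. f (x \<otimes> st s) * g (x \<otimes> st s \<otimes> st (iv s)))"
      using total_shiftr[of "st s" "\<lambda>x. f x * g (x \<otimes> st (iv s))"] s by simp
    also have "\<dots> = total (\<lambda>x. f (x \<otimes> st s) * g x)"
      by (rule total_cong) (simp add: s st_iv m_assoc)
    finally show "total (\<lambda>x. f (x \<otimes> st s) * g x) = total (\<lambda>x. f x * g (x \<otimes> st (iv s)))" by simp
  qed
  also have "\<dots> = (\<Sum>s\<in>S. total (\<lambda>x. f x * g (x \<otimes> st s)))"
    by (rule sum.reindex_bij_betw[OF bij_iv])
  also have "\<dots> / q = total (\<lambda>x. (\<Sum>s\<in>S. f x * g (x \<otimes> st s)) / q)"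
    unfolding total_divide using assms by (subst total_sum) (auto intro!: finsupp_mult1 S_fin)
  also have "\<dots> = total (\<lambda>x. f x * stepop g x)"
    by (rule total_cong) (simp add: stepop_def sum_distrib_left)
  finally show ?thesis .
qed

lemma finsupp_pow: "finsupp f \<Longrightarrow> finsupp ((stepop ^^ n) f)"
  by (induction n) (auto intro: finsupp_stepop)

lemma pow_adjoint: "finsupp f \<Longrightarrow> total (\<lambda>x. (stepop ^^ n) f x * g x) = total (\<lambda>x. f x * (stepop ^^ n) g x)"
proof (induction n arbitrary: g)
  case (Suc n)
  have "total (\<lambda>x. (stepop ^^ Suc n) f x * g x) = total (\<lambda>x. (stepop ^^ n) f x * stepop g x)"
    using Suc.prems by (simp add: stepop_adjoint finsupp_pow)
  also have "\<dots> = total (\<lambda>x. f x * (stepop ^^ n) (stepop g) x)" using Suc by simp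
  finally show ?case by (simp add: funpow_swap1)
qed simp

lemma stepop_cong: "(\<And>x. x \<in> carrier G \<Longrightarrow> f x = g x) \<Longrightarrow> x \<in> carrier G \<Longrightarrow> stepop f x = stepop g x"
  unfolding stepop_def by (intro arg_cong2[of _ _ _ _ "(/)"] sum.cong refl) simp

lemma pow_shiftl:
  assumes "y \<in> carrier G"
  shows "x \<in> carrier G \<Longrightarrow> (stepop ^^ n) (\<lambda>x. f (y \<otimes> x)) x = (stepop ^^ n) f (y \<otimes> x)"
proof (induction n arbitrary: x)
  case (Suc n)
  have "stepop ((stepop ^^ n) (\<lambda>x. f (y \<otimes> x))) x = stepop (\<lambda>x. (stepop ^^ n) f (y \<otimes> x)) x"
    using Suc by (intro stepop_cong) auto
  also have "\<dots> = stepop ((stepop ^^ n) f) (y \<otimes> x)"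
    using Suc.prems assms by (simp add: stepop_def m_assoc)
  finally show ?case by simp
qed simp

lemma pow_cong:
  assumes "\<And>x. x \<in> carrier G \<Longrightarrow> f x = g x"
  shows "x \<in> carrier G \<Longrightarrow> (stepop ^^ n) f x = (stepop ^^ n) g x"
  by (induction n arbitrary: x) (use assms in \<open>auto intro: stepop_cong\<close>)

lemma finsupp_point_mass: "finsupp (point_mass y)"
  unfolding finsupp_def by (rule finite_subset[of _ "{y}"]) (auto simp: point_mass_def)

lemma finsupp_p [simp]: "finsupp (p n)"
  unfolding p_def by (intro finsupp_pow finsupp_point_mass)

lemma p_Suc: "p (Suc n) x = stepop (p n) x"
  by (simp add: p_def)

lemma p_nonneg [simp]: "p n x \<ge> 0"
proof (induction n arbitrary: x)
  case (Suc n)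
  then show ?case using q_ge_1 unfolding p_Suc stepop_def
    by (intro divide_nonneg_nonneg sum_nonneg) auto
qed (simp add: p_def point_mass_def)

lemma total_point_mass: "y \<in> carrier G \<Longrightarrow> total (\<lambda>x. f x * point_mass y x) = f y"
  by (subst total_eq_sum[of "{y}"]) (auto simp: point_mass_def)

text \<open>Averaging over right factors commutes with left translation, so the translate of
  \<open>p n\<close> by y is the n-th power of the operator at the point mass of y. Self-adjointness
  moves that power onto \<open>p m\<close>.\<close>

lemma p_inner:
  assumes "y \<in> carrier G"
  shows "total (\<lambda>x. p m x * p n (inv y \<otimes> x)) = p (m + n) y"
proof -
  have 1: "(stepop ^^ n) (point_mass y) x = p n (inv y \<otimes> x)" if x: "x \<in> carrier G" for x
  proof -
    have "(stepop ^^ n) (point_mass y) x = (stepop ^^ n) (\<lambda>x. point_mass \<one> (inv y \<otimes> x)) x"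
    proof (rule pow_cong[OF _ x])
      fix z assume z: "z \<in> carrier G"
      have "inv y \<otimes> z = \<one> \<longleftrightarrow> z = y"
        using z assms inv_solve_left'[of "\<one>" y z] by auto
      then show "point_mass y z = point_mass \<one> (inv y \<otimes> z)" by (simp add: point_mass_def)
    qed
    also have "\<dots> = p n (inv y \<otimes> x)" unfolding p_def using assms x by (intro pow_shiftl) auto
    finally show ?thesis .
  qed
  have "total (\<lambda>x. p m x * p n (inv y \<otimes> x)) = total (\<lambda>x. p m x * (stepop ^^ n) (point_mass y) x)"
    by (rule total_cong) (simp add: 1)
  also have "\<dots> = total (\<lambda>x. (stepop ^^ n) (p m) x * point_mass y x)"
    by (rule pow_adjoint[symmetric]) simp
  also have "\<dots> = (stepop ^^ n) (p m) y" by (rule total_point_mass[OF assms])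
  also have "\<dots> = p (m + n) y" unfolding p_def by (simp add: funpow_add add.commute[of m])
  finally show ?thesis .
qed

lemma total_p: "total (p n) = 1"
proof -
  have "stepop (\<lambda>x. 1) = (\<lambda>x. 1)" using q_ge_1 unfolding stepop_def q_def by auto
  then have "(stepop ^^ n) (\<lambda>x. 1) = (\<lambda>x. 1)" by (induction n) auto
  then have "total (\<lambda>x. p n x * 1) = total (\<lambda>x. 1 * point_mass \<one> x)"
    unfolding p_def using pow_adjoint[OF finsupp_point_mass, of n \<one> "\<lambda>x. 1"] by simp
  then show ?thesis using total_point_mass[of \<one> "\<lambda>x. 1"] by simp
qed

lemma len_step: "x \<in> carrier G \<Longrightarrow> s \<in> S \<Longrightarrow> len (x \<otimes> st s) \<le> len x + 1"
  using len_mult[of x "st s"] len_E[OF st_E, of s] by simp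

lemma len_step': "x \<in> carrier G \<Longrightarrow> s \<in> S \<Longrightarrow> len x \<le> len (x \<otimes> st s) + 1"
  using len_step[of "x \<otimes> st s" "iv s"] by (simp add: iv_S st_iv m_assoc)

lemma p_eq_0: "x \<in> carrier G \<Longrightarrow> len x > n \<Longrightarrow> p n x = 0"
proof (induction n arbitrary: x)
  case 0
  then have "x \<noteq> \<one>" by auto
  then show ?case by (simp add: p_def point_mass_def)
next
  case (Suc n)
  have "p n (x \<otimes> st s) = 0" if "s \<in> S" for s
    using Suc.prems len_step'[OF Suc.prems(1) that] that by (intro Suc.IH) auto
  then show ?case by (simp add: p_Suc stepop_def)
qed

lemma gball_carrier: "gball t \<subseteq> carrier G"
  by (auto simp: gball_def)

lemma not_gball: "x \<in> carrier G \<Longrightarrow> x \<notin> gball (real n) \<Longrightarrow> len x > n"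
  by (auto simp: gball_def)

lemma total_ball:
  assumes "\<And>x. x \<in> carrier G \<Longrightarrow> len x > n \<Longrightarrow> f x = 0"
  shows "total f = sum f (gball (real n))"
  by (rule total_eq_sum[OF finite_gball gball_carrier]) (use assms not_gball in blast)

lemma sum_p_le_1: "A \<subseteq> carrier G \<Longrightarrow> finite A \<Longrightarrow> sum (p n) A \<le> 1"
proof -
  assume A: "A \<subseteq> carrier G" "finite A"
  have "sum (p n) A \<le> sum (p n) (A \<union> gball (real n))" using A by (intro sum_mono2) auto
  also have "\<dots> = total (p n)"
    using A gball_carrier by (intro total_eq_sum[symmetric]) (auto intro!: p_eq_0 not_gball)
  finally show ?thesis by (simp add: total_p)
qed

section \<open>Return probabilities as squared norms, and a Nash-type inequality\<close>

lemma u_total: "u n = total (\<lambda>x. p n x ^ 2)"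
proof -
  have "u n = total (\<lambda>x. p n x * p n (inv \<one> \<otimes> x))" using p_inner[of \<one> n n] by (simp add: u_def mult_2)
  also have "\<dots> = total (\<lambda>x. p n x ^ 2)" by (rule total_cong) (simp add: power2_eq_square)
  finally show ?thesis .
qed

lemma u_nonneg [simp]: "u n \<ge> 0" by (simp add: u_def)

text \<open>Half the squared l2-distance between \<open>p n\<close> and its left translate by
  y.\<close>

definition defect :: "nat \<Rightarrow> 'a \<Rightarrow> real" where "defect n y = u n - p (2 * n) y"

lemma defect_eq:
  assumes "y \<in> carrier G"
  shows "2 * defect n y = total (\<lambda>x. (p n x - p n (inv y \<otimes> x))^2)"
proof -
  have f: "finsupp (\<lambda>x. p n (inv y \<otimes> x))" using assms by (intro finsupp_shiftl) auto
  have "total (\<lambda>x. (p n x - p n (inv y \<otimes> x))^2) =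
      total (\<lambda>x. p n x ^ 2 + p n (inv y \<otimes> x) ^ 2 - 2 * (p n x * p n (inv y \<otimes> x)))"
    by (rule total_cong) (simp add: power2_diff)
  also have "\<dots> = total (\<lambda>x. p n x ^ 2 + p n (inv y \<otimes> x) ^ 2) - total (\<lambda>x. 2 * (p n x * p n (inv y \<otimes> x)))"
    using f by (intro total_diff finsupp_add finsupp_power finsupp_mult2) auto
  also have "total (\<lambda>x. p n x ^ 2 + p n (inv y \<otimes> x) ^ 2) = total (\<lambda>x. p n x ^ 2) + total (\<lambda>x. p n (inv y \<otimes> x) ^ 2)"
    using f by (intro total_add finsupp_power) auto
  also have "total (\<lambda>x. 2 * (p n x * p n (inv y \<otimes> x))) = 2 * total (\<lambda>x. p n x * p n (inv y \<otimes> x))"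
    by (rule total_cmult)
  also have "total (\<lambda>x. p n (inv y \<otimes> x) ^ 2) = total (\<lambda>x. p n x ^ 2)"
    using total_shiftl[of "inv y" "\<lambda>x. p n x ^ 2"] assms by simp
  also have "total (\<lambda>x. p n x * p n (inv y \<otimes> x)) = p (2 * n) y" using p_inner[OF assms, of n n] by (simp add: mult_2)
  finally show ?thesis by (simp add: defect_def u_total)
qed

lemma defect_nonneg: "y \<in> carrier G \<Longrightarrow> defect n y \<ge> 0"
proof -
  assume y: "y \<in> carrier G"
  have "0 \<le> 2 * defect n y" unfolding defect_eq[OF y] by (rule total_nonneg) simp
  then show ?thesis by simp
qed

lemma p_even_le: "y \<in> carrier G \<Longrightarrow> p (2 * n) y \<le> u n"
  using defect_nonneg[of y n] by (simp add: defect_def)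

text \<open>The triangle inequality for the square root of the defect, written without roots by
  means of (a + b)^2 \<le> (1 + 1/r) a^2 + (1 + r) b^2 with r free.\<close>

lemma defect_mult:
  assumes y: "y \<in> carrier G" and z: "z \<in> carrier G" and r: "r > 0"
  shows "defect n (y \<otimes> z) \<le> (1 + 1 / r) * defect n y + (1 + r) * defect n z"
proof -
  have f: "finsupp (\<lambda>x. p n (a \<otimes> x))" if "a \<in> carrier G" for a using that by (intro finsupp_shiftl) auto
  let ?a = "\<lambda>x. (p n x - p n (inv y \<otimes> x))^2"
  let ?b = "\<lambda>x. (p n (inv y \<otimes> x) - p n (inv z \<otimes> (inv y \<otimes> x)))^2"
  have fa: "finsupp ?a" using f[of "inv y"] y by (intro finsupp_power finsupp_diff) auto
  have fb: "finsupp ?b" using f[of "inv y"] f[of "inv z \<otimes> inv y"] y z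
    by (intro finsupp_power finsupp_diff) (auto intro: finsupp_subset simp: m_assoc)
  have "2 * defect n (y \<otimes> z) = total (\<lambda>x. (p n x - p n (inv (y \<otimes> z) \<otimes> x))^2)" using y z by (intro defect_eq) auto
  also have "\<dots> \<le> total (\<lambda>x. (1 + 1 / r) * ?a x + (1 + r) * ?b x)"
  proof (rule total_mono)
    show "finsupp (\<lambda>x. (p n x - p n (inv (y \<otimes> z) \<otimes> x))\<^sup>2)" using f[of "inv (y \<otimes> z)"] y z by (intro finsupp_power finsupp_diff) auto
    show "finsupp (\<lambda>x. (1 + 1 / r) * ?a x + (1 + r) * ?b x)" by (intro finsupp_add finsupp_mult2 fa fb)
    fix x assume x: "x \<in> carrier G"
    have *: "(a + b)^2 \<le> (1 + 1 / r) * a^2 + (1 + r) * b^2" for a b :: real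
    proof -
      have "0 \<le> (a - r * b)^2 / r" using r by simp
      also have "\<dots> = a^2 / r + r * b^2 - 2 * a * b" using r by (simp add: power2_eq_square field_simps)
      finally show ?thesis by (simp add: power2_sum algebra_simps)
    qed
    show "(p n x - p n (inv (y \<otimes> z) \<otimes> x))\<^sup>2 \<le> (1 + 1 / r) * ?a x + (1 + r) * ?b x"
      using *[of "p n x - p n (inv y \<otimes> x)" "p n (inv y \<otimes> x) - p n (inv z \<otimes> (inv y \<otimes> x))"] x y z
      by (simp add: inv_mult_group m_assoc)
  qed
  also have "\<dots> = (1 + 1 / r) * total ?a + (1 + r) * total ?b"
    using fa fb by (subst total_add) (auto intro!: finsupp_mult2 simp: total_cmult)
  also have "total ?b = 2 * defect n z"
    using total_shiftl[of "inv y" "\<lambda>x. (p n x - p n (inv z \<otimes> x))^2"] defect_eq[OF z, of n] y by simp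
  also have "total ?a = 2 * defect n y" using defect_eq[OF y, of n] by simp
  finally show ?thesis by simp
qed

lemma u_step: "u n - u (Suc n) = (\<Sum>s\<in>S. \<Sum>t\<in>S. defect n (st s \<otimes> st t)) / q^2"
proof -
  have q: "q > 0" using q_ge_1 by simp
  have "u (Suc n) = (\<Sum>s\<in>S. \<Sum>t\<in>S. p (2 * n) (st s \<otimes> st t)) / q^2"
    by (simp add: u_def p_Suc stepop_def sum_divide_distrib power2_eq_square)
  moreover have "u n = (\<Sum>s\<in>S. \<Sum>t\<in>S. u n) / q^2" using q by (simp add: power2_eq_square flip: q_def)
  ultimately show ?thesis unfolding defect_def by (simp add: sum_subtractf diff_divide_distrib)
qed

text \<open>\<open>u_step\<close> averages the defect over products of two steps. Letting the second
  be the lazy one reaches a single generator; the factor q^2 comes from dropping the other terms,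
  all nonnegative.\<close>

lemma defect_step: "s \<in> S \<Longrightarrow> defect n (st s) \<le> q^2 * (u n - u (Suc n))"
proof -
  assume s: "s \<in> S"
  have "defect n (st s \<otimes> st idl) \<le> (\<Sum>t\<in>S. defect n (st s \<otimes> st t))"
    using s S_fin idl by (intro member_le_sum) (auto intro!: defect_nonneg)
  also have "\<dots> \<le> (\<Sum>s\<in>S. \<Sum>t\<in>S. defect n (st s \<otimes> st t))"
    using s S_fin by (intro member_le_sum) (auto intro!: defect_nonneg sum_nonneg)
  also have "\<dots> = q^2 * (u n - u (Suc n))" using q_ge_1 by (simp add: u_step)
  finally show ?thesis using s idl by simp
qed

lemma u_Suc_le: "u (Suc n) \<le> u n"
proof -
  have "0 \<le> q^2 * (u n - u (Suc n))"
    using defect_step[OF idl(1), of n] defect_nonneg[of "st idl" n] idl by simp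
  then show ?thesis using q_ge_1 by (auto simp: zero_le_mult_iff)
qed

lemma u_antimono: "m \<le> n \<Longrightarrow> u n \<le> u m"
  by (rule lift_Suc_antimono_le[of u, OF u_Suc_le])

lemma defect_len: "y \<in> carrier G \<Longrightarrow> defect n y \<le> real (len y)^2 * (q^2 * (u n - u (Suc n)))"
proof -
  assume y: "y \<in> carrier G"
  define d where "d = q^2 * (u n - u (Suc n))"
  have d: "d \<ge> 0" using u_Suc_le[of n] by (simp add: d_def)
  have *: "set xs \<subseteq> E \<Longrightarrow> defect n (lprod G xs) \<le> real (length xs)^2 * d" for xs
  proof (induction xs)
    case Nil
    then show ?case by (simp add: defect_def u_def)
  next
    case (Cons a xs)
    have a: "a \<in> carrier G" using Cons E_carrier by auto
    have xs: "lprod G xs \<in> carrier G" using Cons E_carrier by (intro lprod_closed) auto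
    from Cons obtain s where "s \<in> S" "a = st s" using st_S by auto
    then have ca: "defect n a \<le> d" using defect_step by (simp add: d_def)
    show ?case
    proof (cases "xs = []")
      case True
      then show ?thesis using ca a by simp
    next
      case False
      \<comment> \<open>With l the length of xs this gives (1 + l) + (1 + 1/l) l^2 = (1 + l)^2, so
        the growth stays exactly quadratic.\<close>
      define r where "r = 1 / real (length xs)"
      have r: "r > 0" using False by (simp add: r_def)
      have "defect n (a \<otimes> lprod G xs) \<le> (1 + 1 / r) * defect n a + (1 + r) * defect n (lprod G xs)"
        by (rule defect_mult[OF a xs r])
      also have "\<dots> \<le> (1 + 1 / r) * d + (1 + r) * (real (length xs)^2 * d)"
        using r ca Cons by (intro add_mono mult_left_mono) auto
      also have "\<dots> = real (length (a # xs))^2 * d"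
        using False by (simp add: r_def field_simps power2_eq_square)
      finally show ?thesis by simp
    qed
  qed
  obtain xs where "set xs \<subseteq> E" "length xs = len y" "lprod G xs = y" by (rule len_attained[OF y])
  then show ?thesis using *[of xs] unfolding d_def by simp
qed

text \<open>Average u n = defect n y + p (2 n) y over the ball of radius t: the probabilities sum to
  at most 1, and the defects are controlled by the decrease of u in one step.\<close>

lemma nash:
  assumes "t \<ge> 0"
  shows "u n \<le> 1 / vol t + q^2 * t^2 * (u n - u (Suc n))"
proof -
  define d where "d = q^2 * (u n - u (Suc n))"
  have d: "d \<ge> 0" using u_Suc_le[of n] by (simp add: d_def)
  have v: "vol t > 0" using vol_ge_1[OF assms] by simp
  have "vol t * u n = (\<Sum>y\<in>gball t. defect n y + p (2 * n) y)" by (simp add: defect_def vol_def)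
  also have "\<dots> = (\<Sum>y\<in>gball t. defect n y) + (\<Sum>y\<in>gball t. p (2 * n) y)" by (rule sum.distrib)
  also have "(\<Sum>y\<in>gball t. p (2 * n) y) \<le> 1" by (rule sum_p_le_1[OF gball_carrier finite_gball])
  also have "(\<Sum>y\<in>gball t. defect n y) \<le> (\<Sum>y\<in>gball t. t^2 * d)"
  proof (rule sum_mono)
    fix y assume y: "y \<in> gball t"
    have "defect n y \<le> real (len y)^2 * d" using defect_len[of y n] y by (simp add: gball_def d_def)
    also have "\<dots> \<le> t^2 * d" using y d by (intro mult_right_mono power_mono) (auto simp: gball_def)
    finally show "defect n y \<le> t^2 * d" .
  qed
  also have "\<dots> = vol t * (t^2 * d)" by (simp add: vol_def)
  finally have "vol t * u n \<le> vol t * (t\<^sup>2 * d) + 1" by simp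
  then have "u n \<le> (vol t * (t\<^sup>2 * d) + 1) / vol t" using v by (simp add: pos_le_divide_eq mult.commute)
  also have "\<dots> = 1 / vol t + t^2 * d" using v by (simp add: field_simps)
  finally show ?thesis by (simp add: d_def mult_ac)
qed

lemma vol_doubling_pow: "t \<ge> 0 \<Longrightarrow> vol (2 ^ j * t) \<le> D ^ j * vol t"
proof (induction j)
  case (Suc j)
  have "vol (2 ^ Suc j * t) \<le> D * vol (2 ^ j * t)" using doubling[of "2 ^ j * t"] Suc.prems by (simp add: mult_ac)
  also have "\<dots> \<le> D * (D ^ j * vol t)" using D_ge_1 Suc by (intro mult_left_mono) auto
  finally show ?case by simp
qed simp

text \<open>Summing \<open>nash\<close> over N \<le> i < 2 N makes the decreases telescope, so that
  on average a decrease is at most u N / N.\<close>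

lemma u_averaged:
  assumes "N \<ge> 1" "t \<ge> 0"
  shows "u (2 * N) \<le> 1 / vol t + q^2 * t^2 / real N * u N"
proof -
  have "real N * u (2 * N) = (\<Sum>i\<in>{N..<2 * N}. u (2 * N))" by simp
  also have "\<dots> \<le> (\<Sum>i\<in>{N..<2 * N}. 1 / vol t + q^2 * t^2 * (u i - u (Suc i)))"
    using u_antimono nash[OF assms(2)] by (intro sum_mono) (meson atLeastLessThan_iff less_imp_le order_trans)
  also have "\<dots> = real N / vol t + q^2 * t^2 * (\<Sum>i\<in>{N..<2 * N}. u i - u (Suc i))"
    by (simp add: sum.distrib sum_distrib_left)
  also have "(\<Sum>i\<in>{N..<2 * N}. u i - u (Suc i)) = u N - u (2 * N)"
    using sum_Suc_diff'[of N "2 * N" "\<lambda>i. - u i"] by simp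
  also have "real N / vol t + q^2 * t^2 * (u N - u (2 * N)) \<le> real N / vol t + q^2 * t^2 * u N"
    by (intro add_left_mono mult_left_mono) auto
  finally have "u (2 * N) \<le> (real N / vol t + q^2 * t^2 * u N) / real N"
    using assms by (simp add: pos_le_divide_eq mult.commute)
  also have "\<dots> = 1 / vol t + q^2 * t^2 / real N * u N" using assms by (simp add: add_divide_distrib)
  finally show ?thesis .
qed

lemma u_upper: "\<exists>C>0. \<forall>n\<ge>1. u n * vol (sqrt n) \<le> C"
proof -
  \<comment> \<open>With t = sqrt N / 2^j the inductive term has coefficient D q^2 / 4^j, hence at
    most 1/2; comparing the volumes at sqrt n and t costs D^(j+1), which explains C.\<close>
  obtain j where j: "D * q^2 * 2 < 4 ^ j" using real_arch_pow[of 4 "D * q^2 * 2"] by auto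
  define C where "C = max (2 * D ^ (j + 1)) (vol 1)"
  have C0: "C > 0" using vol_ge_1[of 1] by (simp add: C_def)
  have "n \<ge> 1 \<Longrightarrow> u n * vol (sqrt n) \<le> C" for n
  proof (induction n rule: less_induct)
    case (less n)
    show ?case
    proof (cases "n = 1")
      case True
      have "u 1 \<le> u 0" by (rule u_antimono) simp
      also have "u 0 = 1" by (simp add: u_def p_def point_mass_def)
      finally have "u n * vol (sqrt n) \<le> 1 * vol 1" using True vol_ge_1[of 1] by (intro mult_mono) auto
      then show ?thesis by (simp add: C_def)
    next
      case False
      define N where "N = n div 2"
      have N: "N \<ge> 1" "N < n" "2 * N \<le> n" "n \<le> 4 * N" using False less.prems by (auto simp: N_def)
      define t where "t = sqrt N / 2 ^ j"
      have t: "t \<ge> 0" by (simp add: t_def)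
      have vt: "vol t \<ge> 1" by (rule vol_ge_1[OF t])
      have "vol (sqrt N) \<le> D ^ j * vol t" using vol_doubling_pow[OF t, of j] by (simp add: t_def)
      moreover have "vol (sqrt n) \<le> D * vol (sqrt N)"
      proof -
        have "sqrt n \<le> sqrt (4 * N)" using N by (intro real_sqrt_le_mono) simp
        also have "\<dots> = 2 * sqrt N" by (simp add: real_sqrt_mult)
        finally show ?thesis using vol_mono doubling[of "sqrt N"] by (meson order_trans real_sqrt_ge_0_iff of_nat_0_le_iff)
      qed
      moreover from calculation(1) have "D * vol (sqrt N) \<le> D * (D ^ j * vol t)"
        using D_ge_1 by (intro mult_left_mono) auto
      ultimately have v: "vol (sqrt n) \<le> D ^ (j + 1) * vol t" by (simp add: mult.assoc)
      have vn: "vol (sqrt n) \<ge> 1" by (rule vol_ge_1) simp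
      have e: "q^2 * t^2 / real N = q^2 / 4 ^ j"
      proof -
        have "((2::real) ^ j)^2 = 4 ^ j" by (simp add: power2_eq_square flip: power_mult_distrib)
        then show ?thesis using N by (simp add: t_def power_divide)
      qed
      have "u n * vol (sqrt n) \<le> u (2 * N) * vol (sqrt n)"
        using u_antimono[OF N(3)] vn by (intro mult_right_mono) auto
      also have "\<dots> \<le> (1 / vol t + q^2 / 4 ^ j * u N) * vol (sqrt n)"
        using u_averaged[OF N(1) t] e vn by (intro mult_right_mono) auto
      also have "\<dots> = vol (sqrt n) / vol t + q^2 / 4 ^ j * (u N * vol (sqrt n))" by (simp add: algebra_simps)
      also have "\<dots> \<le> D ^ (j + 1) + q^2 / 4 ^ j * (u N * (D * vol (sqrt N)))"
        using v vt \<open>vol (sqrt n) \<le> D * vol (sqrt N)\<close>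
        by (intro add_mono mult_left_mono) (auto simp: divide_le_eq)
      also have "q^2 / 4 ^ j * (u N * (D * vol (sqrt N))) = (D * q^2 / 4 ^ j) * (u N * vol (sqrt N))" by simp
      also have "\<dots> \<le> (1 / 2) * C"
      proof (intro mult_mono)
        show "D * q^2 / 4 ^ j \<le> 1 / 2" using j by (simp add: divide_le_eq)
        show "u N * vol (sqrt N) \<le> C" by (rule less.IH[OF N(2) N(1)])
      qed (use vol_ge_1[of "sqrt N"] in auto)
      finally have "u n * vol (sqrt n) \<le> D ^ (j + 1) + C / 2" by simp
      also have "\<dots> \<le> C" by (simp add: C_def)
      finally show ?thesis .
    qed
  qed
  then show ?thesis using C0 by blast
qed

section \<open>Contraction of weighted l2-norms under one step\<close>

lemma am_gm_step: "r > 0 \<Longrightarrow> a * b - b^2 / r \<le> r * a^2 / (4::real)"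
proof -
  assume r: "r > 0"
  have "0 \<le> (r * a / 2 - b)^2 / r" using r by simp
  also have "\<dots> = r * a^2 / 4 - a * b + b^2 / r" using r by (simp add: power2_eq_square field_simps)
  finally show ?thesis by simp
qed

text \<open>Laziness makes \<open>(stepop f x - f x)\<^sup>2\<close> smaller than the mean of the squared increments by a
  factor \<open>1 - 1 / q\<close>; the remaining \<open>1 / q\<close> of the Dirichlet form absorbs the variation of w.\<close>

lemma weighted_contraction:
  assumes f: "finsupp f"
    and w: "\<And>x. x \<in> carrier G \<Longrightarrow> w x \<ge> 0"
    and k: "\<And>x s. x \<in> carrier G \<Longrightarrow> s \<in> S \<Longrightarrow> \<bar>w (x \<otimes> st s) - w x\<bar> \<le> k * sqrt (w x * w (x \<otimes> st s))"
  shows "total (\<lambda>x. w x * stepop f x ^ 2) \<le> (1 + q * k^2 / 4) * total (\<lambda>x. w x * f x ^ 2)"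
proof -
  have q: "q \<ge> 1" by (rule q_ge_1)
  define d where "d = (\<lambda>s x. f (x \<otimes> st s) - f x)"
  have fd: "finsupp (d s)" if "s \<in> S" for s unfolding d_def using that f by (intro finsupp_diff finsupp_shiftr) auto
  define A where "A = (\<lambda>s x. w x * f x * d s x)"
  define B where "B = (\<lambda>s x. (1 - 1 / q) * (w x * d s x ^ 2))"
  \<comment> \<open>The cross term of \<open>iv s\<close> translated by \<open>st s\<close>.
    Replacing one of the two copies of A by it leaves only a difference of weights: A + A' + B = -
    (w (x s) - w x) f (x s) d - w x d^2 / q.\<close>
  define A' where "A' = (\<lambda>s x. - (w (x \<otimes> st s) * f (x \<otimes> st s) * d s x))"
  have fA: "finsupp (A s)" "finsupp (B s)" "finsupp (A' s)" if "s \<in> S" for s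
    unfolding A_def B_def A'_def using fd[OF that] f by (auto intro!: finsupp_mult2 finsupp_power elim!: finsupp_subset)
  have "finsupp (\<lambda>x. \<Sum>s\<in>S. 2 * A s x + B s x)" using fA S_fin by (intro finsupp_sum finsupp_add finsupp_mult2) auto
  then have fsum: "finsupp (\<lambda>x. (\<Sum>s\<in>S. 2 * A s x + B s x) / q)" by (rule finsupp_subset) simp
  have pt: "w x * stepop f x ^ 2 \<le> w x * f x ^ 2 + (\<Sum>s\<in>S. 2 * A s x + B s x) / q" if x: "x \<in> carrier G" for x
  proof -
    have "stepop f x - f x = (\<Sum>s\<in>S. d s x) / q"
      using q by (simp add: stepop_def d_def sum_subtractf field_simps flip: q_def)
    \<comment> \<open>The increment of the lazy label vanishes, so Cauchy-Schwarz runs over q - 1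
      terms only.\<close>
    also have "(\<Sum>s\<in>S. d s x) = (\<Sum>s\<in>S - {idl}. d s x)"
      using x S_fin by (intro sum.mono_neutral_right) (auto simp: d_def idl)
    finally have e: "stepop f x = f x + (\<Sum>s\<in>S - {idl}. d s x) / q" by simp
    have e2: "(\<Sum>s\<in>S - {idl}. d s x) = (\<Sum>s\<in>S. d s x)"
      using x S_fin by (intro sum.mono_neutral_left) (auto simp: d_def idl)
    have "(\<Sum>s\<in>S - {idl}. d s x)^2 \<le> (\<Sum>s\<in>S - {idl}. (d s x)^2) * real (card (S - {idl}))"
      by (rule sum_squared_le_sum_of_squares)
    also have "real (card (S - {idl})) = q - 1" using S_fin idl q by (simp add: q_def card_Diff_singleton of_nat_diff)
    also have "(\<Sum>s\<in>S - {idl}. (d s x)^2) \<le> (\<Sum>s\<in>S. (d s x)^2)" using S_fin by (intro sum_mono2) auto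
    finally have c: "(\<Sum>s\<in>S - {idl}. d s x)^2 \<le> (\<Sum>s\<in>S. (d s x)^2) * (q - 1)" using q by (simp add: mult_right_mono)
    have "w x * stepop f x ^ 2 = w x * f x ^ 2 + 2 * (w x * f x * (\<Sum>s\<in>S. d s x)) / q + w x * (\<Sum>s\<in>S - {idl}. d s x)^2 / q^2"
      unfolding e using q e2 by (simp add: power2_sum power_divide field_simps power2_eq_square power4_eq_xxxx)
    also have "w x * (\<Sum>s\<in>S - {idl}. d s x)^2 / q^2 \<le> w x * ((\<Sum>s\<in>S. (d s x)^2) * (q - 1)) / q^2"
      using c w[OF x] q by (intro divide_right_mono mult_left_mono) auto
    also have "\<dots> = (\<Sum>s\<in>S. B s x) / q"
    proof -
      have eq: "(\<Sum>s\<in>S. B s x) = (1 - 1 / q) * (w x * (\<Sum>s\<in>S. (d s x)^2))"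
        by (simp add: B_def sum_distrib_left)
      show ?thesis unfolding eq using q by (simp add: field_simps power2_eq_square)
    qed
    also have "2 * (w x * f x * (\<Sum>s\<in>S. d s x)) / q = (\<Sum>s\<in>S. 2 * A s x) / q"
      by (simp add: A_def sum_distrib_left mult_ac)
    finally show ?thesis by (simp add: sum.distrib add_divide_distrib)
  qed
  have "total (\<lambda>x. w x * stepop f x ^ 2) \<le> total (\<lambda>x. w x * f x ^ 2 + (\<Sum>s\<in>S. 2 * A s x + B s x) / q)"
    using f fsum pt by (intro total_mono finsupp_mult2 finsupp_power finsupp_add finsupp_stepop) auto
  also have "\<dots> = total (\<lambda>x. w x * f x ^ 2) + (\<Sum>s\<in>S. 2 * total (A s) + total (B s)) / q"
  proof -
    have "total (\<lambda>x. w x * f x ^ 2 + (\<Sum>s\<in>S. 2 * A s x + B s x) / q) =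
        total (\<lambda>x. w x * f x ^ 2) + total (\<lambda>x. (\<Sum>s\<in>S. 2 * A s x + B s x) / q)"
      using f fsum by (intro total_add finsupp_mult2 finsupp_power) auto
    also have "total (\<lambda>x. (\<Sum>s\<in>S. 2 * A s x + B s x) / q) = (\<Sum>s\<in>S. total (\<lambda>x. 2 * A s x + B s x)) / q"
      unfolding total_divide using fA S_fin by (subst total_sum) (auto intro!: finsupp_add finsupp_mult2)
    also have "(\<Sum>s\<in>S. total (\<lambda>x. 2 * A s x + B s x)) = (\<Sum>s\<in>S. 2 * total (A s) + total (B s))"
    proof (rule sum.cong[OF refl])
      fix s assume "s \<in> S"
      then show "total (\<lambda>x. 2 * A s x + B s x) = 2 * total (A s) + total (B s)"
        using total_add[OF finsupp_mult2[of "A s" "\<lambda>x. 2"], of "B s"] fA by (simp add: total_cmult)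
    qed
    finally show ?thesis .
  qed
  also have "(\<Sum>s\<in>S. 2 * total (A s) + total (B s)) = (\<Sum>s\<in>S. total (A s) + total (A' s) + total (B s))"
  proof -
    have "(\<Sum>s\<in>S. total (A s)) = (\<Sum>s\<in>S. total (A (iv s)))"
      by (rule sum.reindex_bij_betw[OF bij_iv, symmetric])
    also have "\<dots> = (\<Sum>s\<in>S. total (A' s))"
    proof (rule sum.cong[OF refl])
      fix s assume s: "s \<in> S"
      have "total (A (iv s)) = total (\<lambda>x. A (iv s) (x \<otimes> st s))" using s by (intro total_shiftr[symmetric]) auto
      also have "\<dots> = total (A' s)"
        by (rule total_cong) (use s in \<open>simp add: A_def A'_def d_def st_iv m_assoc algebra_simps\<close>)
      finally show "total (A (iv s)) = total (A' s)" .
    qed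
    finally show ?thesis by (simp add: sum.distrib flip: sum_distrib_left)
  qed
  also have "(\<Sum>s\<in>S. total (A s) + total (A' s) + total (B s)) \<le> (\<Sum>s\<in>S. q * k^2 / 4 * total (\<lambda>x. w x * f x ^ 2))"
  proof (rule sum_mono)
    fix s assume s: "s \<in> S"
    have "total (A s) + total (A' s) + total (B s) = total (\<lambda>x. A s x + A' s x + B s x)"
      using fA[OF s] by (simp add: total_add finsupp_add)
    also have "\<dots> \<le> total (\<lambda>x. q * k^2 / 4 * (w (x \<otimes> st s) * f (x \<otimes> st s) ^ 2))"
    proof (rule total_mono)
      show "finsupp (\<lambda>x. A s x + A' s x + B s x)" using fA[OF s] by (intro finsupp_add) auto
      show "finsupp (\<lambda>x. q * k^2 / 4 * (w (x \<otimes> st s) * f (x \<otimes> st s) ^ 2))"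
        using finsupp_shiftr[OF f, of "st s"] s by (intro finsupp_mult2 finsupp_power) auto
      fix x assume x: "x \<in> carrier G"
      define a b g where "a = w x" and "b = w (x \<otimes> st s)" and "g = f (x \<otimes> st s)"
      have ab: "a \<ge> 0" "b \<ge> 0" using w x s by (auto simp: a_def b_def)
      have kk: "\<bar>b - a\<bar> \<le> k * sqrt (a * b)" using k[OF x s] by (simp add: a_def b_def)
      have fx: "f x = g - d s x" by (simp add: g_def d_def)
      have "A s x + A' s x + B s x = a * f x * d s x - b * g * d s x + (a * d s x ^ 2 - a * d s x ^ 2 / q)"
        by (simp add: A_def A'_def B_def a_def b_def g_def left_diff_distrib)
      also have "\<dots> = - (b - a) * (g * d s x) - a * d s x ^ 2 / q"
        unfolding fx by (simp add: algebra_simps power2_eq_square)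
      also have "\<dots> \<le> \<bar>b - a\<bar> * (\<bar>g\<bar> * \<bar>d s x\<bar>) - a * d s x ^ 2 / q"
        using abs_ge_self[of "- (b - a) * (g * d s x)"] by (simp add: abs_mult abs_minus_commute[of a b])
      also have "\<bar>b - a\<bar> * (\<bar>g\<bar> * \<bar>d s x\<bar>) \<le> k * sqrt (a * b) * (\<bar>g\<bar> * \<bar>d s x\<bar>)"
        using kk by (intro mult_right_mono) auto
      also have "k * sqrt (a * b) * (\<bar>g\<bar> * \<bar>d s x\<bar>) - a * d s x ^ 2 / q =
          (k * (sqrt b * \<bar>g\<bar>)) * (sqrt a * \<bar>d s x\<bar>) - (sqrt a * \<bar>d s x\<bar>)^2 / q"
        using ab by (simp add: real_sqrt_mult power_mult_distrib)
      also have "\<dots> \<le> q * (k * (sqrt b * \<bar>g\<bar>))^2 / 4" using q by (intro am_gm_step) simp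
      also have "\<dots> = q * k^2 / 4 * (b * g^2)" using ab by (simp add: power_mult_distrib)
      finally show "A s x + A' s x + B s x \<le> q * k^2 / 4 * (w (x \<otimes> st s) * f (x \<otimes> st s) ^ 2)"
        by (simp add: b_def g_def)
    qed
    also have "\<dots> = q * k^2 / 4 * total (\<lambda>x. w x * f x ^ 2)"
      unfolding total_cmult using total_shiftr[of "st s" "\<lambda>x. w x * f x ^ 2"] s by simp
    finally show "total (A s) + total (A' s) + total (B s) \<le> q * k^2 / 4 * total (\<lambda>x. w x * f x ^ 2)" .
  qed
  also have "\<dots> = q * (q * k^2 / 4 * total (\<lambda>x. w x * f x ^ 2))" by (simp add: q_def)
  finally show ?thesis using q by (simp add: divide_right_mono algebra_simps)
qed

end

section \<open>Moments of the walk\<close>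

text \<open>With m the midpoint and h half the difference, factor out exp m, which is the square
  root on the right. From t \<le> 1 comes h \<le> 1/2, where exp h \<le> 1 + 2 h. This is the
  hypothesis of \<open>weighted_contraction\<close> for exponential weights.\<close>

lemma exp_diff_bound:
  fixes a b t :: real
  assumes "\<bar>a - b\<bar> \<le> t" "t \<le> 1"
  shows "\<bar>exp b - exp a\<bar> \<le> 2 * t * sqrt (exp a * exp b)"
proof -
  have *: "exp b - exp a \<le> 2 * t * sqrt (exp a * exp b)" if ab: "\<bar>a - b\<bar> \<le> t" for a b :: real
  proof -
    define h where "h = (b - a) / 2"
    define m where "m = (a + b) / 2"
    have t: "t \<ge> 0" using ab by simp
    have m: "sqrt (exp a * exp b) = exp m"
    proof -
      have "exp a * exp b = exp m ^ 2" by (simp add: m_def flip: exp_add exp_double)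
      then show ?thesis by simp
    qed
    have "exp b - exp a = exp m * (exp h - exp (- h))" by (simp add: m_def h_def algebra_simps field_simps flip: exp_add)
    also have "exp h - exp (- h) \<le> 2 * t"
    proof (cases "h \<ge> 0")
      case True
      have h: "h \<le> t / 2" using ab by (simp add: h_def)
      then have "h \<le> 1 / 2" using assms by simp
      then have "exp h \<le> 1 + 2 * h" using exp_bound_lemma[of h] True by simp
      moreover have "exp (- h) \<ge> 1 - h" using exp_ge_add_one_self[of "- h"] by simp
      ultimately show ?thesis using h True by linarith
    next
      case False
      then have "exp h \<le> exp (- h)" by simp
      then show ?thesis using t by linarith
    qed
    finally show ?thesis by (simp add: m mult.commute mult_left_mono)
  qed
  show ?thesis using *[OF assms(1)] *[of b a] assms(1) by (simp add: abs_minus_commute mult.commute abs_le_iff)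
qed

lemma power_le_fact_exp: "x \<ge> 0 \<Longrightarrow> x ^ n \<le> fact n * exp (x::real)"
proof -
  assume x: "x \<ge> 0"
  have "x ^ n / fact n = (\<Sum>i\<in>{n}. x ^ i / fact i)" by simp
  also have "\<dots> \<le> (\<Sum>i. x ^ i / fact i)"
    using x summable_exp_generic[of x] by (intro sum_le_suminf) (auto simp: scaleR_conv_of_real divide_inverse mult.commute)
  also have "\<dots> = exp x" by (simp add: exp_def scaleR_conv_of_real divide_inverse mult.commute)
  finally show ?thesis by (simp add: divide_le_eq mult.commute)
qed

context lazy_walk
begin

definition wt :: "nat \<Rightarrow> 'a \<Rightarrow> real" where "wt N x = exp (real (len x) / sqrt N)"

lemma wt_pos [simp]: "wt N x > 0" "wt N x \<ge> 0" by (simp_all add: wt_def)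

text \<open>A step changes the logarithm of the weight by at most 1 / sqrt N, so it costs a factor 1
  + q / N, and at most N steps cost at most \<open>exp q\<close>.\<close>

lemma wt_evolve:
  assumes "N \<ge> 1" "n \<le> N"
  shows "total (\<lambda>x. wt N x * p (m + n) x ^ 2) \<le> exp q * total (\<lambda>x. wt N x * p m x ^ 2)"
proof -
  define k where "k = 2 * (1 / sqrt N)"
  have 1: "1 / sqrt N \<le> 1" using assms by simp
  have q: "q \<ge> 1" by (rule q_ge_1)
  have kk: "q * k^2 / 4 = q / N" using assms by (simp add: k_def power_divide power_mult_distrib)
  have step: "total (\<lambda>x. wt N x * stepop f x ^ 2) \<le> (1 + q / N) * total (\<lambda>x. wt N x * f x ^ 2)" if f: "finsupp f" for f
  proof -
    have "total (\<lambda>x. wt N x * stepop f x ^ 2) \<le> (1 + q * k^2 / 4) * total (\<lambda>x. wt N x * f x ^ 2)"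
    proof (rule weighted_contraction[OF f])
      fix x s assume x: "x \<in> carrier G" and s: "s \<in> S"
      have "\<bar>real (len x) / sqrt N - real (len (x \<otimes> st s)) / sqrt N\<bar> = \<bar>real (len x) - real (len (x \<otimes> st s))\<bar> / sqrt N"
        by (simp add: abs_divide flip: diff_divide_distrib)
      also have "\<dots> \<le> 1 / sqrt N" using len_step[OF x s] len_step'[OF x s] by (intro divide_right_mono) auto
      finally show "\<bar>wt N (x \<otimes> st s) - wt N x\<bar> \<le> k * sqrt (wt N x * wt N (x \<otimes> st s))"
        unfolding wt_def k_def using exp_diff_bound 1 by blast
    qed simp
    then show ?thesis by (simp only: kk)
  qed
  have it: "total (\<lambda>x. wt N x * p (m + n) x ^ 2) \<le> (1 + q / N) ^ n * total (\<lambda>x. wt N x * p m x ^ 2)" for n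
  proof (induction n)
    case (Suc n)
    have "total (\<lambda>x. wt N x * p (m + Suc n) x ^ 2) \<le> (1 + q / N) * total (\<lambda>x. wt N x * p (m + n) x ^ 2)"
      using step[of "p (m + n)"] by (simp add: p_Suc)
    also have "\<dots> \<le> (1 + q / N) * ((1 + q / N) ^ n * total (\<lambda>x. wt N x * p m x ^ 2))"
      using Suc q by (intro mult_left_mono) auto
    finally show ?case by (simp add: mult.assoc)
  qed simp
  have "(1 + q / N) ^ n \<le> exp (q / N) ^ n" using q by (intro power_mono exp_ge_add_one_self) auto
  also have "\<dots> = exp (real n * (q / N))" by (rule exp_of_nat_mult[symmetric])
  also have "\<dots> \<le> exp q" using assms q by (simp add: field_simps)
  finally have "(1 + q / N) ^ n \<le> exp q" .
  then have "(1 + q / N) ^ n * total (\<lambda>x. wt N x * p m x ^ 2) \<le> exp q * total (\<lambda>x. wt N x * p m x ^ 2)"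
    by (intro mult_right_mono total_nonneg) auto
  then show ?thesis using it[of n] by linarith
qed

lemma finsupp_wt: "finsupp (\<lambda>x. wt N x * p m x ^ 2)" by (intro finsupp_mult2 finsupp_power) auto

text \<open>Induction from N / 4 to N: the weight at scale N / 4 is at least the square of the weight at
  scale N, so \<open>y \<le> e y\<^sup>2 + 1 / e\<close> bounds the latter by a small multiple of the former plus a
  constant, and the constant is paid for by the bound on \<open>u\<close>.\<close>

lemma weighted_upper: "\<exists>C>0. \<forall>N\<ge>1. vol (sqrt N) * total (\<lambda>x. wt N x * p N x ^ 2) \<le> C"
proof -
  obtain Cu where Cu: "Cu > 0" "\<And>n. n \<ge> 1 \<Longrightarrow> u n * vol (sqrt n) \<le> Cu" using u_upper by blast
  define K where "K = exp q * D^2"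
  have K: "K > 0" using D_ge_1 by (simp add: K_def)
  \<comment> \<open>Makes K e = 1/2: the inductive bound returns with factor 1/2, so C only has to
    be twice the constant term.\<close>
  define e where "e = 1 / (2 * K)"
  have e: "e > 0" using K by (simp add: e_def)
  define C where "C = max (vol 2 * exp 3) (2 * (K / e * Cu))"
  have C0: "C > 0" using vol_ge_1[of 2] by (simp add: C_def less_max_iff_disj)
  have "N \<ge> 1 \<Longrightarrow> vol (sqrt N) * total (\<lambda>x. wt N x * p N x ^ 2) \<le> C" for N
  proof (induction N rule: less_induct)
    case (less N)
    show ?case
    proof (cases "N < 4")
      case True
      have "total (\<lambda>x. wt N x * p N x ^ 2) \<le> total (\<lambda>x. exp 3 * p N x ^ 2)"
      proof (rule total_mono[OF finsupp_wt])
        show "finsupp (\<lambda>x. exp 3 * p N x ^ 2)" by (intro finsupp_mult2 finsupp_power) auto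
        fix x assume x: "x \<in> carrier G"
        show "wt N x * p N x ^ 2 \<le> exp 3 * p N x ^ 2"
        proof (cases "len x > N")
          case True
          then show ?thesis using p_eq_0[OF x] by simp
        next
          case False
          have "real (len x) / sqrt N \<le> real (len x) / 1" using less.prems by (intro divide_left_mono) auto
          also have "\<dots> \<le> 3" using False True by simp
          finally show ?thesis by (intro mult_right_mono) (auto simp: wt_def)
        qed
      qed
      also have "\<dots> = exp 3 * u N" by (simp add: total_cmult u_total)
      also have "u N \<le> 1" using u_antimono[of 0 N] by (simp add: u_def p_def point_mass_def)
      finally have "total (\<lambda>x. wt N x * p N x ^ 2) \<le> exp 3" by simp
      moreover have "sqrt N \<le> sqrt 4" using True by (intro real_sqrt_le_mono) simp
      then have "vol (sqrt N) \<le> vol 2" by (intro vol_mono) simp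
      ultimately have "vol (sqrt N) * total (\<lambda>x. wt N x * p N x ^ 2) \<le> vol 2 * exp 3"
        using vol_ge_1[of 2] by (intro mult_mono total_nonneg) auto
      then show ?thesis by (simp add: C_def)
    next
      case False
      \<comment> \<open>4 m \<le> N makes the square of the weight at scale N at most the weight at
        scale m, and N \<le> 16 m keeps the volumes within two doublings.\<close>
      define m where "m = N div 4"
      have m: "m \<ge> 1" "m < N" "4 * m \<le> N" "N \<le> 16 * m" using False by (auto simp: m_def)
      have "2 * sqrt m = sqrt (4 * m)" by (simp add: real_sqrt_mult)
      also have "\<dots> \<le> sqrt N" using m by (intro real_sqrt_le_mono) simp
      finally have sm: "2 * sqrt m \<le> sqrt N" .
      have w: "wt N x \<le> e * wt m x + 1 / e" for x
      proof -
        have "2 * (real (len x) / sqrt N) = real (len x) / (sqrt N / 2)" by simp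
        also have "\<dots> \<le> real (len x) / sqrt m" using sm m by (intro divide_left_mono) auto
        finally have "wt N x ^ 2 \<le> wt m x" by (simp add: wt_def flip: exp_double)
        then have *: "e * wt N x ^ 2 \<le> e * wt m x" using e by (intro mult_left_mono) auto
        have "0 \<le> (e * wt N x - 1) ^ 2 / e" using e by simp
        also have "\<dots> = e * wt N x ^ 2 - 2 * wt N x + 1 / e" using e by (simp add: power2_eq_square field_simps)
        finally have "2 * wt N x \<le> e * wt N x ^ 2 + 1 / e" by simp
        then have "wt N x \<le> e * wt N x ^ 2 + 1 / e" using wt_pos(2)[of N x] by linarith
        then show ?thesis using * by linarith
      qed
      have "sqrt N \<le> sqrt (16 * m)" using m by (intro real_sqrt_le_mono) simp
      also have "\<dots> = 2 ^ 2 * sqrt m" by (simp add: real_sqrt_mult)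
      finally have "vol (sqrt N) \<le> vol (2 ^ 2 * sqrt m)" by (rule vol_mono)
      also have "\<dots> \<le> D ^ 2 * vol (sqrt m)" by (rule vol_doubling_pow) simp
      finally have v: "vol (sqrt N) \<le> D ^ 2 * vol (sqrt m)" .
      define T where "T = total (\<lambda>x. wt m x * p m x ^ 2)"
      have T: "T \<ge> 0" unfolding T_def by (intro total_nonneg) auto
      have "total (\<lambda>x. wt N x * p N x ^ 2) \<le> exp q * total (\<lambda>x. wt N x * p m x ^ 2)"
        using wt_evolve[of N "N - m" m] m by simp
      also have "total (\<lambda>x. wt N x * p m x ^ 2) \<le> total (\<lambda>x. e * (wt m x * p m x ^ 2) + 1 / e * p m x ^ 2)"
      proof (rule total_mono[OF finsupp_wt])
        show "finsupp (\<lambda>x. e * (wt m x * p m x ^ 2) + 1 / e * p m x ^ 2)" by (intro finsupp_add finsupp_mult2 finsupp_wt finsupp_power) auto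
        show "wt N x * p m x ^ 2 \<le> e * (wt m x * p m x ^ 2) + 1 / e * p m x ^ 2" for x
          using mult_right_mono[OF w[of x], of "p m x ^ 2"] by (simp add: algebra_simps)
      qed
      also have "\<dots> = e * T + 1 / e * u m"
        unfolding T_def by (subst total_add) (auto intro!: finsupp_mult2 finsupp_wt finsupp_power simp: total_cmult u_total simp del: times_divide_eq_left)
      finally have "total (\<lambda>x. wt N x * p N x ^ 2) \<le> exp q * (e * T + 1 / e * u m)" by simp
      then have "vol (sqrt N) * total (\<lambda>x. wt N x * p N x ^ 2) \<le> (D ^ 2 * vol (sqrt m)) * (exp q * (e * T + 1 / e * u m))"
        using v vol_ge_1[of "sqrt N"] vol_ge_1[of "sqrt m"] e T by (intro mult_mono total_nonneg mult_nonneg_nonneg add_nonneg_nonneg) auto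
      also have "\<dots> = K * e * (vol (sqrt m) * T) + K / e * (u m * vol (sqrt m))"
        by (simp add: K_def algebra_simps)
      also have "\<dots> \<le> K * e * C + K / e * Cu"
        using less.IH[OF m(2,1)] Cu(2)[OF m(1)] K e unfolding T_def by (intro add_mono mult_left_mono) auto
      also have "\<dots> \<le> C" using K by (simp add: e_def C_def)
      finally show ?thesis .
    qed
  qed
  then show ?thesis using C0 by blast
qed

lemma total_cauchy_schwarz:
  assumes "finsupp f" "finite A" "A \<subseteq> carrier G" "\<And>x. x \<in> carrier G \<Longrightarrow> x \<notin> A \<Longrightarrow> f x = 0" "\<And>x. x \<in> carrier G \<Longrightarrow> w x > 0"
  shows "total (\<lambda>x. g x * f x) \<le> sqrt (total (\<lambda>x. w x * f x ^ 2)) * sqrt (\<Sum>x\<in>A. g x ^ 2 / w x)"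
proof -
  have wA: "x \<in> A \<Longrightarrow> w x > 0" for x using assms by auto
  have "total (\<lambda>x. g x * f x) = (\<Sum>x\<in>A. g x * f x)" using assms by (intro total_eq_sum) auto
  also have "\<dots> = (\<Sum>x\<in>A. (sqrt (w x) * f x) * (g x / sqrt (w x)))"
    by (intro sum.cong refl) (use wA in force)
  also have "\<dots> \<le> \<bar>\<Sum>x\<in>A. (sqrt (w x) * f x) * (g x / sqrt (w x))\<bar>" by simp
  also have "\<dots> \<le> (\<Sum>x\<in>A. \<bar>sqrt (w x) * f x\<bar> * \<bar>g x / sqrt (w x)\<bar>)"
    by (rule order_trans[OF sum_abs]) (simp only: abs_mult order_refl)
  also have "\<dots> \<le> L2_set (\<lambda>x. sqrt (w x) * f x) A * L2_set (\<lambda>x. g x / sqrt (w x)) A" by (rule L2_set_mult_ineq)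
  also have "L2_set (\<lambda>x. sqrt (w x) * f x) A = sqrt (total (\<lambda>x. w x * f x ^ 2))"
  proof -
    have "total (\<lambda>x. w x * f x ^ 2) = (\<Sum>x\<in>A. w x * f x ^ 2)" using assms by (intro total_eq_sum) auto
    also have "\<dots> = (\<Sum>x\<in>A. (sqrt (w x) * f x)^2)" by (intro sum.cong refl) (use wA in \<open>simp add: power_mult_distrib less_imp_le\<close>)
    finally show ?thesis by (simp add: L2_set_def)
  qed
  also have "L2_set (\<lambda>x. g x / sqrt (w x)) A = sqrt (\<Sum>x\<in>A. g x ^ 2 / w x)"
    unfolding L2_set_def by (intro arg_cong[of _ _ sqrt] sum.cong refl) (use wA in \<open>simp add: power_divide less_imp_le\<close>)
  finally show ?thesis .
qed

text \<open>Dyadic shells: the exponential weight beats the polynomial volume growth that doubling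
  allows. M is only a finite cutoff, and the constant does not depend on it.\<close>

lemma volume_sum:
  assumes k: "k \<ge> 0"
  shows "\<exists>C>0. \<forall>N\<ge>1. \<forall>M. (\<Sum>x\<in>gball (real M). (real (len x) powr k) ^ 2 / wt N x) \<le> C * real N powr k * vol (sqrt N)"
proof -
  \<comment> \<open>On a shell with 2^i \<le> 2 t this gives (2 D)^i \<le> (2 t)^b, a power of t
    dominated by exp t. Hence the factor r^i with r = 1 / (2 D), and r^i D^i = 2^-i is
    summable.\<close>
  obtain b where b: "2 * D < 2 ^ b" using real_arch_pow[of 2 "2 * D"] by auto
  define n where "n = nat \<lceil>2 * k\<rceil> + b"
  define C1 :: real where "C1 = 2 ^ b * fact n"
  have C1: "C1 \<ge> 1"
  proof -
    have "(1::real) * 1 \<le> 2 ^ b * fact n" by (intro mult_mono) auto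
    then show ?thesis by (simp add: C1_def)
  qed
  define r where "r = 1 / (2 * D)"
  have r: "r > 0" "r * D = 1 / 2" using D_ge_1 by (auto simp: r_def)
  have "(\<Sum>x\<in>gball (real M). (real (len x) powr k) ^ 2 / wt N x) \<le> 2 * C1 * real N powr k * vol (sqrt N)" if N: "N \<ge> 1" for N M
  proof -
    define J where "J = M"
    have pt: "(real (len x) powr k) ^ 2 / wt N x \<le> real N powr k * (C1 * (\<Sum>j\<le>J. r ^ j * (if real (len x) \<le> 2 ^ j * sqrt N then 1 else 0)))"
      if x: "x \<in> gball (real M)" for x
    proof -
      define t where "t = real (len x) / sqrt N"
      have t: "t \<ge> 0" by (simp add: t_def)
      have lt: "real (len x) = sqrt N * t" using N by (simp add: t_def)
      have "(real (len x) powr k) ^ 2 = real N powr k * (t powr k)^2"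
      proof -
        have "(sqrt N powr k)^2 = real N powr k"
          using N by (simp add: power2_eq_square flip: powr_mult)
        then show ?thesis unfolding lt using t by (simp add: powr_mult power_mult_distrib)
      qed
      then have "(real (len x) powr k) ^ 2 / wt N x = real N powr k * ((t powr k)^2 * exp (- t))"
        by (simp add: wt_def t_def exp_minus divide_inverse)
      also have "(t powr k)^2 * exp (- t) \<le> C1 * (\<Sum>j\<le>J. r ^ j * (if real (len x) \<le> 2 ^ j * sqrt N then 1 else 0))"
      proof -
        \<comment> \<open>The shell of x. It occurs among the indices up to J because t \<le> M
          \<le> 2^M.\<close>
        define i where "i = (LEAST i. t \<le> 2 ^ i)"
        have "real M \<le> 2 ^ M" by (rule order_trans[OF less_imp_le[OF of_nat_less_two_power]]) simp
        moreover have "t \<le> real (len x)" using N unfolding t_def by (simp add: divide_le_eq mult_le_cancel_left1)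
        moreover have "real (len x) \<le> real M" using x by (simp add: gball_def)
        ultimately have tM: "t \<le> 2 ^ M" by linarith
        then have i: "t \<le> 2 ^ i" unfolding i_def by (rule LeastI[where P = "\<lambda>i. t \<le> 2 ^ i"])
        have iJ: "i \<le> J" unfolding i_def J_def by (rule Least_le) (rule tM)
        have "(t powr k)^2 * exp (- t) \<le> C1 * r ^ i"
        proof (cases i)
          case 0
          then have t1: "t \<le> 1" using i by simp
          have "t powr k \<le> 1" using t t1 k by (intro powr_le1) auto
          then have "(t powr k)^2 \<le> 1" by (intro power_le_one) auto
          then have "(t powr k)^2 * exp (- t) \<le> 1 * 1" using t by (intro mult_mono) auto
          then show ?thesis using 0 C1 by simp
        next
          case (Suc i')
          have "\<not> t \<le> 2 ^ i'" using not_less_Least[of i' "\<lambda>i. t \<le> 2 ^ i"] Suc by (simp add: i_def)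
          then have t2: "2 ^ i \<le> 2 * t" using Suc by simp
          have "(1::real) \<le> 2 ^ i'" by simp
          then have t1: "t \<ge> 1" using \<open>\<not> t \<le> 2 ^ i'\<close> by linarith
          have "(2 * D) ^ i \<le> (2 ^ b) ^ i" using b D_ge_1 by (intro power_mono) auto
          also have "\<dots> = (2 ^ i) ^ b" by (simp flip: power_mult add: mult.commute)
          also have "\<dots> \<le> (2 * t) ^ b" using t2 by (intro power_mono) auto
          finally have "(2 * D) ^ i \<le> 2 ^ b * t ^ b" by (simp add: power_mult_distrib)
          moreover have "(t powr k)^2 \<le> t ^ nat \<lceil>2 * k\<rceil>"
          proof -
            have "(t powr k)^2 = t powr (2 * k)" using t1 by (simp add: powr_powr mult.commute flip: powr_realpow)
            also have "\<dots> \<le> t powr real (nat \<lceil>2 * k\<rceil>)" using t1 k by (intro powr_mono) (auto simp: real_nat_ceiling_ge)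
            finally show ?thesis using t1 by (simp add: powr_realpow)
          qed
          ultimately have "(t powr k)^2 * (2 * D) ^ i \<le> t ^ nat \<lceil>2 * k\<rceil> * (2 ^ b * t ^ b)"
            using t1 D_ge_1 by (intro mult_mono) auto
          also have "\<dots> = 2 ^ b * t ^ n" by (simp add: n_def power_add)
          also have "\<dots> \<le> C1 * exp t" using power_le_fact_exp[OF t, of n] by (simp add: C1_def mult.assoc mult_left_mono)
          finally have "(t powr k)^2 * (2 * D) ^ i \<le> C1 * exp t" .
          then show ?thesis using D_ge_1 by (simp add: r_def power_divide exp_minus field_simps)
        qed
        also have "r ^ i \<le> (\<Sum>j\<le>J. r ^ j * (if real (len x) \<le> 2 ^ j * sqrt N then 1 else 0))"
        proof -
          have "r ^ i = r ^ i * (if real (len x) \<le> 2 ^ i * sqrt N then 1 else 0)"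
          proof -
            have "real (len x) \<le> 2 ^ i * sqrt N"
              using lt mult_right_mono[OF i, of "sqrt N"] by (simp add: mult.commute)
            then show ?thesis by simp
          qed
          also have "\<dots> \<le> (\<Sum>j\<le>J. r ^ j * (if real (len x) \<le> 2 ^ j * sqrt N then 1 else 0))"
            using iJ r by (intro member_le_sum[of i "{..J}" "\<lambda>j. r ^ j * (if real (len x) \<le> 2 ^ j * sqrt N then 1 else 0)"]) auto
          finally show ?thesis .
        qed
        finally show ?thesis using C1 by (simp add: mult_left_mono)
      qed
      finally show ?thesis by (simp add: mult_left_mono)
    qed
    have "(\<Sum>x\<in>gball (real M). (real (len x) powr k) ^ 2 / wt N x) \<le>
        (\<Sum>x\<in>gball (real M). real N powr k * (C1 * (\<Sum>j\<le>J. r ^ j * (if real (len x) \<le> 2 ^ j * sqrt N then 1 else 0))))"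
      by (rule sum_mono[OF pt])
    also have "\<dots> = real N powr k * (C1 * (\<Sum>j\<le>J. r ^ j * (\<Sum>x\<in>gball (real M). if real (len x) \<le> 2 ^ j * sqrt N then 1 else 0)))"
      by (simp only: sum_distrib_left[symmetric] sum.swap[of _ "{..J}"])
    also have "\<dots> \<le> real N powr k * (C1 * (\<Sum>j\<le>J. (1 / 2) ^ j * vol (sqrt N)))"
    proof (intro mult_left_mono sum_mono)
      fix j
      have "(\<Sum>x\<in>gball (real M). if real (len x) \<le> 2 ^ j * sqrt N then 1 else 0) = real (card {x \<in> gball (real M). real (len x) \<le> 2 ^ j * sqrt N})"
        using sum.inter_filter[of "gball (real M)" "\<lambda>_. 1 :: real" "\<lambda>x. real (len x) \<le> 2 ^ j * sqrt N"] by simp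
      also have "\<dots> \<le> vol (2 ^ j * sqrt N)"
        unfolding vol_def by (intro of_nat_mono card_mono finite_gball) (auto simp: gball_def)
      also have "\<dots> \<le> D ^ j * vol (sqrt N)" by (rule vol_doubling_pow) simp
      finally have "r ^ j * (\<Sum>x\<in>gball (real M). if real (len x) \<le> 2 ^ j * sqrt N then 1 else 0) \<le> r ^ j * (D ^ j * vol (sqrt N))"
        using r by (intro mult_left_mono) auto
      also have "\<dots> = (1 / 2) ^ j * vol (sqrt N)" using r(2) by (metis mult.assoc power_mult_distrib)
      finally show "r ^ j * (\<Sum>x\<in>gball (real M). if real (len x) \<le> 2 ^ j * sqrt N then 1 else 0) \<le> (1 / 2) ^ j * vol (sqrt N)" .
    qed (use C1 in auto)
    also have "(\<Sum>j\<le>J. (1 / 2) ^ j * vol (sqrt N)) = (\<Sum>j\<le>J. (1 / 2) ^ j) * vol (sqrt N)" by (simp add: sum_distrib_right)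
    also have "real N powr k * (C1 * ((\<Sum>j\<le>J. (1 / 2) ^ j) * vol (sqrt N))) \<le> real N powr k * (C1 * (2 * vol (sqrt N)))"
    proof (intro mult_left_mono mult_right_mono)
      have "(\<Sum>j<Suc J. (1 / 2 :: real) ^ j) \<le> (\<Sum>j. (1 / 2) ^ j)" by (intro sum_le_suminf summable_geometric) auto
      also have "\<dots> = 2" by (subst suminf_geometric) auto
      finally show "(\<Sum>j\<le>J. (1 / 2 :: real) ^ j) \<le> 2" by (simp add: lessThan_Suc_atMost)
    qed (use C1 vol_ge_1[of "sqrt N"] in auto)
    finally show ?thesis by (simp add: mult_ac)
  qed
  then show ?thesis using C1 by (intro exI[of _ "2 * C1"]) auto
qed

text \<open>Cauchy-Schwarz with weight \<open>wt N\<close>: \<open>weighted_upper\<close>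
  contributes 1 / V(sqrt N) and \<open>volume_sum\<close> contributes V(sqrt N), so the volumes
  cancel.\<close>

lemma moment:
  assumes k: "k \<ge> 0"
  shows "\<exists>C>0. \<forall>N\<ge>1. total (\<lambda>x. real (len x) powr k * p N x) \<le> C * real N powr (k / 2)"
proof -
  obtain A where A: "A > 0" "\<And>N. N \<ge> 1 \<Longrightarrow> vol (sqrt N) * total (\<lambda>x. wt N x * p N x ^ 2) \<le> A" using weighted_upper by blast
  obtain B where B: "B > 0" "\<And>N M. N \<ge> 1 \<Longrightarrow>
      (\<Sum>x\<in>gball (real M). (real (len x) powr k) ^ 2 / wt N x) \<le> B * real N powr k * vol (sqrt N)"
    using volume_sum[OF k] by blast
  have "total (\<lambda>x. real (len x) powr k * p N x) \<le> sqrt (A * B) * real N powr (k / 2)" if N: "N \<ge> 1" for N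
  proof -
    have v: "vol (sqrt N) \<ge> 1" by (rule vol_ge_1) simp
    define T where "T = total (\<lambda>x. wt N x * p N x ^ 2)"
    have T: "T \<ge> 0" unfolding T_def by (intro total_nonneg) auto
    have "total (\<lambda>x. real (len x) powr k * p N x) \<le> sqrt T * sqrt (\<Sum>x\<in>gball (real N). (real (len x) powr k) ^ 2 / wt N x)"
      unfolding T_def by (rule total_cauchy_schwarz) (use gball_carrier in \<open>auto intro!: p_eq_0 not_gball\<close>)
    also have "\<dots> \<le> sqrt T * sqrt (B * real N powr k * vol (sqrt N))"
      using B(2)[OF N] T by (intro mult_left_mono real_sqrt_le_mono) auto
    also have "\<dots> = sqrt ((vol (sqrt N) * T) * (B * real N powr k))" by (simp flip: real_sqrt_mult add: mult_ac)
    also have "\<dots> \<le> sqrt (A * (B * real N powr k))"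
      using A(2)[OF N] B unfolding T_def by (intro real_sqrt_le_mono mult_right_mono) auto
    also have "\<dots> = sqrt (A * B) * sqrt (real N powr k)" by (simp add: real_sqrt_mult)
    also have "sqrt (real N powr k) = real N powr (k / 2)" by (simp add: powr_half_sqrt[symmetric] powr_powr)
    finally show ?thesis .
  qed
  then show ?thesis using A B by (intro exI[of _ "sqrt (A * B)"]) auto
qed

text \<open>By Chebyshev and the second moment, half of the mass of \<open>p n\<close> lies in a
  ball of radius comparable with sqrt n. Cauchy-Schwarz on this ball and doubling bound the squared
  norm of \<open>p n\<close> from below.\<close>

lemma u_lower: "\<exists>c>0. \<forall>n\<ge>1. c \<le> u n * vol (sqrt n)"
proof -
  obtain C where C: "C > 0" "\<And>N. N \<ge> 1 \<Longrightarrow> total (\<lambda>x. real (len x) powr 2 * p N x) \<le> C * real N powr (2 / 2)"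
    using moment[of 2] by auto
  \<comment> \<open>Ensures R^2 = 4^j n > 2 C n, so at most half of the mass lies outside the ball
    of radius R.\<close>
  obtain j where j: "2 * C < 4 ^ j" using real_arch_pow[of 4 "2 * C"] by auto
  have "1 / (4 * D ^ j) \<le> u n * vol (sqrt n)" if n: "n \<ge> 1" for n
  proof -
    define R where "R = 2 ^ j * sqrt n"
    have R: "R > 0" using n by (simp add: R_def)
    have R2: "R^2 > 2 * C * n"
    proof -
      have "((2::real) ^ j)^2 = 4 ^ j" by (simp add: power2_eq_square flip: power_mult_distrib)
      then have "R^2 = 4 ^ j * n" by (simp add: R_def power_mult_distrib)
      then show ?thesis using j n by simp
    qed
    define A where "A = gball R"
    have A: "finite A" "A \<subseteq> carrier G" using gball_carrier by (auto simp: A_def)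
    define B where "B = gball (real n) - A"
    have B: "finite B" "B \<subseteq> carrier G" using gball_carrier by (auto simp: B_def)
    have "1 = total (p n)" by (simp add: total_p)
    also have "\<dots> = sum (p n) (A \<union> B)"
      using A B by (intro total_eq_sum) (auto simp: B_def intro!: p_eq_0 not_gball)
    also have "\<dots> = sum (p n) A + sum (p n) B" using A B by (intro sum.union_disjoint) (auto simp: B_def)
    also have "sum (p n) B \<le> (\<Sum>x\<in>B. real (len x) powr 2 * p n x / R^2)"
    proof (rule sum_mono)
      fix x assume x: "x \<in> B"
      then have xc: "x \<in> carrier G" using B(2) by blast
      have "x \<notin> gball R" using x by (simp add: B_def A_def)
      then have "real (len x) \<ge> R" using xc by (simp add: gball_def)
      then have "R^2 \<le> (real (len x))^2" using R by (intro power_mono) auto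
      then have "R^2 \<le> real (len x) powr 2" by simp
      then have "1 * p n x \<le> real (len x) powr 2 / R^2 * p n x" using R by (intro mult_right_mono) auto
      then show "p n x \<le> real (len x) powr 2 * p n x / R^2" by simp
    qed
    also have "\<dots> = (\<Sum>x\<in>B. real (len x) powr 2 * p n x) / R^2" by (simp add: sum_divide_distrib)
    also have "(\<Sum>x\<in>B. real (len x) powr 2 * p n x) \<le> (\<Sum>x\<in>gball (real n). real (len x) powr 2 * p n x)"
      by (intro sum_mono2) (auto simp: B_def)
    also have "\<dots> = total (\<lambda>x. real (len x) powr 2 * p n x)" by (rule total_ball[symmetric]) (simp add: p_eq_0)
    also have "\<dots> \<le> C * n" using C(2)[OF n] by simp
    also have "C * n / R^2 \<le> 1 / 2" using R2 R by (simp add: divide_le_eq)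
    finally have half: "sum (p n) A \<ge> 1 / 2" using R by (simp add: divide_right_mono)
    have sq: "(\<Sum>x\<in>A. (p n x)^2) \<le> u n"
    proof -
      have "(\<Sum>x\<in>A. (p n x)^2) \<le> (\<Sum>x\<in>A \<union> gball (real n). (p n x)^2)" using A by (intro sum_mono2) auto
      also have "\<dots> = total (\<lambda>x. p n x ^ 2)"
        using A gball_carrier by (intro total_eq_sum[symmetric]) (auto intro!: p_eq_0 not_gball)
      finally show ?thesis by (simp add: u_total)
    qed
    have cA: "real (card A) \<le> D ^ j * vol (sqrt n)"
      using vol_doubling_pow[of "sqrt n" j] by (simp add: A_def R_def vol_def)
    have "(1 / 2)^2 \<le> (sum (p n) A)^2" using half by (intro power_mono) auto
    also have "\<dots> \<le> (\<Sum>x\<in>A. (p n x)^2) * real (card A)" by (rule sum_squared_le_sum_of_squares)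
    also have "\<dots> \<le> u n * (D ^ j * vol (sqrt n))"
      using sq cA by (intro mult_mono) auto
    finally have "1 / 4 \<le> u n * (D ^ j * vol (sqrt n))" by (simp add: power2_eq_square)
    then show ?thesis using D_ge_1 by (simp add: field_simps)
  qed
  then show ?thesis using D_ge_1 by (intro exI[of _ "1 / (4 * D ^ j)"]) auto
qed

end

section \<open>Bridges\<close>

context lazy_walk
begin

lemma p_le_u: "x \<in> carrier G \<Longrightarrow> p l x \<le> u (l div 2)"
proof (cases "even l")
  case True
  then show "x \<in> carrier G \<Longrightarrow> p l x \<le> u (l div 2)" using p_even_le[of x "l div 2"] by simp
next
  case False
  assume x: "x \<in> carrier G"
  define j where "j = l div 2"
  have l: "l = Suc (2 * j)" using False by (simp add: j_def)
  have "p l x \<le> (\<Sum>s\<in>S. u j) / q"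
    unfolding l p_Suc stepop_def using q_ge_1 x by (intro divide_right_mono sum_mono p_even_le) auto
  also have "\<dots> = u j" using q_ge_1 by (simp flip: q_def)
  finally show "p l x \<le> u (l div 2)" by (simp add: j_def)
qed

text \<open>At odd times one lazy step, of probability at least 1 / q, restores an even
  time.\<close>

lemma p_one_ge: "p n \<one> \<ge> u (n div 2) / q"
proof (cases "even n")
  case True
  have "u (n div 2) / q \<le> u (n div 2) / 1" using q_ge_1 by (intro divide_left_mono) auto
  then show ?thesis using True by (simp add: u_def)
next
  case False
  define j where "j = n div 2"
  have n: "n = Suc (2 * j)" using False by (simp add: j_def)
  have "p (2 * j) (\<one> \<otimes> st idl) \<le> (\<Sum>s\<in>S. p (2 * j) (\<one> \<otimes> st s))"
    using S_fin idl by (intro member_le_sum) auto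
  then show ?thesis unfolding j_def[symmetric] using q_ge_1 idl
    by (simp add: n p_Suc stepop_def divide_right_mono u_def)
qed

text \<open>Divide the upper bound for u at one time by the lower bound at a comparable one;
  doubling compares the two volumes.\<close>

lemma p_ratio: "\<exists>C>0. \<forall>n l. l \<ge> 1 \<and> n \<le> 4 * l \<longrightarrow> (\<forall>x\<in>carrier G. p l x \<le> C * p n \<one>)"
proof -
  obtain A where A: "A > 0" "\<And>n. n \<ge> 1 \<Longrightarrow> u n * vol (sqrt n) \<le> A" using u_upper by blast
  obtain c where c: "c > 0" "\<And>n. n \<ge> 1 \<Longrightarrow> c \<le> u n * vol (sqrt n)" using u_lower by blast
  have q: "q \<ge> 1" by (rule q_ge_1)
  have v: "vol (sqrt (real n)) \<ge> 1" for n by (rule vol_ge_1) simp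
  have u2: "u 2 > 0" using c(1) c(2)[of 2] v[of 2] by (auto simp: less_le)
  \<comment> \<open>One summand for each case: both times large, l = 1 (then n div 2 \<le> 2, so u 2
    bounds u (n div 2) from below), and n div 2 = 0.\<close>
  define B where "B = A * D^2 / c + 1 / u 2 + 1"
  have B: "B \<ge> 1" "B \<ge> 1 / u 2" "B \<ge> A * D^2 / c" using A c u2 D_ge_1 by (auto simp: B_def)
  have u0: "u j \<le> 1" for j using u_antimono[of 0 j] by (simp add: u_def p_def point_mass_def)
  have main: "u (l div 2) \<le> B * u (n div 2)" if l: "l \<ge> 1" "n \<le> 4 * l" for n l
  proof (cases "n div 2 = 0")
    case True
    have "u 0 = 1" by (simp add: u_def p_def point_mass_def)
    then show ?thesis using True u0[of "l div 2"] B by simp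
  next
    case n0: False
    show ?thesis
    proof (cases "l div 2 = 0")
      case True
      then have "n div 2 \<le> 2" using l by linarith
      then have "u 2 \<le> u (n div 2)" by (rule u_antimono)
      then have "1 / u 2 * u 2 \<le> B * u (n div 2)" using B u2 by (intro mult_mono) auto
      then show ?thesis using u0[of "l div 2"] u2 by simp
    next
      case False
      define i j where "i = n div 2" and "j = l div 2"
      \<comment> \<open>Rounding turns n \<le> 4 l into i \<le> 6 j; the weaker 16 is convenient
        because sqrt 16 amounts to two doublings.\<close>
      have ij: "i \<ge> 1" "j \<ge> 1" "i \<le> 16 * j" using n0 False l by (auto simp: i_def j_def)
      have "sqrt i \<le> sqrt (16 * j)" using ij by (intro real_sqrt_le_mono) simp
      also have "\<dots> = 2 ^ 2 * sqrt j" by (simp add: real_sqrt_mult)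
      finally have "vol (sqrt i) \<le> vol (2 ^ 2 * sqrt j)" by (rule vol_mono)
      also have "\<dots> \<le> D ^ 2 * vol (sqrt j)" by (rule vol_doubling_pow) simp
      finally have vij: "vol (sqrt i) \<le> D ^ 2 * vol (sqrt j)" .
      have "c * (u j * vol (sqrt i)) \<le> c * (D^2 * (u j * vol (sqrt j)))"
        using mult_left_mono[OF vij, of "u j"] c by (intro mult_left_mono) (auto simp: mult_ac)
      also have "\<dots> \<le> c * (D^2 * A)" using A(2)[OF ij(2)] c by (intro mult_left_mono) auto
      also have "\<dots> \<le> (u i * vol (sqrt i)) * (D^2 * A)" using c(2)[OF ij(1)] A by (intro mult_right_mono) auto
      finally have "(c * u j) * vol (sqrt i) \<le> (A * D^2 * u i) * vol (sqrt i)" by (simp add: mult_ac)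
      then have "c * u j \<le> A * D^2 * u i" using v[of i] by (simp add: mult_le_cancel_right)
      then have "u j \<le> A * D^2 / c * u i" using c by (simp add: field_simps)
      also have "\<dots> \<le> B * u i" using B by (intro mult_right_mono) auto
      finally show ?thesis by (simp add: i_def j_def)
    qed
  qed
  have "p l x \<le> (q * B) * p n \<one>" if "l \<ge> 1" "n \<le> 4 * l" "x \<in> carrier G" for n l x
  proof -
    have "p l x \<le> B * u (n div 2)" using p_le_u[of x l] main[of l n] that by linarith
    also have "u (n div 2) \<le> q * p n \<one>" using p_one_ge[of n] q by (simp add: divide_le_eq mult.commute)
    finally show ?thesis using B by (simp add: mult_left_mono mult_ac)
  qed
  then show ?thesis using q B by (intro exI[of _ "q * B"]) auto
qed

section \<open>Counting words and loops\<close>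

definition W :: "nat \<Rightarrow> 's list set" where "W n = {a. set a \<subseteq> S \<and> length a = n}"

definition gval :: "'s list \<Rightarrow> 'a" where "gval a = lprod G (map st a)"

definition loops :: "nat \<Rightarrow> 's list set" where "loops n = {a \<in> W n. gval a = \<one>}"

lemma finite_W [simp]: "finite (W n)"
  unfolding W_def by (rule finite_lists_length_eq[OF S_fin])

lemma st_list_carrier: "set a \<subseteq> S \<Longrightarrow> set (map st a) \<subseteq> carrier G"
  by (auto simp: subset_eq)

lemma gval_closed: "set a \<subseteq> S \<Longrightarrow> gval a \<in> carrier G"
  unfolding gval_def by (intro lprod_closed st_list_carrier)

lemma gval_append: "set a \<subseteq> S \<Longrightarrow> set b \<subseteq> S \<Longrightarrow> gval (a @ b) = gval a \<otimes> gval b"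
  unfolding gval_def map_append by (intro lprod_append st_list_carrier)

lemma W_set: "a \<in> W n \<Longrightarrow> set a \<subseteq> S"
  by (simp add: W_def)

lemma sum_W_add: "(\<Sum>a\<in>W (i + j). H a) = (\<Sum>b\<in>W i. \<Sum>c\<in>W j. H (b @ c))"
proof -
  have "bij_betw (\<lambda>(b, c). b @ c) (W i \<times> W j) (W (i + j))"
  proof (rule bij_betwI[of _ _ _ "\<lambda>a. (take i a, drop i a)"])
    show "(\<lambda>a. (take i a, drop i a)) \<in> W (i + j) \<rightarrow> W i \<times> W j"
      using set_take_subset set_drop_subset by (fastforce simp: W_def)
  qed (auto simp: W_def)
  then have "(\<Sum>a\<in>W (i + j). H a) = (\<Sum>x\<in>W i \<times> W j. H (case x of (b, c) \<Rightarrow> b @ c))"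
    by (rule sum.reindex_bij_betw[symmetric])
  also have "\<dots> = (\<Sum>b\<in>W i. \<Sum>c\<in>W j. H (b @ c))"
    by (subst sum.cartesian_product) (auto intro!: sum.cong)
  finally show ?thesis .
qed

lemma sum_W_1: "(\<Sum>a\<in>W 1. H a) = (\<Sum>s\<in>S. H [s])"
proof -
  have "W 1 = (\<lambda>s. [s]) ` S" by (auto simp: W_def length_Suc_conv)
  then show ?thesis by (simp add: sum.reindex inj_on_def)
qed

text \<open>Links counting with the operator: appending a letter replaces F by
  \<open>stepop F\<close>, and self-adjointness moves this step onto \<open>p n\<close>.\<close>

lemma sum_words: "(\<Sum>a\<in>W n. F (gval a)) = q ^ n * total (\<lambda>x. F x * p n x)"
proof (induction n arbitrary: F)
  case 0
  have "W 0 = {[]}" by (auto simp: W_def)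
  then show ?case using total_point_mass[of \<one> F] by (simp add: p_def gval_def)
next
  case (Suc n)
  have q: "q \<ge> 1" by (rule q_ge_1)
  have "(\<Sum>a\<in>W (Suc n). F (gval a)) = (\<Sum>b\<in>W n. \<Sum>s\<in>S. F (gval (b @ [s])))"
    using sum_W_add[of "\<lambda>a. F (gval a)" n 1] by (simp add: sum_W_1[simplified])
  also have "\<dots> = (\<Sum>b\<in>W n. q * stepop F (gval b))"
    using q by (intro sum.cong refl) (simp add: stepop_def gval_append W_set, simp add: gval_def)
  also have "\<dots> = q * (q ^ n * total (\<lambda>x. stepop F x * p n x))"
    by (simp only: sum_distrib_left[symmetric] Suc.IH)
  also have "total (\<lambda>x. stepop F x * p n x) = total (\<lambda>x. stepop (p n) x * F x)"
    using stepop_adjoint[of "p n" F] by (simp add: mult.commute)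
  finally show ?case by (simp add: p_Suc[abs_def] mult.commute)
qed

lemma sum_words_eq:
  "y \<in> carrier G \<Longrightarrow> (\<Sum>a\<in>W n. if gval a = y then 1 else 0) = q ^ n * p n y"
proof -
  assume y: "y \<in> carrier G"
  have "(\<Sum>a\<in>W n. if gval a = y then 1 else 0) = q ^ n * total (\<lambda>x. (if x = y then 1 else 0) * p n x)"
    by (rule sum_words)
  also have "total (\<lambda>x. (if x = y then 1 else 0) * p n x) = total (\<lambda>x. p n x * point_mass y x)"
    by (rule total_cong) (simp add: point_mass_def)
  finally show ?thesis using total_point_mass[OF y, of "p n"] by simp
qed

lemma card_loops: "real (card (loops n)) = q ^ n * p n \<one>"
proof -
  have "real (card (loops n)) = (\<Sum>a\<in>W n. if gval a = \<one> then 1 else 0)"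
    using sum.inter_filter[of "W n" "\<lambda>_. 1 :: real" "\<lambda>a. gval a = \<one>"] by (simp add: loops_def)
  then show ?thesis using sum_words_eq[of \<one> n] by simp
qed

text \<open>Rotating the loop joins the pieces after and before the segment v into one word of
  length l + i with value v^-1. The position of the segment thus plays no part in the law of its
  value.\<close>

lemma bridge:
  assumes "i + m + l = n"
  shows "(\<Sum>a\<in>loops n. F (gval (take m (drop i a)))) = q ^ n * total (\<lambda>x. F x * (p m x * p (l + i) (inv x)))"
proof -
  have "(\<Sum>a\<in>loops n. F (gval (take m (drop i a)))) =
      (\<Sum>a\<in>W n. if gval a = \<one> then F (gval (take m (drop i a))) else 0)"
    unfolding loops_def by (rule sum.inter_filter) simp
  also have "\<dots> = (\<Sum>b\<in>W i. \<Sum>v\<in>W m. \<Sum>c\<in>W l. if gval (b @ v @ c) = \<one> then F (gval v) else 0)"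
  proof -
    have "n = i + (m + l)" using assms by simp
    then show ?thesis
      by (simp only: sum_W_add) (intro sum.cong refl, simp add: W_def)
  qed
  also have "\<dots> = (\<Sum>v\<in>W m. \<Sum>b\<in>W i. \<Sum>c\<in>W l. if gval (b @ v @ c) = \<one> then F (gval v) else 0)"
    by (rule sum.swap)
  also have "\<dots> = (\<Sum>v\<in>W m. \<Sum>c\<in>W l. \<Sum>b\<in>W i. if gval (b @ v @ c) = \<one> then F (gval v) else 0)"
    by (intro sum.cong refl sum.swap)
  also have "\<dots> = (\<Sum>v\<in>W m. F (gval v) * (q ^ (l + i) * p (l + i) (inv (gval v))))"
  proof (rule sum.cong[OF refl])
    fix v assume "v \<in> W m"
    then have v: "set v \<subseteq> S" "gval v \<in> carrier G" using gval_closed W_set by auto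
    have "(\<Sum>c\<in>W l. \<Sum>b\<in>W i. if gval (b @ v @ c) = \<one> then F (gval v) else 0) =
        (\<Sum>c\<in>W l. \<Sum>b\<in>W i. F (gval v) * (if gval (c @ b) = inv (gval v) then 1 else 0))"
    proof (intro sum.cong refl)
      fix c b assume "c \<in> W l" "b \<in> W i"
      then have cb: "set c \<subseteq> S" "gval c \<in> carrier G" "set b \<subseteq> S" "gval b \<in> carrier G"
        using gval_closed W_set by auto
      have "gval b \<otimes> (gval v \<otimes> gval c) = \<one> \<longleftrightarrow> gval c \<otimes> gval b = inv (gval v)"
      proof
        assume *: "gval b \<otimes> (gval v \<otimes> gval c) = \<one>"
        from inv_comm[OF this] have "gval v \<otimes> (gval c \<otimes> gval b) = \<one>"
          using v cb by (simp add: m_assoc)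
        from inv_comm[OF this] have "inv (gval v) = gval c \<otimes> gval b"
          using v cb by (intro inv_equality) auto
        then show "gval c \<otimes> gval b = inv (gval v)" ..
      next
        assume "gval c \<otimes> gval b = inv (gval v)"
        then have "gval v = inv (gval c \<otimes> gval b)" using v by simp
        then show "gval b \<otimes> (gval v \<otimes> gval c) = \<one>" using cb by (simp add: inv_mult_group m_assoc)
      qed
      then show "(if gval (b @ v @ c) = \<one> then F (gval v) else 0) = F (gval v) * (if gval (c @ b) = inv (gval v) then 1 else 0)"
        using v cb by (simp add: gval_append)
    qed
    also have "\<dots> = F (gval v) * (\<Sum>a\<in>W (l + i). if gval a = inv (gval v) then 1 else 0)"
      by (simp only: sum_W_add sum_distrib_left)
    also have "\<dots> = F (gval v) * (q ^ (l + i) * p (l + i) (inv (gval v)))"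
      using v by (subst sum_words_eq) auto
    finally show "(\<Sum>c\<in>W l. \<Sum>b\<in>W i. if gval (b @ v @ c) = \<one> then F (gval v) else 0) = \<dots>" .
  qed
  also have "\<dots> = q ^ (l + i) * (\<Sum>v\<in>W m. (\<lambda>x. F x * p (l + i) (inv x)) (gval v))"
    by (simp add: sum_distrib_left mult_ac)
  also have "\<dots> = q ^ (l + i) * (q ^ m * total (\<lambda>x. F x * p (l + i) (inv x) * p m x))"
    by (subst sum_words) simp
  also have "\<dots> = q ^ n * total (\<lambda>x. F x * (p m x * p (l + i) (inv x)))"
    unfolding assms[symmetric] by (simp add: mult_ac power_add)
  finally show ?thesis .
qed

text \<open>Since n \<le> 4 (n - m), \<open>p_ratio\<close> bounds the factor of the remaining n - m
  letters by a multiple of the return probability, which is exactly the normalisation; what is left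
  is a moment of the free walk.\<close>

lemma bridge_moment:
  assumes k: "k \<ge> 0"
  shows "\<exists>C>0. \<forall>n i m. i + m \<le> n \<and> 1 \<le> m \<and> m < n \<and> n \<le> 4 * (n - m) \<longrightarrow>
    (\<Sum>a\<in>loops n. (1 + real (len (gval (take m (drop i a))))) powr k) \<le> C * real m powr (k / 2) * card (loops n)"
proof -
  obtain A where A: "A > 0" "\<And>n l x. l \<ge> 1 \<Longrightarrow> n \<le> 4 * l \<Longrightarrow> x \<in> carrier G \<Longrightarrow> p l x \<le> A * p n \<one>"
    using p_ratio by blast
  obtain B where B: "B > 0" "\<And>N. N \<ge> 1 \<Longrightarrow> total (\<lambda>x. real (len x) powr k * p N x) \<le> B * real N powr (k / 2)"
    using moment[OF k] by blast
  define F where "F = (\<lambda>x. (1 + real (len x)) powr k)"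
  have F: "F x \<ge> 0" for x by (simp add: F_def)
  have tF: "total (\<lambda>x. F x * p m x) \<le> 2 powr k * (1 + B) * real m powr (k / 2)" if m: "m \<ge> 1" for m
  proof -
    have Fx: "F x \<le> 2 powr k * (1 + real (len x) powr k)" for x
    proof -
      have "F x \<le> (2 * max 1 (real (len x))) powr k" unfolding F_def using k by (intro powr_mono2) auto
      also have "\<dots> = 2 powr k * (max 1 (real (len x))) powr k" by (simp add: powr_mult)
      also have "(max 1 (real (len x))) powr k \<le> 1 + real (len x) powr k" by (simp add: max_def)
      finally show ?thesis by simp
    qed
    have "total (\<lambda>x. F x * p m x) \<le> total (\<lambda>x. 2 powr k * (p m x + real (len x) powr k * p m x))"
    proof (rule total_mono)
      show "F x * p m x \<le> 2 powr k * (p m x + real (len x) powr k * p m x)" for x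
        using mult_right_mono[OF Fx[of x] p_nonneg[of m x]] by (simp add: algebra_simps)
    qed (auto intro!: finsupp_mult2 finsupp_add)
    also have "\<dots> = 2 powr k * (1 + total (\<lambda>x. real (len x) powr k * p m x))"
      unfolding total_cmult by (subst total_add) (auto intro!: finsupp_mult2 simp: total_p)
    also have "\<dots> \<le> 2 powr k * (real m powr (k / 2) + B * real m powr (k / 2))"
      using B(2)[OF m] m k by (intro mult_left_mono add_mono) (auto intro: ge_one_powr_ge_zero)
    finally show ?thesis by (simp add: algebra_simps)
  qed
  have "(\<Sum>a\<in>loops n. F (gval (take m (drop i a)))) \<le> (A * (2 powr k * (1 + B))) * real m powr (k / 2) * card (loops n)"
    if h: "i + m \<le> n" "1 \<le> m" "m < n" "n \<le> 4 * (n - m)" for n i m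
  proof -
    define l where "l = n - i - m"
    have l: "i + m + l = n" "l + i = n - m" using h by (auto simp: l_def)
    have "(\<Sum>a\<in>loops n. F (gval (take m (drop i a)))) = q ^ n * total (\<lambda>x. F x * (p m x * p (l + i) (inv x)))"
      by (rule bridge[OF l(1)])
    also have "total (\<lambda>x. F x * (p m x * p (l + i) (inv x))) \<le> total (\<lambda>x. A * p n \<one> * (F x * p m x))"
    proof (rule total_mono)
      show "finsupp (\<lambda>x. F x * (p m x * p (l + i) (inv x)))" by (intro finsupp_mult2 finsupp_mult1) simp
      show "finsupp (\<lambda>x. A * p n \<one> * (F x * p m x))" by (intro finsupp_mult2) simp
      fix x assume "x \<in> carrier G"
      then have "p (l + i) (inv x) \<le> A * p n \<one>" using h l by (intro A(2)) auto
      then have "F x * p m x * p (l + i) (inv x) \<le> F x * p m x * (A * p n \<one>)"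
        using F by (intro mult_left_mono) auto
      then show "F x * (p m x * p (l + i) (inv x)) \<le> A * p n \<one> * (F x * p m x)" by (simp add: mult_ac)
    qed
    also have "\<dots> = A * p n \<one> * total (\<lambda>x. F x * p m x)" by (rule total_cmult)
    also have "\<dots> \<le> A * p n \<one> * (2 powr k * (1 + B) * real m powr (k / 2))"
      using A(1) tF[OF h(2)] by (intro mult_left_mono) auto
    finally have "(\<Sum>a\<in>loops n. F (gval (take m (drop i a)))) \<le> q ^ n * (A * p n \<one> * (2 powr k * (1 + B) * real m powr (k / 2)))"
      using q_ge_1 by (simp add: mult_left_mono)
    then show ?thesis unfolding card_loops by (simp add: mult_ac)
  qed
  then show ?thesis using A B unfolding F_def by (intro exI[of _ "A * (2 powr k * (1 + B))"]) auto
qed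

end

section \<open>Homomorphisms of free groups\<close>

lemma free_mult: "u \<otimes>\<^bsub>free_group d\<^esub> v = foldr cancel_cons u v"
  by (simp add: free_group_def)

lemma free_one: "\<one>\<^bsub>free_group d\<^esub> = []"
  by (simp add: free_group_def)

lemma free_carrier: "w \<in> carrier (free_group d) \<longleftrightarrow> set w \<subseteq> letters d \<and> reduced w"
  by (simp add: free_group_def)

lemma letter_carrier: "x \<in> letters d \<Longrightarrow> [x] \<in> carrier (free_group d)"
  by (simp add: free_carrier)

lemma free_inv_letter: "x \<in> letters d \<Longrightarrow> inv\<^bsub>free_group d\<^esub> [x] = [inv_letter x]"
  by (rule group.inv_equality[OF group_free_group]) (auto simp: letter_carrier free_mult free_one)

lemma word_value_lprod: "word_value d w = lprod (free_group d) (map (\<lambda>x. [x]) w)"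
  by (simp add: word_value_def lprod_def)

lemma word_value_simps [simp]:
  "word_value d [] = []" "word_value d (x # w) = [x] \<otimes>\<^bsub>free_group d\<^esub> word_value d w"
  by (simp_all add: word_value_def free_one)

lemma word_value_foldr: "word_value d w = foldr cancel_cons w []"
  by (induction w) (simp_all add: free_mult)

lemma word_value_id: "w \<in> carrier (free_group d) \<Longrightarrow> word_value d w = w"
  by (simp add: word_value_foldr free_carrier foldr_cancel_cons_Nil)

lemma letters_carrier: "set w \<subseteq> letters d \<Longrightarrow> set (map (\<lambda>x. [x]) w) \<subseteq> carrier (free_group d)"
  by (auto simp: letter_carrier)

lemma word_value_closed: "set w \<subseteq> letters d \<Longrightarrow> word_value d w \<in> carrier (free_group d)"
  unfolding word_value_lprod by (intro group.lprod_closed group_free_group letters_carrier)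

lemma word_value_append:
  "set u \<subseteq> letters d \<Longrightarrow> set v \<subseteq> letters d \<Longrightarrow>
    word_value d (u @ v) = word_value d u \<otimes>\<^bsub>free_group d\<^esub> word_value d v"
  unfolding word_value_lprod map_append by (intro group.lprod_append group_free_group letters_carrier)

lemma hom_lprod:
  assumes "f \<in> hom H K" "group H" "group K"
  shows "set xs \<subseteq> carrier H \<Longrightarrow> f (lprod H xs) = lprod K (map f xs)"
proof (induction xs)
  case Nil
  then show ?case using group_hom.hom_one[of H K f] assms by (simp add: group_hom_def group_hom_axioms_def)
next
  case (Cons x xs)
  then show ?case using assms group.lprod_closed[of H xs] by (simp add: hom_mult)
qed

lemma hom_word_value:
  assumes "f \<in> hom (free_group d) K" "group K" "set w \<subseteq> letters d"
  shows "f (word_value d w) = lprod K (map (\<lambda>x. f [x]) w)"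
  unfolding word_value_lprod using hom_lprod[OF assms(1) group_free_group assms(2) letters_carrier[OF assms(3)]]
  by (simp add: comp_def)

lemma hom_eqI:
  assumes "f \<in> hom (free_group d) K" "g \<in> hom (free_group d) K" "group K"
    "\<And>x. x \<in> letters d \<Longrightarrow> f [x] = g [x]" and w: "w \<in> carrier (free_group d)"
  shows "f w = g w"
proof -
  have "set w \<subseteq> letters d" using w by (simp add: free_carrier)
  note sw = this
  have "map (\<lambda>x. f [x]) w = map (\<lambda>x. g [x]) w"
    using sw assms(4) by (intro map_cong refl) blast
  then have "lprod K (map (\<lambda>x. f [x]) w) = lprod K (map (\<lambda>x. g [x]) w)" by (rule arg_cong)
  then have "f (word_value d w) = g (word_value d w)"
    by (simp only: hom_word_value[OF assms(1,3) sw] hom_word_value[OF assms(2,3) sw])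
  then show ?thesis by (simp add: word_value_id[OF w])
qed

text \<open>Universal property of the free group: cancellation is respected because h sends formal
  inverses to inverses.\<close>

lemma free_extend:
  assumes "group K" "\<And>x. x \<in> letters d \<Longrightarrow> h x \<in> carrier K" "\<And>x. x \<in> letters d \<Longrightarrow> h (inv_letter x) = inv\<^bsub>K\<^esub> (h x)"
  shows "(\<lambda>w. lprod K (map h w)) \<in> hom (free_group d) K"
proof (rule homI)
  interpret K: group K by fact
  have cl: "lprod K (map h w) \<in> carrier K" if "set w \<subseteq> letters d" for w
    using that assms(2) by (intro K.lprod_closed) auto
  show "lprod K (map h w) \<in> carrier K" if "w \<in> carrier (free_group d)" for w
    using that cl by (simp add: free_carrier)
  have defect: "lprod K (map h (cancel_cons x w)) = h x \<otimes>\<^bsub>K\<^esub> lprod K (map h w)"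
    if "x \<in> letters d" "set w \<subseteq> letters d" for x w
    using that cl assms by (cases w) auto
  fix u v assume uv: "u \<in> carrier (free_group d)" "v \<in> carrier (free_group d)"
  then have v: "set v \<subseteq> letters d" by (simp add: free_carrier)
  have *: "set u \<subseteq> letters d \<Longrightarrow> set (foldr cancel_cons u v) \<subseteq> letters d \<and>
      lprod K (map h (foldr cancel_cons u v)) = lprod K (map h u) \<otimes>\<^bsub>K\<^esub> lprod K (map h v)" for u
  proof (induction u)
    case Nil
    then show ?case using v cl by simp
  next
    case (Cons x u)
    then show ?case using set_cancel_cons[of x "foldr cancel_cons u v"] assms(2) cl v
      by (auto simp: defect K.m_assoc)
  qed
  show "lprod K (map h (u \<otimes>\<^bsub>free_group d\<^esub> v)) = lprod K (map h u) \<otimes>\<^bsub>K\<^esub> lprod K (map h v)"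
    using *[of u] uv by (simp add: free_mult free_carrier)
qed

text \<open>Projectivity of free groups. It supplies the translations between two presentations of
  the same group.\<close>

lemma free_lift:
  assumes G: "group G" and f: "f \<in> hom (free_group d) G" and g: "g \<in> hom (free_group e) G"
    and surj: "g ` carrier (free_group e) = carrier G"
  shows "\<exists>a\<in>hom (free_group d) (free_group e). \<forall>w\<in>carrier (free_group d). g (a w) = f w"
proof -
  interpret G: group G by fact
  interpret F: group "free_group e" by (rule group_free_group)
  interpret g: group_hom "free_group e" G g by unfold_locales (rule g)
  have fl: "f [x] \<in> carrier G" if "x \<in> letters d" for x
    using hom_in_carrier[OF f letter_carrier[OF that]] .
  have "\<exists>c. c \<in> carrier (free_group e) \<and> g c = f [x]" if "x \<in> letters d" for x
    using fl[OF that] surj by (metis imageE)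
  then obtain c where c: "\<And>x. x \<in> letters d \<Longrightarrow> c x \<in> carrier (free_group e) \<and> g (c x) = f [x]" by metis
  \<comment> \<open>Only positive letters are lifted by choice; independent choices for a letter and
    its inverse need not be inverse to each other.\<close>
  define h where "h = (\<lambda>x. if snd x then c x else inv\<^bsub>free_group e\<^esub> (c (inv_letter x)))"
  have hc: "h x \<in> carrier (free_group e)" if "x \<in> letters d" for x
    using c that by (auto simp: h_def)
  have hi: "h (inv_letter x) = inv\<^bsub>free_group e\<^esub> (h x)" if "x \<in> letters d" for x
  proof -
    have "snd (inv_letter x) \<longleftrightarrow> \<not> snd x" by (simp add: inv_letter_def)
    then show ?thesis using c[of "inv_letter x"] that by (simp add: h_def)
  qed
  define a where "a = (\<lambda>w. lprod (free_group e) (map h w))"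
  have a: "a \<in> hom (free_group d) (free_group e)" unfolding a_def
    using hc hi by (intro free_extend group_free_group)
  have gh: "g (h x) = f [x]" if x: "x \<in> letters d" for x
  proof (cases "snd x")
    case True
    then show ?thesis using c x by (simp add: h_def)
  next
    case False
    have "g (h x) = inv\<^bsub>G\<^esub> (f [inv_letter x])" using c[of "inv_letter x"] x False by (simp add: h_def)
    also have "\<dots> = f (inv\<^bsub>free_group d\<^esub> [inv_letter x])"
      using group_hom.hom_inv[of "free_group d" G f "[inv_letter x]"] f x
      by (simp add: group_hom_def group_hom_axioms_def group_free_group G.group_axioms letter_carrier)
    finally show ?thesis using x by (simp add: free_inv_letter)
  qed
  have "g (a w) = f w" if w: "w \<in> carrier (free_group d)" for w
  proof (rule hom_eqI[OF _ f G _ w, of "\<lambda>w. g (a w)"])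
    show "(\<lambda>w. g (a w)) \<in> hom (free_group d) G"
      using hom_compose[OF a g] by (simp add: comp_def)
    show "g (a [x]) = f [x]" if "x \<in> letters d" for x
      using that gh hc by (simp add: a_def)
  qed
  then show ?thesis using a by blast
qed

lemma word_ball_iff: "x \<in> word_ball d n \<longleftrightarrow> (\<exists>w. set w \<subseteq> letters d \<and> length w \<le> n \<and> x = word_value d w)"
  by (auto simp: word_ball_def)

lemma word_ball_mult:
  assumes "x \<in> word_ball d m" "y \<in> word_ball d n"
  shows "x \<otimes>\<^bsub>free_group d\<^esub> y \<in> word_ball d (m + n)"
proof -
  obtain u v where "set u \<subseteq> letters d" "length u \<le> m" "x = word_value d u"
    "set v \<subseteq> letters d" "length v \<le> n" "y = word_value d v"
    using assms unfolding word_ball_iff by blast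
  then show ?thesis unfolding word_ball_iff by (intro exI[of _ "u @ v"]) (auto simp: word_value_append)
qed

lemma word_ball_inv:
  assumes "x \<in> word_ball d n"
  shows "inv\<^bsub>free_group d\<^esub> x \<in> word_ball d n"
proof -
  interpret F: group "free_group d" by (rule group_free_group)
  have *: "set u \<subseteq> letters d \<Longrightarrow> inv\<^bsub>free_group d\<^esub> (word_value d u) = word_value d (rev (map inv_letter u))" for u
  proof (induction u)
    case Nil
    then show ?case using F.inv_one by (simp add: free_one)
  next
    case (Cons x u)
    have "set (rev (map inv_letter u)) \<subseteq> letters d" using Cons.prems by auto
    then have "word_value d (rev (map inv_letter u) @ [inv_letter x]) =
        word_value d (rev (map inv_letter u)) \<otimes>\<^bsub>free_group d\<^esub> word_value d [inv_letter x]"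
      using Cons.prems by (intro word_value_append) auto
    moreover have "word_value d [inv_letter x] = [inv_letter x]"
      using Cons.prems by (intro word_value_id letter_carrier) auto
    ultimately show ?case using Cons
      by (simp add: F.inv_mult_group letter_carrier word_value_closed free_inv_letter del: word_value_simps(2))
        (simp add: F.inv_mult_group letter_carrier word_value_closed free_inv_letter)
  qed
  obtain u where "set u \<subseteq> letters d" "length u \<le> n" "x = word_value d u"
    using assms unfolding word_ball_iff by blast
  then show ?thesis unfolding word_ball_iff using *[of u] by (intro exI[of _ "rev (map inv_letter u)"]) auto
qed

lemma word_ball_mono: "m \<le> n \<Longrightarrow> word_ball d m \<subseteq> word_ball d n"
  by (auto simp: word_ball_def)

lemma word_ball_carrier: "word_ball d n \<subseteq> carrier (free_group d)"
  by (auto simp: word_ball_def word_value_closed)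

lemma hom_word_ball:
  assumes a: "a \<in> hom (free_group d) (free_group e)"
  shows "\<exists>L. \<forall>n. \<forall>w\<in>word_ball d n. a w \<in> word_ball e (L * n)"
proof -
  define L where "L = (\<Sum>x\<in>letters d. length (a [x]))"
  have L: "length (a [x]) \<le> L" if "x \<in> letters d" for x
    unfolding L_def using that by (intro member_le_sum) (auto simp: finite_letters)
  have *: "set u \<subseteq> letters d \<Longrightarrow> a (word_value d u) \<in> word_ball e (L * length u)" for u
  proof (induction u)
    case Nil
    then show ?case using hom_word_value[OF a group_free_group, of "[]"] one_in_word_ball[of e]
      by (simp add: free_one)
  next
    case (Cons x u)
    have ax: "a [x] \<in> carrier (free_group e)"
      using Cons.prems by (intro hom_in_carrier[OF a] letter_carrier) auto
    then have "a [x] \<in> word_ball e L" unfolding word_ball_iff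
      using word_value_id[OF ax] L[of x] Cons.prems by (intro exI[of _ "a [x]"]) (auto simp: free_carrier)
    moreover have "a (word_value d (x # u)) = a [x] \<otimes>\<^bsub>free_group e\<^esub> a (word_value d u)"
      using hom_mult[OF a, of "[x]" "word_value d u"] Cons.prems by (simp add: letter_carrier word_value_closed)
    ultimately show ?case using word_ball_mult[of "a [x]" e L] Cons by simp
  qed
  have "a w \<in> word_ball e (L * n)" if "w \<in> word_ball d n" for w n
  proof -
    obtain u where "set u \<subseteq> letters d" "length u \<le> n" "w = word_value d u"
      using \<open>w \<in> word_ball d n\<close> unfolding word_ball_iff by blast
    then show ?thesis using *[of u] word_ball_mono[of "L * length u" "L * n" e] by auto
  qed
  then show ?thesis by blast
qed

section \<open>Filling area\<close>

locale presentation =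
  fixes d :: nat and rs :: "letter list list"
  assumes rs_carrier: "set rs \<subseteq> carrier (free_group d)"
begin

abbreviation "F \<equiv> free_group d"
abbreviation "R \<equiv> relations d rs"
abbreviation "fa \<equiv> filling_area d rs"

sublocale F: group F by (rule group_free_group)

lemma R_normal: "R \<lhd> F"
proof (rule F.normal_inv_iff[THEN iffD2], intro conjI ballI)
  let ?N = "{N. N \<lhd> F \<and> set rs \<subseteq> N}"
  have ne: "carrier F \<in> ?N" using carrier_normal[OF group_free_group] rs_carrier by auto
  show "subgroup R F" unfolding normal_closure_def
    using ne by (intro F.subgroups_Inter) (auto dest: normal_imp_subgroup)
  fix x h assume x: "x \<in> carrier F" and h: "h \<in> R"
  have "x \<otimes>\<^bsub>F\<^esub> h \<otimes>\<^bsub>F\<^esub> inv\<^bsub>F\<^esub> x \<in> N" if "N \<in> ?N" for N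
    using that x h normal.inv_op_closed2[of N F x h] by (auto simp: normal_closure_def)
  then show "x \<otimes>\<^bsub>F\<^esub> h \<otimes>\<^bsub>F\<^esub> inv\<^bsub>F\<^esub> x \<in> R" by (auto simp: normal_closure_def)
qed

lemma R_subgroup: "subgroup R F" by (rule normal_imp_subgroup[OF R_normal])

lemma R_carrier: "x \<in> R \<Longrightarrow> x \<in> carrier F" by (rule subgroup.mem_carrier[OF R_subgroup])

lemma rs_R: "set rs \<subseteq> R" by (auto simp: normal_closure_def)

lemma R_one: "\<one>\<^bsub>F\<^esub> \<in> R" by (rule subgroup.one_closed[OF R_subgroup])

lemma R_mult: "x \<in> R \<Longrightarrow> y \<in> R \<Longrightarrow> x \<otimes>\<^bsub>F\<^esub> y \<in> R" by (rule subgroup.m_closed[OF R_subgroup])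

lemma R_conj: "g \<in> carrier F \<Longrightarrow> x \<in> R \<Longrightarrow> inv\<^bsub>F\<^esub> g \<otimes>\<^bsub>F\<^esub> x \<otimes>\<^bsub>F\<^esub> g \<in> R"
  using normal.inv_op_closed1[OF R_normal] by blast

abbreviation "RC \<equiv> relator_conjugates d rs"

lemma RC_iff: "c \<in> RC \<longleftrightarrow> (\<exists>g\<in>carrier F. \<exists>r\<in>set rs. c = inv\<^bsub>F\<^esub> g \<otimes>\<^bsub>F\<^esub> r \<otimes>\<^bsub>F\<^esub> g \<or>
    c = inv\<^bsub>F\<^esub> g \<otimes>\<^bsub>F\<^esub> inv\<^bsub>F\<^esub> r \<otimes>\<^bsub>F\<^esub> g)"
  by (auto simp: relator_conjugates_def)

lemma RC_R: "RC \<subseteq> R"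
proof
  fix c assume "c \<in> RC"
  then obtain g r where *: "g \<in> carrier F" "r \<in> set rs"
    "c = inv\<^bsub>F\<^esub> g \<otimes>\<^bsub>F\<^esub> r \<otimes>\<^bsub>F\<^esub> g \<or> c = inv\<^bsub>F\<^esub> g \<otimes>\<^bsub>F\<^esub> inv\<^bsub>F\<^esub> r \<otimes>\<^bsub>F\<^esub> g"
    unfolding RC_iff by blast
  have "r \<in> R" using * rs_R by auto
  moreover from this have "inv\<^bsub>F\<^esub> r \<in> R" by (rule subgroup.m_inv_closed[OF R_subgroup])
  ultimately show "c \<in> R" using * R_conj by auto
qed

lemma RC_carrier: "c \<in> RC \<Longrightarrow> c \<in> carrier F"
  using RC_R R_carrier by auto

lemma RC_conj:
  assumes "c \<in> RC" "h \<in> carrier F"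
  shows "inv\<^bsub>F\<^esub> h \<otimes>\<^bsub>F\<^esub> c \<otimes>\<^bsub>F\<^esub> h \<in> RC"
proof -
  obtain g r where *: "g \<in> carrier F" "r \<in> set rs"
    "c = inv\<^bsub>F\<^esub> g \<otimes>\<^bsub>F\<^esub> r \<otimes>\<^bsub>F\<^esub> g \<or> c = inv\<^bsub>F\<^esub> g \<otimes>\<^bsub>F\<^esub> inv\<^bsub>F\<^esub> r \<otimes>\<^bsub>F\<^esub> g"
    using assms(1) unfolding RC_iff by blast
  have r: "r \<in> carrier F" using * rs_carrier by auto
  show ?thesis unfolding RC_iff using * r assms(2)
    by (intro bexI[of _ "g \<otimes>\<^bsub>F\<^esub> h"] bexI[of _ r]) (auto simp: F.inv_mult_group F.m_assoc)
qed

lemma RC_inv: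
  assumes "c \<in> RC"
  shows "inv\<^bsub>F\<^esub> c \<in> RC"
proof -
  obtain g r where *: "g \<in> carrier F" "r \<in> set rs"
    "c = inv\<^bsub>F\<^esub> g \<otimes>\<^bsub>F\<^esub> r \<otimes>\<^bsub>F\<^esub> g \<or> c = inv\<^bsub>F\<^esub> g \<otimes>\<^bsub>F\<^esub> inv\<^bsub>F\<^esub> r \<otimes>\<^bsub>F\<^esub> g"
    using assms(1) unfolding RC_iff by blast
  have r: "r \<in> carrier F" using * rs_carrier by auto
  show ?thesis unfolding RC_iff using * r
    by (intro bexI[of _ g] bexI[of _ r]) (auto simp: F.inv_mult_group F.m_assoc)
qed

lemma conj_lprod:
  assumes h: "h \<in> carrier F"
  shows "set cs \<subseteq> carrier F \<Longrightarrow>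
    inv\<^bsub>F\<^esub> h \<otimes>\<^bsub>F\<^esub> lprod F cs \<otimes>\<^bsub>F\<^esub> h = lprod F (map (\<lambda>c. inv\<^bsub>F\<^esub> h \<otimes>\<^bsub>F\<^esub> c \<otimes>\<^bsub>F\<^esub> h) cs)"
proof (induction cs)
  case (Cons c cs)
  have "lprod F cs \<in> carrier F" using Cons.prems by (intro F.lprod_closed) auto
  moreover have "lprod F (map (\<lambda>c. inv\<^bsub>F\<^esub> h \<otimes>\<^bsub>F\<^esub> c \<otimes>\<^bsub>F\<^esub> h) cs) = inv\<^bsub>F\<^esub> h \<otimes>\<^bsub>F\<^esub> lprod F cs \<otimes>\<^bsub>F\<^esub> h"
    using Cons by simp
  ultimately show ?case using Cons.prems h by (simp add: F.m_assoc)
qed (use h in simp)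

text \<open>Products of relator conjugates form a normal subgroup containing the relators, hence
  contain the normal closure. So the minimum in \<open>filling_area\<close> is attained on
  R.\<close>

lemma R_products:
  assumes "w \<in> R"
  obtains cs where "set cs \<subseteq> RC" "w = lprod F cs"
proof -
  define P where "P = {lprod F cs | cs. set cs \<subseteq> RC}"
  have sub: "set cs \<subseteq> RC \<Longrightarrow> set cs \<subseteq> carrier F" for cs using RC_carrier by auto
  have invP: "set cs \<subseteq> RC \<Longrightarrow> inv\<^bsub>F\<^esub> (lprod F cs) \<in> P" for cs
  proof (induction cs)
    case Nil
    then show ?case unfolding P_def using F.inv_one by (auto intro!: exI[of _ "[]"])
  next
    case (Cons c cs)
    then obtain es where es: "set es \<subseteq> RC" "inv\<^bsub>F\<^esub> (lprod F cs) = lprod F es" by (auto simp: P_def)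
    have c: "c \<in> RC" "c \<in> carrier F" using Cons.prems RC_carrier by auto
    have ics: "inv\<^bsub>F\<^esub> c \<in> carrier F" using c by simp
    have l: "lprod F cs \<in> carrier F" using Cons.prems sub by (intro F.lprod_closed) auto
    have "lprod F (es @ [inv\<^bsub>F\<^esub> c]) = lprod F es \<otimes>\<^bsub>F\<^esub> lprod F [inv\<^bsub>F\<^esub> c]"
      using es(1) sub[of es] ics by (intro F.lprod_append) auto
    then have "inv\<^bsub>F\<^esub> (lprod F (c # cs)) = lprod F (es @ [inv\<^bsub>F\<^esub> c])"
      using es(2) c l ics by (simp add: F.inv_mult_group)
    then show ?case unfolding P_def using es(1) RC_inv[OF c(1)] by (intro CollectI exI[of _ "es @ [inv\<^bsub>F\<^esub> c]"]) auto
  qed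
  have "subgroup P F"
  proof (rule F.subgroupI)
    show "P \<subseteq> carrier F" unfolding P_def using sub F.lprod_closed by auto
    show "P \<noteq> {}" unfolding P_def by (auto intro: exI[of _ "[]"])
    show "\<And>a. a \<in> P \<Longrightarrow> inv\<^bsub>F\<^esub> a \<in> P" using invP by (auto simp: P_def)
    fix a b assume "a \<in> P" "b \<in> P"
    then obtain u v where "set u \<subseteq> RC" "a = lprod F u" "set v \<subseteq> RC" "b = lprod F v" by (auto simp: P_def)
    then show "a \<otimes>\<^bsub>F\<^esub> b \<in> P" unfolding P_def using sub
      by (intro CollectI exI[of _ "u @ v"]) (auto simp: F.lprod_append)
  qed
  moreover have "x \<otimes>\<^bsub>F\<^esub> h \<otimes>\<^bsub>F\<^esub> inv\<^bsub>F\<^esub> x \<in> P" if x: "x \<in> carrier F" and h: "h \<in> P" for x h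
  proof -
    obtain cs where cs: "set cs \<subseteq> RC" "h = lprod F cs" using h by (auto simp: P_def)
    have "x \<otimes>\<^bsub>F\<^esub> h \<otimes>\<^bsub>F\<^esub> inv\<^bsub>F\<^esub> x = lprod F (map (\<lambda>c. inv\<^bsub>F\<^esub> (inv\<^bsub>F\<^esub> x) \<otimes>\<^bsub>F\<^esub> c \<otimes>\<^bsub>F\<^esub> inv\<^bsub>F\<^esub> x) cs)"
      using conj_lprod[of "inv\<^bsub>F\<^esub> x" cs] x cs sub by simp
    moreover have "set (map (\<lambda>c. inv\<^bsub>F\<^esub> (inv\<^bsub>F\<^esub> x) \<otimes>\<^bsub>F\<^esub> c \<otimes>\<^bsub>F\<^esub> inv\<^bsub>F\<^esub> x) cs) \<subseteq> RC"
      using cs RC_conj[of _ "inv\<^bsub>F\<^esub> x"] x by auto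
    ultimately show ?thesis unfolding P_def by blast
  qed
  ultimately have "P \<lhd> F" by (simp add: F.normal_inv_iff)
  moreover have "set rs \<subseteq> P"
  proof
    fix r assume r: "r \<in> set rs"
    then have "r \<in> carrier F" using rs_carrier by auto
    then have "r \<in> RC" unfolding RC_iff using r by (intro bexI[of _ "\<one>\<^bsub>F\<^esub>"] bexI[of _ r]) auto
    then show "r \<in> P" unfolding P_def using \<open>r \<in> carrier F\<close> by (intro CollectI exI[of _ "[r]"]) auto
  qed
  ultimately have "R \<subseteq> P" by (auto simp: normal_closure_def)
  then show ?thesis using assms that unfolding P_def by blast
qed

lemma fa_le: "set cs \<subseteq> RC \<Longrightarrow> fa (lprod F cs) \<le> length cs"
  unfolding filling_area_def by (rule Least_le) (auto simp: lprod_def)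

lemma fa_attained:
  assumes "w \<in> R"
  obtains cs where "set cs \<subseteq> RC" "length cs = fa w" "w = lprod F cs"
proof -
  obtain es where es: "set es \<subseteq> RC" "w = lprod F es" by (rule R_products[OF assms])
  have "\<exists>k cs. length cs = k \<and> set cs \<subseteq> RC \<and> w = foldr (\<otimes>\<^bsub>F\<^esub>) cs \<one>\<^bsub>F\<^esub>"
    using es unfolding lprod_def by blast
  from LeastI_ex[OF this] show ?thesis
    using that unfolding filling_area_def lprod_def by blast
qed

lemma fa_one [simp]: "fa [] = 0"
  using fa_le[of "[]"] by (simp add: free_one)

lemma fa_mult:
  assumes "u \<in> R" "v \<in> R"
  shows "fa (u \<otimes>\<^bsub>F\<^esub> v) \<le> fa u + fa v"
proof -
  obtain cs where cs: "set cs \<subseteq> RC" "length cs = fa u" "u = lprod F cs" by (rule fa_attained[OF assms(1)])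
  obtain es where es: "set es \<subseteq> RC" "length es = fa v" "v = lprod F es" by (rule fa_attained[OF assms(2)])
  have "set cs \<subseteq> carrier F" "set es \<subseteq> carrier F" using cs es RC_carrier by auto
  then have "u \<otimes>\<^bsub>F\<^esub> v = lprod F (cs @ es)" using cs es by (simp add: F.lprod_append)
  then show ?thesis using fa_le[of "cs @ es"] cs es by simp
qed

lemma fa_conj:
  assumes "u \<in> R" "g \<in> carrier F"
  shows "fa (inv\<^bsub>F\<^esub> g \<otimes>\<^bsub>F\<^esub> u \<otimes>\<^bsub>F\<^esub> g) \<le> fa u"
proof -
  obtain cs where cs: "set cs \<subseteq> RC" "length cs = fa u" "u = lprod F cs" by (rule fa_attained[OF assms(1)])
  have "set cs \<subseteq> carrier F" using cs RC_carrier by auto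
  then have "inv\<^bsub>F\<^esub> g \<otimes>\<^bsub>F\<^esub> u \<otimes>\<^bsub>F\<^esub> g = lprod F (map (\<lambda>c. inv\<^bsub>F\<^esub> g \<otimes>\<^bsub>F\<^esub> c \<otimes>\<^bsub>F\<^esub> g) cs)"
    using conj_lprod[OF assms(2)] cs by simp
  moreover have "set (map (\<lambda>c. inv\<^bsub>F\<^esub> g \<otimes>\<^bsub>F\<^esub> c \<otimes>\<^bsub>F\<^esub> g) cs) \<subseteq> RC" using cs RC_conj assms(2) by auto
  ultimately show ?thesis using fa_le[of "map (\<lambda>c. inv\<^bsub>F\<^esub> g \<otimes>\<^bsub>F\<^esub> c \<otimes>\<^bsub>F\<^esub> g) cs"] cs by simp
qed

lemma fa_conj': "u \<in> R \<Longrightarrow> g \<in> carrier F \<Longrightarrow> fa (g \<otimes>\<^bsub>F\<^esub> u \<otimes>\<^bsub>F\<^esub> inv\<^bsub>F\<^esub> g) \<le> fa u"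
  using fa_conj[of u "inv\<^bsub>F\<^esub> g"] by simp

lemma R_conj': "g \<in> carrier F \<Longrightarrow> x \<in> R \<Longrightarrow> g \<otimes>\<^bsub>F\<^esub> x \<otimes>\<^bsub>F\<^esub> inv\<^bsub>F\<^esub> g \<in> R"
  using R_conj[of "inv\<^bsub>F\<^esub> g" x] by simp

lemma fa_lprod:
  "set cs \<subseteq> R \<Longrightarrow> (\<And>c. c \<in> set cs \<Longrightarrow> fa c \<le> B) \<Longrightarrow> lprod F cs \<in> R \<and> fa (lprod F cs) \<le> B * length cs"
proof (induction cs)
  case Nil
  then show ?case using R_one by (simp add: free_one)
next
  case (Cons c cs)
  have "lprod F cs \<in> R" "fa (lprod F cs) \<le> B * length cs" using Cons by auto
  moreover have "c \<in> R" "fa c \<le> B" using Cons.prems by auto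
  ultimately show ?case using R_mult[of c "lprod F cs"] fa_mult[of c "lprod F cs"] by simp
qed

end

section \<open>Change of presentation\<close>

lemma presentation_hom:
  assumes G: "group G" and fp: "finite_presentation_of G d rs"
  shows "\<exists>f. f \<in> hom (free_group d) G \<and> f ` carrier (free_group d) = carrier G \<and>
    (\<forall>w\<in>carrier (free_group d). f w = \<one>\<^bsub>G\<^esub> \<longleftrightarrow> w \<in> relations d rs)"
proof -
  interpret presentation d rs using fp by unfold_locales (simp add: finite_presentation_of_def)
  interpret R: normal R F by (rule R_normal)
  interpret G: group G by fact
  obtain g where g: "g \<in> iso (F Mod R) G" using fp by (auto simp: finite_presentation_of_def is_iso_def)
  have Q: "group (F Mod R)" by (rule R.factorgroup_is_group)
  interpret g: group_hom "F Mod R" G g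
    using g Q by (simp add: group_hom_def group_hom_axioms_def iso_def G.group_axioms)
  have bij: "bij_betw g (carrier (F Mod R)) (carrier G)" using g by (simp add: iso_def)
  have c: "(\<lambda>a. R #>\<^bsub>F\<^esub> a) \<in> hom F (F Mod R)" by (rule R.r_coset_hom_Mod)
  have ci: "(\<lambda>a. R #>\<^bsub>F\<^esub> a) ` carrier F = carrier (F Mod R)"
    by (auto simp: FactGroup_def RCOSETS_def)
  define f where "f = (\<lambda>a. g (R #>\<^bsub>F\<^esub> a))"
  have "f \<in> hom F G" using hom_compose[OF c g.homh] by (simp add: f_def comp_def)
  moreover have "f ` carrier F = carrier G"
  proof -
    have "f ` carrier F = g ` ((\<lambda>a. R #>\<^bsub>F\<^esub> a) ` carrier F)" by (auto simp: f_def)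
    then show ?thesis using bij by (simp add: ci bij_betw_def)
  qed
  moreover have "f w = \<one>\<^bsub>G\<^esub> \<longleftrightarrow> w \<in> R" if w: "w \<in> carrier F" for w
  proof -
    have m: "R #>\<^bsub>F\<^esub> w \<in> carrier (F Mod R)" using ci w by blast
    have o: "\<one>\<^bsub>F Mod R\<^esub> = R" by (simp add: FactGroup_def)
    have "f w = \<one>\<^bsub>G\<^esub> \<longleftrightarrow> R #>\<^bsub>F\<^esub> w = \<one>\<^bsub>F Mod R\<^esub>"
    proof
      assume "f w = \<one>\<^bsub>G\<^esub>"
      then have "g (R #>\<^bsub>F\<^esub> w) = g \<one>\<^bsub>F Mod R\<^esub>" using g.hom_one by (simp only: f_def)
      then show "R #>\<^bsub>F\<^esub> w = \<one>\<^bsub>F Mod R\<^esub>"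
        using bij m g.G.one_closed by (meson bij_betw_def inj_onD)
    next
      assume "R #>\<^bsub>F\<^esub> w = \<one>\<^bsub>F Mod R\<^esub>"
      then show "f w = \<one>\<^bsub>G\<^esub>" using g.hom_one by (simp only: f_def)
    qed
    also have "\<dots> \<longleftrightarrow> w \<in> R" using F.coset_join1[OF _ w R_subgroup] F.coset_join2[OF w R_subgroup] o by auto
    finally show ?thesis .
  qed
  ultimately show ?thesis by blast
qed

text \<open>The sum T of the finitely many values below the threshold of the O-bound makes it
  uniform in n, and 1 + n keeps the right side positive at n = 0.\<close>

lemma dehn_bound:
  assumes "set rs \<subseteq> carrier (free_group d)" "k \<ge> 0"
    and O: "(\<lambda>n. real (dehn_function d rs n)) \<in> O(\<lambda>n. real n powr k)"
  shows "\<exists>C\<ge>0. \<forall>n. \<forall>w\<in>relations d rs \<inter> word_ball d n. real (filling_area d rs w) \<le> C * (1 + real n) powr k"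
proof -
  obtain c where c: "c > 0" "eventually (\<lambda>n. norm (real (dehn_function d rs n)) \<le> c * norm (real n powr k)) at_top"
    using O by (auto elim: landau_o.bigE)
  then obtain N where N: "\<And>n. n \<ge> N \<Longrightarrow> real (dehn_function d rs n) \<le> c * real n powr k"
    by (auto simp: eventually_at_top_linorder)
  define T where "T = (\<Sum>i<N. real (dehn_function d rs i))"
  have T: "T \<ge> 0" unfolding T_def by (intro sum_nonneg) auto
  have dehn: "real (dehn_function d rs n) \<le> (c + T) * (1 + real n) powr k" for n
  proof (cases "n \<ge> N")
    case True
    have "real n powr k \<le> (1 + real n) powr k" using assms(2) by (intro powr_mono2) auto
    then have "c * real n powr k \<le> (c + T) * (1 + real n) powr k" using c T by (intro mult_mono) auto
    then show ?thesis using N[OF True] by linarith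
  next
    case False
    have "real (dehn_function d rs n) \<le> T" unfolding T_def
      using False by (intro member_le_sum[of n "{..<N}" "\<lambda>i. real (dehn_function d rs i)"]) auto
    also have "\<dots> \<le> (c + T) * 1" using c by simp
    also have "\<dots> \<le> (c + T) * (1 + real n) powr k"
      using c T assms(2) by (intro mult_left_mono ge_one_powr_ge_zero) auto
    finally show ?thesis .
  qed
  have "real (filling_area d rs w) \<le> (c + T) * (1 + real n) powr k" if w: "w \<in> relations d rs \<inter> word_ball d n" for n w
  proof -
    have "filling_area d rs w \<le> dehn_function d rs n"
      unfolding dehn_function_def using w finite_word_ball[of d n] by (intro Max_ge) auto
    then show ?thesis using dehn[of n] by linarith
  qed
  then show ?thesis using c T by (intro exI[of _ "c + T"]) auto
qed

text \<open>Lift the identity of G to homomorphisms a and b between the free groups and compare w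
  with b (a w). The comparison costs a constant per letter, which k \<ge> 1 absorbs, and a filling
  of a w is pushed forward by b relator by relator.\<close>

lemma area_change_of_presentation:
  assumes G: "group G" and fp0: "finite_presentation_of G d\<^sub>0 rs\<^sub>0" and fp: "finite_presentation_of G d rs"
    and k: "k \<ge> 1"
    and bound: "\<And>n w. w \<in> relations d\<^sub>0 rs\<^sub>0 \<inter> word_ball d\<^sub>0 n \<Longrightarrow> real (filling_area d\<^sub>0 rs\<^sub>0 w) \<le> C * (1 + real n) powr k"
    and C: "C \<ge> 0"
  shows "\<exists>A\<ge>0. \<forall>n. \<forall>w\<in>relations d rs \<inter> word_ball d n. real (filling_area d rs w) \<le> A * (1 + real n) powr k"
proof -
  interpret P: presentation d rs using fp by unfold_locales (simp add: finite_presentation_of_def)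
  interpret P0: presentation d\<^sub>0 rs\<^sub>0 using fp0 by unfold_locales (simp add: finite_presentation_of_def)
  obtain f where f: "f \<in> hom P.F G" "f ` carrier P.F = carrier G"
    "\<And>w. w \<in> carrier P.F \<Longrightarrow> f w = \<one>\<^bsub>G\<^esub> \<longleftrightarrow> w \<in> P.R"
    using presentation_hom[OF G fp] by blast
  obtain g where g: "g \<in> hom P0.F G" "g ` carrier P0.F = carrier G"
    "\<And>w. w \<in> carrier P0.F \<Longrightarrow> g w = \<one>\<^bsub>G\<^esub> \<longleftrightarrow> w \<in> P0.R"
    using presentation_hom[OF G fp0] by blast
  obtain a where a: "a \<in> hom P.F P0.F" "\<And>w. w \<in> carrier P.F \<Longrightarrow> g (a w) = f w"
    using free_lift[OF G f(1) g(1,2)] by blast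
  obtain b where b: "b \<in> hom P0.F P.F" "\<And>w. w \<in> carrier P0.F \<Longrightarrow> f (b w) = g w"
    using free_lift[OF G g(1) f(1,2)] by blast
  interpret a: group_hom P.F P0.F a by unfold_locales (rule a(1))
  interpret b: group_hom P0.F P.F b by unfold_locales (rule b(1))
  interpret f: group_hom P.F G f using G f(1) by (simp add: group_hom_def group_hom_axioms_def group_free_group)
  have aR: "a w \<in> P0.R" if "w \<in> P.R" for w
    using that g(3)[of "a w"] a(2)[of w] f(3)[of w] P.R_carrier a.hom_closed by simp
  have bR: "b w \<in> P.R" if "w \<in> P0.R" for w
    using that f(3)[of "b w"] b(2)[of w] g(3)[of w] P0.R_carrier b.hom_closed by simp
  obtain L where L: "\<And>n w. w \<in> word_ball d n \<Longrightarrow> a w \<in> word_ball d\<^sub>0 (L * n)"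
    using hom_word_ball[OF a(1)] by blast
  define B where "B = (\<Sum>r\<in>set rs\<^sub>0. P.fa (b r) + P.fa (b (inv\<^bsub>P0.F\<^esub> r)))"
  have Br: "P.fa (b r) \<le> B" "P.fa (b (inv\<^bsub>P0.F\<^esub> r)) \<le> B" if "r \<in> set rs\<^sub>0" for r
  proof -
    have "P.fa (b r) + P.fa (b (inv\<^bsub>P0.F\<^esub> r)) \<le> B" unfolding B_def
      using that by (intro member_le_sum[of r "set rs\<^sub>0" "\<lambda>r. P.fa (b r) + P.fa (b (inv\<^bsub>P0.F\<^esub> r))"]) auto
    then show "P.fa (b r) \<le> B" "P.fa (b (inv\<^bsub>P0.F\<^esub> r)) \<le> B" by auto
  qed
  have Bc: "P.fa (b c) \<le> B" if c: "c \<in> P0.RC" for c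
  proof -
    obtain h r where *: "h \<in> carrier P0.F" "r \<in> set rs\<^sub>0"
      "c = inv\<^bsub>P0.F\<^esub> h \<otimes>\<^bsub>P0.F\<^esub> r \<otimes>\<^bsub>P0.F\<^esub> h \<or> c = inv\<^bsub>P0.F\<^esub> h \<otimes>\<^bsub>P0.F\<^esub> inv\<^bsub>P0.F\<^esub> r \<otimes>\<^bsub>P0.F\<^esub> h"
      using c unfolding P0.RC_iff by blast
    have r: "r \<in> P0.R" "r \<in> carrier P0.F" using *(2) P0.rs_R P0.rs_carrier by auto
    have ir: "inv\<^bsub>P0.F\<^esub> r \<in> P0.R" using r(1) by (rule subgroup.m_inv_closed[OF P0.R_subgroup])
    have bh: "b h \<in> carrier P.F" using *(1) by simp
    from *(3) show ?thesis
    proof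
      assume "c = inv\<^bsub>P0.F\<^esub> h \<otimes>\<^bsub>P0.F\<^esub> r \<otimes>\<^bsub>P0.F\<^esub> h"
      then have "b c = inv\<^bsub>P.F\<^esub> (b h) \<otimes>\<^bsub>P.F\<^esub> b r \<otimes>\<^bsub>P.F\<^esub> b h" using * r by simp
      then show ?thesis using P.fa_conj[OF bR[OF r(1)] bh] Br(1)[OF *(2)] by simp
    next
      assume "c = inv\<^bsub>P0.F\<^esub> h \<otimes>\<^bsub>P0.F\<^esub> inv\<^bsub>P0.F\<^esub> r \<otimes>\<^bsub>P0.F\<^esub> h"
      then have "b c = inv\<^bsub>P.F\<^esub> (b h) \<otimes>\<^bsub>P.F\<^esub> b (inv\<^bsub>P0.F\<^esub> r) \<otimes>\<^bsub>P.F\<^esub> b h"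
        using * r by (simp del: b.hom_inv) simp
      then show ?thesis using P.fa_conj[OF bR[OF ir] bh] Br(2)[OF *(2)] by simp
    qed
  qed
  have fab: "P.fa (b z) \<le> B * P0.fa z" if z: "z \<in> P0.R" for z
  proof -
    obtain cs where cs: "set cs \<subseteq> P0.RC" "length cs = P0.fa z" "z = lprod P0.F cs" by (rule P0.fa_attained[OF z])
    have csc: "set cs \<subseteq> carrier P0.F" using cs P0.RC_carrier by auto
    have "b z = lprod P.F (map b cs)" using hom_lprod[OF b(1) group_free_group group_free_group csc] cs by simp
    moreover have "set (map b cs) \<subseteq> P.R" using cs P0.RC_R bR by auto
    moreover have "\<And>c. c \<in> set (map b cs) \<Longrightarrow> P.fa c \<le> B" using cs Bc by auto
    ultimately show ?thesis using P.fa_lprod[of "map b cs" B] cs by simp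
  qed
  \<comment> \<open>The discrepancy between w and b (a w), an element of R. As e (x w) is a
    conjugate of e w times e x, its area grows at most linearly.\<close>
  define e where "e = (\<lambda>w. w \<otimes>\<^bsub>P.F\<^esub> inv\<^bsub>P.F\<^esub> (b (a w)))"
  have eR: "e w \<in> P.R" if w: "w \<in> carrier P.F" for w
  proof -
    have bc: "b (a w) \<in> carrier P.F" using w by simp
    have "f (e w) = f w \<otimes>\<^bsub>G\<^esub> inv\<^bsub>G\<^esub> (f (b (a w)))" unfolding e_def using w bc by simp
    also have "f (b (a w)) = f w" using w a(2)[of w] b(2)[of "a w"] by simp
    finally have "f (e w) = \<one>\<^bsub>G\<^esub>" using w by simp
    moreover have "e w \<in> carrier P.F" using w by (simp add: e_def)
    ultimately show ?thesis using f(3) by simp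
  qed
  define E where "E = (\<Sum>x\<in>letters d. P.fa (e [x]))"
  have E: "P.fa (e [x]) \<le> E" if "x \<in> letters d" for x
    unfolding E_def using that by (intro member_le_sum) (auto simp: finite_letters)
  have eE: "set u \<subseteq> letters d \<Longrightarrow> P.fa (e (word_value d u)) \<le> E * length u" for u
  proof (induction u)
    case Nil
    have "e [] = \<one>\<^bsub>P.F\<^esub>" using a.hom_one b.hom_one P.F.inv_one by (simp add: e_def free_one free_mult)
    then show ?case by (simp add: free_one)
  next
    case (Cons x u)
    define w where "w = word_value d u"
    have x: "[x] \<in> carrier P.F" and w: "w \<in> carrier P.F" using Cons.prems by (auto simp: w_def letter_carrier word_value_closed)
    have "e ([x] \<otimes>\<^bsub>P.F\<^esub> w) = ([x] \<otimes>\<^bsub>P.F\<^esub> e w \<otimes>\<^bsub>P.F\<^esub> inv\<^bsub>P.F\<^esub> [x]) \<otimes>\<^bsub>P.F\<^esub> e [x]"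
      unfolding e_def using x w by (simp add: P.F.m_assoc P.F.inv_mult_group)
    then have "P.fa (e ([x] \<otimes>\<^bsub>P.F\<^esub> w)) \<le> P.fa ([x] \<otimes>\<^bsub>P.F\<^esub> e w \<otimes>\<^bsub>P.F\<^esub> inv\<^bsub>P.F\<^esub> [x]) + P.fa (e [x])"
      using P.fa_mult[OF P.R_conj'[OF x eR[OF w]] eR[OF x]] by simp
    also have "\<dots> \<le> P.fa (e w) + E"
      using P.fa_conj'[OF eR[OF w] x] E[of x] Cons.prems by (intro add_mono) auto
    finally show ?case using Cons by (simp add: w_def)
  qed
  have kp: "(1 + real (L * n)) powr k \<le> (1 + real L) powr k * (1 + real n) powr k" for n
  proof -
    have "(1 + real (L * n)) powr k \<le> ((1 + real L) * (1 + real n)) powr k"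
      using k by (intro powr_mono2) (auto simp: algebra_simps)
    then show ?thesis by (simp add: powr_mult)
  qed
  define A where "A = real E + real B * C * (1 + real L) powr k"
  have "real (P.fa w) \<le> A * (1 + real n) powr k" if w: "w \<in> P.R \<inter> word_ball d n" for n w
  proof -
    obtain u where u: "set u \<subseteq> letters d" "length u \<le> n" "w = word_value d u"
      using w unfolding word_ball_iff Int_iff by blast
    have wR: "w \<in> P.R" "w \<in> carrier P.F" using w P.R_carrier by auto
    have "w = e w \<otimes>\<^bsub>P.F\<^esub> b (a w)" unfolding e_def using wR by (simp add: P.F.m_assoc)
    then have "P.fa w \<le> P.fa (e w) + P.fa (b (a w))"
      using P.fa_mult[OF eR[OF wR(2)] bR[OF aR[OF wR(1)]]] by simp
    also have "P.fa (e w) \<le> E * n" using order_trans[OF eE[OF u(1)] mult_le_mono2[OF u(2)]] u(3) by simp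
    also have "P.fa (b (a w)) \<le> B * P0.fa (a w)" by (rule fab[OF aR[OF wR(1)]])
    finally have "real (P.fa w) \<le> real E * real n + real B * real (P0.fa (a w))"
      by (simp flip: of_nat_mult of_nat_add)
    note 1 = this
    have "real (P0.fa (a w)) \<le> C * (1 + real (L * n)) powr k"
      using bound[of "a w" "L * n"] aR[OF wR(1)] L[of w n] w by simp
    also have "\<dots> \<le> C * ((1 + real L) powr k * (1 + real n) powr k)" using kp C by (intro mult_left_mono) auto
    finally have 2: "real B * real (P0.fa (a w)) \<le> real B * (C * ((1 + real L) powr k * (1 + real n) powr k))"
      by (intro mult_left_mono) auto
    have "real n \<le> (1 + real n) powr k"
      using powr_mono[of 1 k "1 + real n"] k by simp
    then have "real E * real n \<le> real E * (1 + real n) powr k" by (intro mult_left_mono) auto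
    with 1 2 have "real (P.fa w) \<le> real E * (1 + real n) powr k + real B * (C * ((1 + real L) powr k * (1 + real n) powr k))"
      by linarith
    then show ?thesis by (simp add: A_def algebra_simps)
  qed
  then show ?thesis using C by (intro exI[of _ A]) (auto simp: A_def)
qed

section \<open>Dyadic filling of loops\<close>

lemma powr_sum_le: "a \<ge> 0 \<Longrightarrow> b \<ge> 0 \<Longrightarrow> k \<ge> 0 \<Longrightarrow> (a + b) powr k \<le> 2 powr k * (a powr k + b powr (k::real))"
proof -
  assume ab: "a \<ge> 0" "b \<ge> 0" "k \<ge> 0"
  have "(a + b) powr k \<le> (2 * max a b) powr k" using ab by (intro powr_mono2) auto
  also have "\<dots> = 2 powr k * (max a b) powr k" by (simp add: powr_mult)
  also have "(max a b) powr k \<le> a powr k + b powr k" by (simp add: max_def)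
  finally show ?thesis by simp
qed

text \<open>The extreme case is m = 3, with halves 1 and 2.\<close>

lemma halves_le: "m \<ge> 2 \<Longrightarrow> real (m div 2) \<le> 2 / 3 * real m \<and> real (m - m div 2) \<le> 2 / 3 * real m"
proof -
  assume "m \<ge> 2"
  then have "3 * (m div 2) \<le> 2 * m" "3 * (m - m div 2) \<le> 2 * m" by linarith+
  then have "real (3 * (m div 2)) \<le> real (2 * m)" "real (3 * (m - m div 2)) \<le> real (2 * m)"
    by (simp_all only: of_nat_le_iff)
  then show ?thesis by simp
qed

text \<open>From i^b = i i^(b-1), two parts of size at most 2 m / 3 contribute at most t m^b with t
  = (2/3)^(b-1) < 1. The gap M (1 - t) \<ge> B pays for the new term.\<close>

lemma halving_recursion_powr:
  assumes b: "b > (1::real)" and B: "B \<ge> 0" and D1: "D1 \<ge> 0"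
  shows "\<exists>M\<ge>D1. \<forall>m\<ge>2. M * real (m div 2) powr b + M * real (m - m div 2) powr b + B * real m powr b \<le> M * real m powr b"
proof -
  define t where "t = (2 / 3 :: real) powr (b - 1)"
  have t: "t < 1" "t > 0" using b powr_less_mono2[of "b - 1" "2 / 3" 1] by (auto simp: t_def)
  define M where "M = max D1 (B / (1 - t))"
  have "B / (1 - t) \<le> M" by (simp add: M_def)
  then have M: "B \<le> M * (1 - t)" "M \<ge> 0" using t D1 by (simp_all add: pos_divide_le_eq) (simp add: M_def)
  have "M * real (m div 2) powr b + M * real (m - m div 2) powr b + B * real m powr b \<le> M * real m powr b"
    if m: "m \<ge> 2" for m
  proof -
    have *: "real i powr b \<le> real i * (t * real m powr (b - 1))" if i: "real i \<le> 2 / 3 * real m" for i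
    proof -
      have "real i powr b = real i * real i powr (b - 1)"
        by (simp add: powr_mult_base)
      also have "real i powr (b - 1) \<le> (2 / 3 * real m) powr (b - 1)" using i b by (intro powr_mono2) auto
      also have "\<dots> = t * real m powr (b - 1)" by (simp only: t_def powr_mult)
      finally show ?thesis by (simp add: mult_left_mono)
    qed
    have "real (m div 2) powr b + real (m - m div 2) powr b \<le>
        real (m div 2) * (t * real m powr (b - 1)) + real (m - m div 2) * (t * real m powr (b - 1))"
      by (intro add_mono * halves_le[OF m, THEN conjunct1] halves_le[OF m, THEN conjunct2])
    also have "\<dots> = (real (m div 2) + real (m - m div 2)) * (t * real m powr (b - 1))" by (simp only: distrib_right)
    also have "real (m div 2) + real (m - m div 2) = real m" by (simp flip: of_nat_add)
    also have "real m * (t * real m powr (b - 1)) = t * real m powr b"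
      using m by (simp add: powr_diff)
    finally have "M * (real (m div 2) powr b + real (m - m div 2) powr b) \<le> M * (t * real m powr b)"
      using M by (intro mult_left_mono) auto
    moreover have "B * real m powr b \<le> M * (1 - t) * real m powr b" using M by (intro mult_right_mono) auto
    ultimately show ?thesis by (simp add: algebra_simps)
  qed
  then show ?thesis by (intro exI[of _ M]) (auto simp: M_def)
qed

text \<open>At the critical exponent nothing is lost in the sum of the sizes; the gain is ln i \<le>
  ln m - ln (3/2) for both halves, worth B m after division by ln (3/2).\<close>

lemma halving_recursion_ln:
  assumes B: "B \<ge> 0" and m: "m \<ge> 2"
  defines "h \<equiv> (\<lambda>m::nat. B / ln (3 / 2) * (real m * ln (real m)))"
  shows "h (m div 2) + h (m - m div 2) + B * real m \<le> h m"
proof -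
  have l: "ln (3 / 2 :: real) > 0" by simp
  have *: "real i * ln (real i) \<le> real i * (ln (real m) - ln (3 / 2))" if i: "real i \<le> 2 / 3 * real m" for i
  proof (cases "i = 0")
    case False
    have "ln (real i) \<le> ln (2 / 3 * real m)" using i False by simp
    also have "\<dots> = ln (real m / (3 / 2))" by (simp add: field_simps)
    also have "\<dots> = ln (real m) - ln (3 / 2)" using m by (subst ln_div) auto
    finally show ?thesis by (intro mult_left_mono) auto
  qed simp
  have "real (m div 2) * ln (real (m div 2)) + real (m - m div 2) * ln (real (m - m div 2)) \<le>
      real (m div 2) * (ln (real m) - ln (3 / 2)) + real (m - m div 2) * (ln (real m) - ln (3 / 2))"
    by (intro add_mono * halves_le[OF m, THEN conjunct1] halves_le[OF m, THEN conjunct2])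
  also have "\<dots> = (real (m div 2) + real (m - m div 2)) * (ln (real m) - ln (3 / 2))" by (simp only: distrib_right)
  also have "real (m div 2) + real (m - m div 2) = real m" by (simp flip: of_nat_add)
  finally have "B / ln (3 / 2) * (real (m div 2) * ln (real (m div 2)) + real (m - m div 2) * ln (real (m - m div 2))) \<le>
      B / ln (3 / 2) * (real m * (ln (real m) - ln (3 / 2)))"
    using B l by (intro mult_left_mono) auto
  also have "\<dots> = h m - B * real m" using l by (simp add: h_def field_simps)
  finally have "B / ln (3 / 2) * (real (m div 2) * ln (real (m div 2)) + real (m - m div 2) * ln (real (m - m div 2))) \<le>
      h m - B * real m" .
  then have "h (m div 2) + h (m - m div 2) \<le> h m - B * real m" by (simp only: h_def distrib_left)
  then show ?thesis by linarith
qed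

lemma lazy_value_lprod:
  "lazy_value d a = lprod (free_group d) (map (\<lambda>t. case t of None \<Rightarrow> \<one>\<^bsub>free_group d\<^esub> | Some x \<Rightarrow> [x]) a)"
  by (simp add: lazy_value_def lprod_def)

section \<open>The recursion for the lazy loops of a presentation\<close>

locale nilpotent_presentation = presentation d rs for d rs +
  fixes G :: "('a, 'b) monoid_scheme" and f :: "letter list \<Rightarrow> 'a" and k A :: real and c :: nat
  assumes G: "group G" and f_hom: "f \<in> hom F G" and f_surj: "f ` carrier F = carrier G"
    and f_ker: "w \<in> carrier F \<Longrightarrow> f w = \<one>\<^bsub>G\<^esub> \<longleftrightarrow> w \<in> R"
    and k: "k \<ge> 2" and A: "A \<ge> 0"
    and area: "w \<in> R \<inter> word_ball d n \<Longrightarrow> real (fa w) \<le> A * (1 + real n) powr k"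
    and nilp: "lower_central G c = {\<one>\<^bsub>G\<^esub>}"
begin

definition S :: "letter option set" where "S = insert None (Some ` letters d)"

definition st :: "letter option \<Rightarrow> 'a" where
  "st t = (case t of None \<Rightarrow> \<one>\<^bsub>G\<^esub> | Some x \<Rightarrow> f [x])"

sublocale G: group G by (rule G)

sublocale fh: group_hom F G f by unfold_locales (rule f_hom)

lemma f_letter: "x \<in> letters d \<Longrightarrow> f [x] \<in> carrier G"
  by (rule fh.hom_closed[OF letter_carrier])

lemma st_inv: "x \<in> letters d \<Longrightarrow> f [inv_letter x] = inv\<^bsub>G\<^esub> (f [x])"
  using fh.hom_inv[OF letter_carrier, of x] by (simp add: free_inv_letter)

sublocale N: sym_gen_nilpotent_group G "st ` S" c
proof unfold_locales
  show "finite (st ` S)" by (simp add: S_def finite_letters)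
  show "st ` S \<subseteq> carrier G" by (auto simp: S_def st_def f_letter)
  show "lower_central G c = {\<one>\<^bsub>G\<^esub>}" by (rule nilp)
  show "inv\<^bsub>G\<^esub> x \<in> st ` S" if "x \<in> st ` S" for x
  proof -
    from that consider "x = \<one>\<^bsub>G\<^esub>" | y where "y \<in> letters d" "x = f [y]" by (auto simp: S_def st_def)
    then show ?thesis
    proof cases
      case 1
      then show ?thesis by (intro image_eqI[of _ _ None]) (auto simp: S_def st_def)
    next
      case 2
      then show ?thesis by (intro image_eqI[of _ _ "Some (inv_letter y)"]) (auto simp: S_def st_def st_inv)
    qed
  qed
  show "\<exists>xs. set xs \<subseteq> st ` S \<and> lprod G xs = x" if x: "x \<in> carrier G" for x
  proof -
    from x have "x \<in> f ` carrier F" by (simp only: f_surj)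
    then obtain w where w: "w \<in> carrier F" "f w = x" by (elim imageE) simp
    have sw: "set w \<subseteq> letters d" using w by (simp add: free_carrier)
    have "lprod G (map (\<lambda>y. f [y]) w) = x"
      using hom_word_value[OF f_hom G sw] w by (simp add: word_value_id)
    moreover have "set (map (\<lambda>y. f [y]) w) \<subseteq> st ` S"
    proof -
      have "f [y] \<in> st ` S" if "y \<in> letters d" for y
        using that by (intro image_eqI[of _ _ "Some y"]) (auto simp: S_def st_def)
      then show ?thesis using sw by auto
    qed
    ultimately show ?thesis by blast
  qed
qed

definition iv :: "letter option \<Rightarrow> letter option" where "iv = map_option inv_letter"

lemma lazy_walk: "\<exists>D. lazy_walk G (st ` S) S st iv None D"
proof -
  obtain D where D: "\<And>t. t \<ge> 0 \<Longrightarrow> N.vol (2 * t) \<le> D * N.vol t" using N.vol_doubling by blast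
  have "lazy_walk G (st ` S) S st iv None D"
  proof unfold_locales
    show "finite S" by (simp add: S_def finite_letters)
    show "None \<in> S" "st None = \<one>\<^bsub>G\<^esub>" by (simp_all add: S_def st_def)
    fix s assume "s \<in> S"
    then show "iv s \<in> S" "iv (iv s) = s" "st (iv s) = inv\<^bsub>G\<^esub> st s"
      by (auto simp: S_def iv_def st_def st_inv)
  qed (simp_all add: D)
  then show ?thesis by blast
qed

lemma lazy_carrier: "set a \<subseteq> S \<Longrightarrow> lazy_value d a \<in> carrier F"
  unfolding lazy_value_lprod by (intro F.lprod_closed) (auto simp: S_def letter_carrier split: option.splits)


lemma f_lazy: "set a \<subseteq> S \<Longrightarrow> f (lazy_value d a) = lprod G (map st a)"
proof -
  assume a: "set a \<subseteq> S"
  let ?g = "\<lambda>t. case t of None \<Rightarrow> \<one>\<^bsub>F\<^esub> | Some x \<Rightarrow> [x]"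
  have "set (map ?g a) \<subseteq> carrier F" using a by (auto simp: S_def letter_carrier)
  then have "f (lazy_value d a) = lprod G (map f (map ?g a))"
    unfolding lazy_value_lprod by (rule hom_lprod[OF f_hom group_free_group G])
  also have "map f (map ?g a) = map st a" by (auto simp: st_def split: option.splits)
  finally show ?thesis .
qed

lemma lazy_append:
  assumes "set a \<subseteq> S" "set b \<subseteq> S"
  shows "lazy_value d (a @ b) = lazy_value d a \<otimes>\<^bsub>F\<^esub> lazy_value d b"
  unfolding lazy_value_lprod map_append
  using assms by (intro F.lprod_append) (auto simp: S_def letter_carrier)

lemma short_word:
  "set es \<subseteq> st ` S \<Longrightarrow> \<exists>w. set w \<subseteq> letters d \<and> length w \<le> length es \<and> f (word_value d w) = lprod G es"
proof (induction es)
  case Nil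
  then show ?case using fh.hom_one by (intro exI[of _ "[]"]) (simp add: free_one)
next
  case (Cons e es)
  then obtain w where w: "set w \<subseteq> letters d" "length w \<le> length es" "f (word_value d w) = lprod G es" by auto
  have wc: "word_value d w \<in> carrier F" by (rule word_value_closed[OF w(1)])
  from Cons.prems consider "e = \<one>\<^bsub>G\<^esub>" | x where "x \<in> letters d" "e = f [x]" by (auto simp: S_def st_def)
  then show ?case
  proof cases
    case 1
    have "lprod G es \<in> carrier G" using w(3) wc fh.hom_closed by metis
    then show ?thesis using w 1 by (intro exI[of _ w]) auto
  next
    case 2
    then show ?thesis using w wc by (intro exI[of _ "x # w"]) (auto simp: letter_carrier)
  qed
qed

text \<open>One choice for each group element, so that a side shared by two pieces of a filling is
  the same word in both and cancels.\<close>

definition geo :: "'a \<Rightarrow> letter list" where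
  "geo x = (SOME w. w \<in> word_ball d (N.len x) \<and> f w = x)"

lemma geo: "x \<in> carrier G \<Longrightarrow> geo x \<in> word_ball d (N.len x) \<and> f (geo x) = x"
proof -
  assume x: "x \<in> carrier G"
  obtain es where es: "set es \<subseteq> st ` S" "length es = N.len x" "lprod G es = x" by (rule N.len_attained[OF x])
  obtain w where "set w \<subseteq> letters d" "length w \<le> length es" "f (word_value d w) = lprod G es"
    using short_word[OF es(1)] by blast
  then have "\<exists>w. w \<in> word_ball d (N.len x) \<and> f w = x" using es unfolding word_ball_iff by auto
  then show ?thesis unfolding geo_def by (rule someI_ex)
qed

lemma geo_carrier: "x \<in> carrier G \<Longrightarrow> geo x \<in> carrier F"
  using geo word_ball_carrier by blast

text \<open>Closing a complete loop therefore adds no side, and \<open>loop_of\<close> returns its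
  value.\<close>

lemma geo_one: "geo \<one>\<^bsub>G\<^esub> = []"
  using geo[OF G.one_closed] by (auto simp: word_ball_iff)

definition lazy_elem :: "letter option list \<Rightarrow> 'a" where "lazy_elem a = lprod G (map st a)"

lemma lazy_elem_closed: "set a \<subseteq> S \<Longrightarrow> lazy_elem a \<in> carrier G"
  using f_lazy[of a] lazy_carrier[of a] fh.hom_closed by (metis lazy_elem_def)

lemma lazy_elem_append: "set a \<subseteq> S \<Longrightarrow> set b \<subseteq> S \<Longrightarrow> lazy_elem (a @ b) = lazy_elem a \<otimes>\<^bsub>G\<^esub> lazy_elem b"
  using f_lazy[of "a @ b"] f_lazy[of a] f_lazy[of b] lazy_carrier[of a] lazy_carrier[of b]
  by (simp add: lazy_append lazy_elem_def)

definition loop_of :: "letter option list \<Rightarrow> letter list" where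
  "loop_of v = lazy_value d v \<otimes>\<^bsub>F\<^esub> inv\<^bsub>F\<^esub> (geo (lazy_elem v))"

lemma loop_of_R: "set v \<subseteq> S \<Longrightarrow> loop_of v \<in> R"
proof -
  assume v: "set v \<subseteq> S"
  have c: "lazy_value d v \<in> carrier F" "geo (lazy_elem v) \<in> carrier F"
    using lazy_carrier[OF v] geo_carrier[OF lazy_elem_closed[OF v]] by auto
  then have "f (loop_of v) = lazy_elem v \<otimes>\<^bsub>G\<^esub> inv\<^bsub>G\<^esub> (lazy_elem v)"
    using f_lazy[OF v] geo[OF lazy_elem_closed[OF v]] by (simp add: loop_of_def lazy_elem_def)
  then have "f (loop_of v) = \<one>\<^bsub>G\<^esub>" using lazy_elem_closed[OF v] by simp
  moreover have "loop_of v \<in> carrier F" using c by (simp add: loop_of_def)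
  ultimately show ?thesis using f_ker by simp
qed

text \<open>Splitting a word in two and closing both halves by geodesics leaves a geodesic triangle.\<close>

lemma fa_loop_append:
  assumes u: "set u \<subseteq> S" and v: "set v \<subseteq> S"
  shows "real (fa (loop_of (u @ v))) \<le> real (fa (loop_of u)) + real (fa (loop_of v)) +
    A * 4 powr k * ((1 + real (N.len (lazy_elem u))) powr k + (1 + real (N.len (lazy_elem v))) powr k)"
proof -
  define x y where "x = lazy_elem u" and "y = lazy_elem v"
  have xy: "x \<in> carrier G" "y \<in> carrier G" using lazy_elem_closed u v by (auto simp: x_def y_def)
  define a b where "a = lazy_value d u" and "b = lazy_value d v"
  have ab: "a \<in> carrier F" "b \<in> carrier F" using lazy_carrier u v by (auto simp: a_def b_def)
  define g h l where "g = geo x" and "h = geo y" and "l = geo (x \<otimes>\<^bsub>G\<^esub> y)"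
  have ghl: "g \<in> carrier F" "h \<in> carrier F" "l \<in> carrier F" using geo_carrier xy by (auto simp: g_def h_def l_def)
  define T where "T = g \<otimes>\<^bsub>F\<^esub> h \<otimes>\<^bsub>F\<^esub> inv\<^bsub>F\<^esub> l"
  have fT: "f T = \<one>\<^bsub>G\<^esub>"
    using ghl geo[OF xy(1)] geo[OF xy(2)] geo[of "x \<otimes>\<^bsub>G\<^esub> y"] xy by (simp add: T_def g_def h_def l_def)
  have Tc: "T \<in> carrier F" using ghl by (simp add: T_def)
  have TR: "T \<in> R" using fT f_ker[OF Tc] by simp
  \<comment> \<open>The third side is charged to the other two, so no moment of the longer segment
    is required.\<close>
  have lxy: "N.len (x \<otimes>\<^bsub>G\<^esub> y) \<le> N.len x + N.len y" by (rule N.len_mult[OF xy])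
  have "T \<in> word_ball d (N.len x + N.len y + N.len (x \<otimes>\<^bsub>G\<^esub> y))"
    unfolding T_def g_def h_def l_def using geo xy by (intro word_ball_mult word_ball_inv) auto
  then have Tb: "T \<in> word_ball d (2 * (N.len x + N.len y))"
    using word_ball_mono[of "N.len x + N.len y + N.len (x \<otimes>\<^bsub>G\<^esub> y)" "2 * (N.len x + N.len y)" d] lxy by auto
  have "real (fa T) \<le> A * (1 + real (2 * (N.len x + N.len y))) powr k" using TR Tb by (intro area) auto
  \<comment> \<open>One factor 2^k stems from the perimeter, at most twice the two short sides, the
    other from \<open>powr_sum_le\<close>; together they are 4^k.\<close>
  also have "(1 + real (2 * (N.len x + N.len y))) powr k \<le> (2 * ((1 + real (N.len x)) + (1 + real (N.len y)))) powr k"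
    using k by (intro powr_mono2) auto
  also have "\<dots> = 2 powr k * ((1 + real (N.len x)) + (1 + real (N.len y))) powr k" by (rule powr_mult)
  also have "((1 + real (N.len x)) + (1 + real (N.len y))) powr k \<le>
      2 powr k * ((1 + real (N.len x)) powr k + (1 + real (N.len y)) powr k)"
    using k by (intro powr_sum_le) auto
  finally have "real (fa T) \<le> A * (2 powr k * (2 powr k * ((1 + real (N.len x)) powr k + (1 + real (N.len y)) powr k)))"
    using A by (simp add: mult_left_mono)
  also have "2 powr k * (2 powr k * ((1 + real (N.len x)) powr k + (1 + real (N.len y)) powr k)) =
      4 powr k * ((1 + real (N.len x)) powr k + (1 + real (N.len y)) powr k)"
    using powr_mult[of 2 2 k] by simp
  finally have faT: "real (fa T) \<le> A * 4 powr k * ((1 + real (N.len x)) powr k + (1 + real (N.len y)) powr k)"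
    by (simp add: mult.assoc)
  have lu: "loop_of u = a \<otimes>\<^bsub>F\<^esub> inv\<^bsub>F\<^esub> g" and lv: "loop_of v = b \<otimes>\<^bsub>F\<^esub> inv\<^bsub>F\<^esub> h"
    by (simp_all add: loop_of_def a_def b_def g_def h_def x_def y_def)
  have "loop_of (u @ v) = a \<otimes>\<^bsub>F\<^esub> b \<otimes>\<^bsub>F\<^esub> inv\<^bsub>F\<^esub> l"
    using lazy_append[OF u v] lazy_elem_append[OF u v] by (simp add: loop_of_def a_def b_def l_def x_def y_def)
  \<comment> \<open>The loop of v is carried along the side g by conjugation, which does not
    increase its area; T is the triangle between the sides.\<close>
  also have "\<dots> = loop_of u \<otimes>\<^bsub>F\<^esub> ((g \<otimes>\<^bsub>F\<^esub> loop_of v \<otimes>\<^bsub>F\<^esub> inv\<^bsub>F\<^esub> g) \<otimes>\<^bsub>F\<^esub> T)"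
    unfolding lu lv T_def using ab ghl by (simp add: F.m_assoc)
  finally have eq: "loop_of (u @ v) = \<dots>" .
  have "fa (loop_of (u @ v)) \<le> fa (loop_of u) + fa ((g \<otimes>\<^bsub>F\<^esub> loop_of v \<otimes>\<^bsub>F\<^esub> inv\<^bsub>F\<^esub> g) \<otimes>\<^bsub>F\<^esub> T)"
    unfolding eq by (intro fa_mult R_mult R_conj' loop_of_R u v TR ghl)
  also have "fa ((g \<otimes>\<^bsub>F\<^esub> loop_of v \<otimes>\<^bsub>F\<^esub> inv\<^bsub>F\<^esub> g) \<otimes>\<^bsub>F\<^esub> T) \<le> fa (g \<otimes>\<^bsub>F\<^esub> loop_of v \<otimes>\<^bsub>F\<^esub> inv\<^bsub>F\<^esub> g) + fa T"
    by (intro fa_mult R_conj' loop_of_R v TR ghl)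
  also have "fa (g \<otimes>\<^bsub>F\<^esub> loop_of v \<otimes>\<^bsub>F\<^esub> inv\<^bsub>F\<^esub> g) \<le> fa (loop_of v)"
    by (rule fa_conj'[OF loop_of_R[OF v] ghl(1)])
  finally have "real (fa (loop_of (u @ v))) \<le> real (fa (loop_of u)) + real (fa (loop_of v)) + real (fa T)"
    by simp
  then show ?thesis using faT by (simp add: x_def y_def)
qed

lemma lazy_loops_eq: "lazy_loops d rs n = {a. set a \<subseteq> S \<and> length a = n \<and> lazy_elem a = \<one>\<^bsub>G\<^esub>}"
  using f_ker[OF lazy_carrier] f_lazy by (auto simp: lazy_loops_def S_def[symmetric] lazy_elem_def)

lemma segment_moment:
  "\<exists>C\<ge>0. \<forall>n i m. i + m \<le> n \<and> 1 \<le> m \<and> m < n \<and> n \<le> 4 * (n - m) \<longrightarrow>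
    (\<Sum>a\<in>lazy_loops d rs n. (1 + real (N.len (lazy_elem (take m (drop i a))))) powr k)
      \<le> C * real m powr (k / 2) * card (lazy_loops d rs n)"
proof -
  obtain D where "lazy_walk G (st ` S) S st iv None D" using lazy_walk by blast
  then interpret W: lazy_walk G "st ` S" S st iv None D .
  have L: "W.loops n = lazy_loops d rs n" for n
    by (auto simp: lazy_loops_eq W.loops_def W.W_def W.gval_def lazy_elem_def)
  have V: "W.gval = lazy_elem" by (auto simp: W.gval_def lazy_elem_def)
  show ?thesis using W.bridge_moment[of k] k unfolding L V by (auto intro: less_imp_le)
qed

text \<open>Stated for any g that satisfies the recursion, so that one induction serves both the
  power and n ln n. It runs over all segments at once, which is possible because the moments are
  uniform in the position i.\<close>

lemma averaged_halving:
  "\<exists>B\<ge>0. \<exists>D1\<ge>0. \<forall>g. (\<forall>m\<ge>2. g (m div 2) + g (m - m div 2) + B * real m powr (k / 2) \<le> g m) \<longrightarrow>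
    D1 \<le> g 1 \<longrightarrow> (\<forall>n\<ge>1. avg_dehn_function d rs n \<le> g n)"
proof -
  obtain C where C: "C \<ge> 0" "\<And>n i m. i + m \<le> n \<Longrightarrow> 1 \<le> m \<Longrightarrow> m < n \<Longrightarrow> n \<le> 4 * (n - m) \<Longrightarrow>
    (\<Sum>a\<in>lazy_loops d rs n. (1 + real (N.len (lazy_elem (take m (drop i a))))) powr k)
      \<le> C * real m powr (k / 2) * card (lazy_loops d rs n)"
    using segment_moment by blast
  define K where "K = A * 4 powr k"
  have K: "K \<ge> 0" using A by (simp add: K_def)
  \<comment> \<open>The factor 2 counts the two short sides, whose moments are both bounded by the
    one at length m.\<close>
  define B where "B = K * (2 * C)"
  have B: "B \<ge> 0" using K C by (simp add: B_def)
  define D1 where "D1 = (\<Sum>s\<in>S. real (fa (loop_of [s])))"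
  have D1: "D1 \<ge> 0" unfolding D1_def by (intro sum_nonneg) auto
  have finS: "finite S" by (simp add: S_def finite_letters)
  have "avg_dehn_function d rs n \<le> g n"
    if g: "\<And>m. m \<ge> 2 \<Longrightarrow> g (m div 2) + g (m - m div 2) + B * real m powr (k / 2) \<le> g m" "D1 \<le> g 1" and n: "n \<ge> 1"
    for g :: "nat \<Rightarrow> real" and n
  proof -
    define L where "L = lazy_loops d rs n"
    have finL: "finite L" unfolding L_def by (rule finite_lazy_loops)
    have L: "set a \<subseteq> S" "length a = n" "lazy_elem a = \<one>\<^bsub>G\<^esub>" if "a \<in> L" for a
      using that by (auto simp: L_def lazy_loops_eq)
    have cL: "real (card L) > 0" using finL lazy_loops_nonempty[of d rs n] by (simp add: L_def card_gt_0_iff)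
    define sg where "sg = (\<lambda>i m. \<Sum>a\<in>L. real (fa (loop_of (take m (drop i a)))))"
    have seg: "m \<ge> 1 \<Longrightarrow> i + m \<le> n \<Longrightarrow> sg i m \<le> g m * card L" for i m
    proof (induction m arbitrary: i rule: less_induct)
      case (less m)
      show ?case
      proof (cases "m = 1")
        case True
        have "sg i m \<le> (\<Sum>a\<in>L. D1)" unfolding sg_def
        proof (rule sum_mono)
          fix a assume a: "a \<in> L"
          have i: "i < length a" using less.prems True L[OF a] by simp
          then have "a ! i \<in> S" using L(1)[OF a] nth_mem by blast
          then have "real (fa (loop_of [a ! i])) \<le> D1" unfolding D1_def using finS
            by (intro member_le_sum[of "a ! i" S "\<lambda>s. real (fa (loop_of [s]))"]) auto
          moreover have "take m (drop i a) = [a ! i]" using True i by (simp add: take_Suc_conv_app_nth hd_drop_conv_nth take_Suc)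
          ultimately show "real (fa (loop_of (take m (drop i a)))) \<le> D1" by simp
        qed
        also have "\<dots> = D1 * card L" by simp
        also have "\<dots> \<le> g 1 * card L" using g(2) by (intro mult_right_mono) auto
        finally show ?thesis using True by simp
      next
        case False
        define m1 m2 where "m1 = m div 2" and "m2 = m - m div 2"
        have m: "m \<ge> 2" "m1 \<ge> 1" "m2 \<ge> 1" "m1 < m" "m2 < m" "m = m1 + m2"
          using False less.prems by (auto simp: m1_def m2_def)
        \<comment> \<open>A half has at most (n + 1) / 2 letters, so at least (n - 1) / 2 \<ge> n /
          4 letters remain, as n \<ge> 2. This is the origin of the factor 4 in
          \<open>segment_moment\<close>.\<close>
        have "2 * m1 \<le> m" "2 * m2 \<le> m + 1" by (simp_all add: m1_def m2_def)
        moreover have "m \<le> n" "n \<ge> 2" using less.prems m by auto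
        ultimately have "2 * m1 \<le> n + 1" "2 * m2 \<le> n + 1" by linarith+
        with \<open>n \<ge> 2\<close> have h: "m1 < n" "m2 < n" "n \<le> 4 * (n - m1)" "n \<le> 4 * (n - m2)" by linarith+
        have "sg i m \<le> (\<Sum>a\<in>L. real (fa (loop_of (take m1 (drop i a)))) + real (fa (loop_of (take m2 (drop (i + m1) a)))) +
          K * ((1 + real (N.len (lazy_elem (take m1 (drop i a))))) powr k + (1 + real (N.len (lazy_elem (take m2 (drop (i + m1) a))))) powr k))"
          unfolding sg_def
        proof (rule sum_mono)
          fix a assume a: "a \<in> L"
          have sub: "set (take j (drop i a)) \<subseteq> S" for i j
            using L(1)[OF a] set_take_subset[of j "drop i a"] set_drop_subset[of i a] by blast
          have "take m (drop i a) = take m1 (drop i a) @ take m2 (drop (i + m1) a)"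
            unfolding m(6) take_add by (simp add: add.commute)
          then show "real (fa (loop_of (take m (drop i a)))) \<le> real (fa (loop_of (take m1 (drop i a)))) + real (fa (loop_of (take m2 (drop (i + m1) a)))) +
            K * ((1 + real (N.len (lazy_elem (take m1 (drop i a))))) powr k + (1 + real (N.len (lazy_elem (take m2 (drop (i + m1) a))))) powr k)"
            unfolding K_def using fa_loop_append[OF sub sub] by simp
        qed
        also have "\<dots> = sg i m1 + sg (i + m1) m2 + K * ((\<Sum>a\<in>L. (1 + real (N.len (lazy_elem (take m1 (drop i a))))) powr k) +
            (\<Sum>a\<in>L. (1 + real (N.len (lazy_elem (take m2 (drop (i + m1) a))))) powr k))"
          by (simp only: sg_def sum.distrib sum_distrib_left[symmetric])
        also have "\<dots> \<le> g m1 * card L + g m2 * card L + K * (C * real m powr (k / 2) * card L + C * real m powr (k / 2) * card L)"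
        proof (intro add_mono mult_left_mono K)
          show "sg i m1 \<le> g m1 * card L" using less.prems m by (intro less.IH) auto
          show "sg (i + m1) m2 \<le> g m2 * card L" using less.prems m by (intro less.IH) auto
          have mono: "C * real j powr (k / 2) * card L \<le> C * real m powr (k / 2) * card L" if "j \<le> m" for j
            using that k C by (intro mult_right_mono mult_left_mono powr_mono2) auto
          have "(\<Sum>a\<in>L. (1 + real (N.len (lazy_elem (take m1 (drop i a))))) powr k) \<le> C * real m1 powr (k / 2) * card L"
            unfolding L_def using less.prems m h by (intro C(2)) auto
          also have "\<dots> \<le> C * real m powr (k / 2) * card L" using m by (intro mono) auto
          finally show "(\<Sum>a\<in>L. (1 + real (N.len (lazy_elem (take m1 (drop i a))))) powr k) \<le> C * real m powr (k / 2) * card L" .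
          have "(\<Sum>a\<in>L. (1 + real (N.len (lazy_elem (take m2 (drop (i + m1) a))))) powr k) \<le> C * real m2 powr (k / 2) * card L"
            unfolding L_def using less.prems m h by (intro C(2)) auto
          also have "\<dots> \<le> C * real m powr (k / 2) * card L" using m by (intro mono) auto
          finally show "(\<Sum>a\<in>L. (1 + real (N.len (lazy_elem (take m2 (drop (i + m1) a))))) powr k) \<le> C * real m powr (k / 2) * card L" .
        qed
        also have "\<dots> = (g m1 + g m2 + B * real m powr (k / 2)) * card L" by (simp add: B_def algebra_simps)
        also have "\<dots> \<le> g m * card L" using g(1)[OF m(1)] by (intro mult_right_mono) (auto simp: m1_def m2_def)
        finally show ?thesis .
      qed
    qed
    have "avg_dehn_function d rs n = (\<Sum>a\<in>L. real (fa (lazy_value d a)) / card L)"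
      unfolding avg_dehn_function_def L_def[symmetric]
      using finL lazy_loops_nonempty[of d rs n] by (intro sum.cong refl) (simp add: L_def)
    also have "\<dots> = sg 0 n / card L"
      unfolding sum_divide_distrib[symmetric] sg_def
    proof (intro arg_cong2[of _ _ _ _ "(/)"] sum.cong refl)
      fix a assume a: "a \<in> L"
      have "loop_of a = lazy_value d a"
        unfolding loop_of_def L(3)[OF a] geo_one using F.inv_one lazy_carrier[OF L(1)[OF a]] F.r_one by (simp add: free_one)
      then show "real (fa (lazy_value d a)) = real (fa (loop_of (take n (drop 0 a))))" using L(2)[OF a] by simp
    qed
    also have "\<dots> \<le> g n" using seg[of n 0] n cL by (simp add: divide_le_eq)
    finally show ?thesis .
  qed
  then show ?thesis using B D1 by (intro exI[of _ B] conjI exI[of _ D1]) auto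
qed

lemma averaged_powr:
  assumes "k > 2"
  shows "avg_dehn_function d rs \<in> O(\<lambda>n. real n powr (k / 2))"
proof -
  obtain B D1 where B: "B \<ge> 0" "D1 \<ge> 0"
    "\<And>g. (\<forall>m\<ge>2. g (m div 2) + g (m - m div 2) + B * real m powr (k / 2) \<le> g m) \<Longrightarrow>
      D1 \<le> g 1 \<Longrightarrow> (\<forall>n\<ge>1. avg_dehn_function d rs n \<le> g n)"
    using averaged_halving by blast
  obtain M where M: "M \<ge> D1" "\<forall>m\<ge>2. M * real (m div 2) powr (k / 2) + M * real (m - m div 2) powr (k / 2) + B * real m powr (k / 2) \<le> M * real m powr (k / 2)"
    using halving_recursion_powr[of "k / 2" B D1] B assms by auto
  have le: "\<forall>n\<ge>1. avg_dehn_function d rs n \<le> M * real n powr (k / 2)"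
    by (rule B(3)) (use M in auto)
  show ?thesis
  proof (rule bigoI[of _ M])
    show "\<forall>\<^sub>F n in sequentially. norm (avg_dehn_function d rs n) \<le> M * norm (real n powr (k / 2))"
      using eventually_ge_at_top[of 1]
    proof eventually_elim
      case (elim n)
      have "avg_dehn_function d rs n \<ge> 0" unfolding avg_dehn_function_def by (intro sum_nonneg) auto
      then show ?case using le elim by simp
    qed
  qed
qed

lemma averaged_ln:
  assumes "k = 2"
  shows "avg_dehn_function d rs \<in> O(\<lambda>n. real n * ln (real n))"
proof -
  obtain B D1 where B: "B \<ge> 0" "D1 \<ge> 0"
    "\<And>g. (\<forall>m\<ge>2. g (m div 2) + g (m - m div 2) + B * real m powr (k / 2) \<le> g m) \<Longrightarrow>
      D1 \<le> g 1 \<Longrightarrow> (\<forall>n\<ge>1. avg_dehn_function d rs n \<le> g n)"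
    using averaged_halving by blast
  define E where "E = B / ln (3 / 2)"
  \<comment> \<open>The linear term provides g 1 = D1, since ln 1 = 0, and it is additive under
    halving.\<close>
  have le: "\<forall>n\<ge>1. avg_dehn_function d rs n \<le> D1 * real n + E * (real n * ln (real n))"
  proof (rule B(3))
    show "\<forall>m\<ge>2. D1 * real (m div 2) + E * (real (m div 2) * ln (real (m div 2))) +
        (D1 * real (m - m div 2) + E * (real (m - m div 2) * ln (real (m - m div 2)))) + B * real m powr (k / 2)
        \<le> D1 * real m + E * (real m * ln (real m))"
    proof (intro allI impI)
      fix m :: nat assume m: "m \<ge> 2"
      have "D1 * real (m div 2) + D1 * real (m - m div 2) = D1 * real m"
        by (simp flip: distrib_left of_nat_add)
      then show "D1 * real (m div 2) + E * (real (m div 2) * ln (real (m div 2))) +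
        (D1 * real (m - m div 2) + E * (real (m - m div 2) * ln (real (m - m div 2)))) + B * real m powr (k / 2)
        \<le> D1 * real m + E * (real m * ln (real m))"
        using halving_recursion_ln[OF B(1) m] assms unfolding E_def by simp
    qed
  qed simp
  show ?thesis
  proof (rule bigoI[of _ "D1 + E"])
    show "\<forall>\<^sub>F n in sequentially. norm (avg_dehn_function d rs n) \<le> (D1 + E) * norm (real n * ln (real n))"
      \<comment> \<open>From n = 3 on, ln n \<ge> 1, which lets n ln n absorb the linear
        term.\<close>
      using eventually_ge_at_top[of 3]
    proof eventually_elim
      case (elim n)
      have "avg_dehn_function d rs n \<ge> 0" unfolding avg_dehn_function_def by (intro sum_nonneg) auto
      have "exp 1 \<le> real n" using exp_le elim by linarith
      then have l: "1 \<le> ln (real n)" using elim by (subst ln_ge_iff) auto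
      then have "D1 * real n \<le> D1 * (real n * ln (real n))"
        using B by (intro mult_left_mono) (auto simp: mult_le_cancel_left1)
      moreover have "avg_dehn_function d rs n \<le> D1 * real n + E * (real n * ln (real n))" using le elim by simp
      moreover have "norm (real n * ln (real n)) = real n * ln (real n)" using l by simp
      ultimately show ?case using \<open>avg_dehn_function d rs n \<ge> 0\<close> by (simp only: real_norm_def distrib_right)
    qed
  qed
qed

end

theorem theorem1:
  fixes G :: "('a, 'b) monoid_scheme" and k :: real
    and d\<^sub>0 :: nat and rs\<^sub>0 :: "letter list list"
  assumes "finitely_generated_group G" and "nilpotent_group G"
    and "k \<ge> 2"
    and "finite_presentation_of G d\<^sub>0 rs\<^sub>0"
    and "(\<lambda>n. real (dehn_function d\<^sub>0 rs\<^sub>0 n)) \<in> O(\<lambda>n. real n powr k)"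
  shows "\<forall>d rs. finite_presentation_of G d rs \<longrightarrow>
    (k > 2 \<longrightarrow> avg_dehn_function d rs \<in> O(\<lambda>n. real n powr (k / 2))) \<and>
    (k = 2 \<longrightarrow> avg_dehn_function d rs \<in> O(\<lambda>n. real n * ln (real n)))"
proof (intro allI impI)
  fix d rs assume fp: "finite_presentation_of G d rs"
  have G: "group G" using assms(2) by (simp add: nilpotent_group_def)
  obtain c where c: "lower_central G c = {\<one>\<^bsub>G\<^esub>}" using assms(2) by (auto simp: nilpotent_group_def)
  have rs0: "set rs\<^sub>0 \<subseteq> carrier (free_group d\<^sub>0)" and rs: "set rs \<subseteq> carrier (free_group d)"
    using assms(4) fp by (auto simp: finite_presentation_of_def)
  obtain C where C: "C \<ge> 0" "\<And>n w. w \<in> relations d\<^sub>0 rs\<^sub>0 \<inter> word_ball d\<^sub>0 n \<Longrightarrow>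
      real (filling_area d\<^sub>0 rs\<^sub>0 w) \<le> C * (1 + real n) powr k"
    using dehn_bound[OF rs0 _ assms(5)] assms(3) by auto
  obtain A where A: "A \<ge> 0" "\<And>n w. w \<in> relations d rs \<inter> word_ball d n \<Longrightarrow>
      real (filling_area d rs w) \<le> A * (1 + real n) powr k"
    using area_change_of_presentation[OF G assms(4) fp _ C(2,1)] assms(3) by auto
  obtain f where f: "f \<in> hom (free_group d) G" "f ` carrier (free_group d) = carrier G"
    "\<And>w. w \<in> carrier (free_group d) \<Longrightarrow> f w = \<one>\<^bsub>G\<^esub> \<longleftrightarrow> w \<in> relations d rs"
    using presentation_hom[OF G fp] by blast
  interpret nilpotent_presentation d rs G f k A c
    by (intro nilpotent_presentation.intro presentation.intro nilpotent_presentation_axioms.intro)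
      (fact rs G f assms(3) A c)+
  show "(k > 2 \<longrightarrow> avg_dehn_function d rs \<in> O(\<lambda>n. real n powr (k / 2))) \<and>
    (k = 2 \<longrightarrow> avg_dehn_function d rs \<in> O(\<lambda>n. real n * ln (real n)))"
    using averaged_powr averaged_ln by blast
qed

end
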